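(* In the volatility-regression setting of the context, with $\sigma(x,\theta)=\exp(x'\theta/2)$, suppose that (V1) and (V2) hold. Then the hypotheses of the general stochastic expansion of the marginal quasi-log likelihood are satisfied with rate matrix $A_n=n^{-1/2}I_p$; that is, $\mathbb{H}_n$ satisfies (A1) and (A3) of the context and $\hat\theta_n\to\theta_0$ in probability (so that for any prior densities $\pi_n$ satisfying (A2) of the context and $\log\pi_n(\hat\theta_n)=\log\pi_n(\theta_0)+o_p(1)$ all those hypotheses hold). The corresponding QBIC, defined as $-2\mathbb{H}_n(\hat\theta_n)+\log|-\partial_\theta^2\mathbb{H}_n(\hat\theta_n)|$, is given by $$\mathrm{QBIC}_n=\sum_{j=1}^n\Big\{X_{t_{j-1}}'\hat\theta_n+\frac1{h_n}(\Delta_jY)^2\exp(-X_{t_{j-1}}'\hat\theta_n)\Big\}+\log\bigg|\frac1{2h_n}\sum_{j=1}^n(\Delta_jY)^2\exp(-X_{t_{j-1}}'\hat\theta_n)X_{t_{j-1}}X_{t_{j-1}}'\bigg| .$$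
   Context: Setting. On a filtered probability space $(\Omega,\mathcal{F},(\mathcal{F}_t)_{t\le T},\mathbb{P})$ with $T>0$ fixed, let $$dY_t=b_tdt+\sigma(X_t,\theta_0)dw_t,\qquad t\in[0,T],$$ where $w$ is a one-dimensional standard Wiener process, $b$ (real valued, unobserved and unknown) and $X$ (values in $\mathbb{R}^p$) are progressively measurable processes, $\sigma(x,\theta)=\exp(x'\theta/2)$, $'$ denotes transpose, $\theta\in\Theta$ with $\Theta\subset\mathbb{R}^p$ a bounded convex domain, and $\theta_0\in\Theta$ is the true value. The data are $\mathbf{X}_n=(X_{t_j},Y_{t_j})_{j=0}^n$ with $t_j=jh_n$, $h_n=T/n$. Put $\Delta_jY=Y_{t_j}-Y_{t_{j-1}}$ and $$\mathbb{H}_n(\theta)=-\frac12\sum_{j=1}^n\Big\{X_{t_{j-1}}'\theta+\frac1{h_n}(\Delta_jY)^2\exp(-X_{t_{j-1}}'\theta)\Big\};$$ $\hat\theta_n$ is any maximizer of $\mathbb{H}_n$ over $\bar\Theta$. $|M|=\det M$ for a square matrix $M$; $\lambda_{\min}$ is the smallest eigenvalue. (V1) For every $q>0$: $\mathbb{E}(|X_0|^q)<\infty$; there is $C>0$ with $\mathbb{E}(|X_t-X_s|^q)<C|t-s|^{q/2}$ for all $s,t\in[0,T]$; and $\sup_{0\le t\le T}\mathbb{E}(|b_t|^q)<\infty$. (V2) (i) $\sup_{\omega\in\Omega}\sup_{t\le T}|X_t|<\infty$; (ii) for every $L>0$ there is $C_L>0$ such that for all $r>0$, $\mathbb{P}\big\{\lambda_{\min}\big(\int_0^TX_tX_t'dt\big)\le\frac1r\big\}\le\frac{C_L}{r^L}$.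 General conditions, with $A_n=n^{-1/2}I_p$, $\mathbb{U}_n=\{u\in\mathbb{R}^p:\theta_0+A_nu\in\Theta\}$ and $\mathbb{Z}_n(u)=\exp\{\mathbb{H}_n(\theta_0+A_nu)-\mathbb{H}_n(\theta_0)\}$: (A1) $\mathbb{H}_n$ is of class $\mathcal{C}^3(\Theta)$; $A_n\partial_\theta\mathbb{H}_n(\theta_0)=O_p(1)$; $-A_n\partial_\theta^2\mathbb{H}_n(\theta_0)A_n=\Gamma_0+o_p(1)$ for some (possibly random) a.s. positive definite $\Gamma_0$; and $\max_{i,j,k\le p}\sup_\theta|n^{-3/2}\partial_{\theta^i}\partial_{\theta^j}\partial_{\theta^k}\mathbb{H}_n(\theta)|=o_p(1)$. (A2) $\pi_n(\theta_0)>0$ for all $n$, $\sup_n\sup_\theta\pi_n(\theta)<\infty$, and $\sup_{|u|<M}|\pi_n(\theta_0+A_nu)-\pi_n(\theta_0)|\to0$ for each $M>0$. (A3) For any $\epsilon>0$ there exist $M>0$ and $N$ such that $\sup_{n\ge N}\mathbb{P}\big(\int_{\mathbb{U}_n\cap\{|u|\ge M\}}\mathbb{Z}_n(u)du>\epsilon\big)<\epsilon$. *)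

theory Defs
  imports "HOL-Probability.Probability"
begin

section \<open>Stochastic orders\<close>

text \<open>Probabilities of events that involve a maximizer are taken as outer probabilities, so that
  no measurable selection of the maximizer has to be postulated; on measurable events
  \<^const>\<open>outer_measure_of\<close> is just \<^const>\<open>emeasure\<close>. The magnitude of a remainder is an
  \<^typ>\<open>ennreal\<close>, so an infinite magnitude counts as large.\<close>

definition vanishes_in_prob :: "'a measure \<Rightarrow> (nat \<Rightarrow> 'a \<Rightarrow> ennreal) \<Rightarrow> bool" where
  "vanishes_in_prob M Z \<longleftrightarrow>
     (\<forall>\<epsilon>::real. \<epsilon> > 0 \<longrightarrow>
        (\<lambda>n. outer_measure_of M {\<omega> \<in> space M. Z n \<omega> > ennreal \<epsilon>}) \<longlonglongrightarrow> 0)"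

definition converges_in_prob ::
    "'a measure \<Rightarrow> (nat \<Rightarrow> 'a \<Rightarrow> 'b::real_normed_vector) \<Rightarrow> ('a \<Rightarrow> 'b) \<Rightarrow> bool" where
  "converges_in_prob M Z L \<longleftrightarrow> vanishes_in_prob M (\<lambda>n \<omega>. ennreal (norm (Z n \<omega> - L \<omega>)))"

definition bounded_in_prob ::
    "'a measure \<Rightarrow> (nat \<Rightarrow> 'a \<Rightarrow> 'b::real_normed_vector) \<Rightarrow> bool" where
  "bounded_in_prob M Z \<longleftrightarrow>
     (\<forall>\<epsilon>::real. \<epsilon> > 0 \<longrightarrow> (\<exists>K. \<forall>\<^sub>F n in sequentially.
        outer_measure_of M {\<omega> \<in> space M. norm (Z n \<omega>) > K} < ennreal \<epsilon>))"


section \<open>Filtrations, Wiener processes and the Ito integral on a finite horizon\<close>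

definition filtration_upto :: "'a measure \<Rightarrow> real \<Rightarrow> (real \<Rightarrow> 'a measure) \<Rightarrow> bool" where
  "filtration_upto M T F \<longleftrightarrow>
     (\<forall>t\<in>{0..T}. subalgebra M (F t)) \<and>
     (\<forall>s\<in>{0..T}. \<forall>t\<in>{0..T}. s \<le> t \<longrightarrow> subalgebra (F t) (F s))"

definition progressive_upto ::
    "real \<Rightarrow> (real \<Rightarrow> 'a measure) \<Rightarrow> (real \<Rightarrow> 'a \<Rightarrow> 'b::topological_space) \<Rightarrow> bool" where
  "progressive_upto T F Z \<longleftrightarrow>
     (\<forall>t\<in>{0..T}. (\<lambda>(s, \<omega>). Z s \<omega>) \<in> borel_measurable (restrict_space borel {0..t} \<Otimes>\<^sub>M F t))"

definition wiener_process ::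
    "'a measure \<Rightarrow> real \<Rightarrow> (real \<Rightarrow> 'a measure) \<Rightarrow> (real \<Rightarrow> 'a \<Rightarrow> real) \<Rightarrow> bool" where
  "wiener_process M T F w \<longleftrightarrow>
     (\<forall>t\<in>{0..T}. w t \<in> borel_measurable (F t)) \<and>
     (AE \<omega> in M. w 0 \<omega> = 0) \<and>
     (AE \<omega> in M. continuous_on {0..T} (\<lambda>t. w t \<omega>)) \<and>
     (\<forall>s\<in>{0..T}. \<forall>t\<in>{0..T}. s < t \<longrightarrow>
        prob_space.indep_set M (sets (F s))
          {(\<lambda>\<omega>. w t \<omega> - w s \<omega>) -` B \<inter> space M |B. B \<in> sets borel} \<and>
        distributed M lborel (\<lambda>\<omega>. w t \<omega> - w s \<omega>) (normal_density 0 (sqrt (t - s))))"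

text \<open>A simple integrand takes the value \<open>\<xi> i\<close> on the interval from \<open>s i\<close> (exclusive) to
  \<open>s (Suc i)\<close> (inclusive), for \<open>i < m\<close>.\<close>

definition simple_integrand ::
    "real \<Rightarrow> (real \<Rightarrow> 'a measure) \<Rightarrow> nat \<Rightarrow> (nat \<Rightarrow> real) \<Rightarrow> (nat \<Rightarrow> 'a \<Rightarrow> real) \<Rightarrow> bool" where
  "simple_integrand T F m s \<xi> \<longleftrightarrow>
     (\<forall>i\<le>m. s i \<in> {0..T}) \<and> (\<forall>i<m. s i \<le> s (Suc i)) \<and>
     (\<forall>i<m. \<xi> i \<in> borel_measurable (F (s i)) \<and> bounded (\<xi> i ` space (F (s i))))"

definition simple_value ::
    "nat \<Rightarrow> (nat \<Rightarrow> real) \<Rightarrow> (nat \<Rightarrow> 'a \<Rightarrow> real) \<Rightarrow> real \<Rightarrow> 'a \<Rightarrow> real" where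
  "simple_value m s \<xi> t \<omega> = (\<Sum>i<m. \<xi> i \<omega> * indicator {s i<..s (Suc i)} t)"

definition simple_integral ::
    "(real \<Rightarrow> 'a \<Rightarrow> real) \<Rightarrow> nat \<Rightarrow> (nat \<Rightarrow> real) \<Rightarrow> (nat \<Rightarrow> 'a \<Rightarrow> real) \<Rightarrow> real \<Rightarrow> 'a \<Rightarrow> real" where
  "simple_integral w m s \<xi> t \<omega> =
     (\<Sum>i<m. \<xi> i \<omega> * (w (min t (s (Suc i))) \<omega> - w (min t (s i)) \<omega>))"

text \<open>\<open>I\<close> is (a version of) the process of indefinite integrals of \<open>H\<close> with respect to \<open>w\<close> on
  the horizon \<open>T\<close>: an almost surely continuous process that is, at every time, the limit in
  probability of the integrals of simple integrands approximating \<open>H\<close> in the \<open>L\<^sup>2\<close> distance on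
  the time interval, in probability. This determines \<open>I\<close> up to indistinguishability.\<close>

definition ito_integral ::
    "'a measure \<Rightarrow> real \<Rightarrow> (real \<Rightarrow> 'a measure) \<Rightarrow> (real \<Rightarrow> 'a \<Rightarrow> real) \<Rightarrow>
     (real \<Rightarrow> 'a \<Rightarrow> real) \<Rightarrow> (real \<Rightarrow> 'a \<Rightarrow> real) \<Rightarrow> bool" where
  "ito_integral M T F w H I \<longleftrightarrow>
     (\<forall>t\<in>{0..T}. I t \<in> borel_measurable M) \<and>
     (AE \<omega> in M. continuous_on {0..T} (\<lambda>t. I t \<omega>)) \<and>
     (\<exists>m s \<xi>.
        (\<forall>k. simple_integrand T F (m k) (s k) (\<xi> k)) \<and>
        vanishes_in_prob M
          (\<lambda>k \<omega>. \<integral>\<^sup>+t\<in>{0..T}. ennreal ((simple_value (m k) (s k) (\<xi> k) t \<omega> - H t \<omega>)\<^sup>2) \<partial>lborel) \<and>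
        (\<forall>t\<in>{0..T}. converges_in_prob M (\<lambda>k. simple_integral w (m k) (s k) (\<xi> k) t) (I t)))"

text \<open>\<open>dY = b dt + H dw\<close> on the interval from \<open>0\<close> to \<open>T\<close>.\<close>

definition ito_process ::
    "'a measure \<Rightarrow> real \<Rightarrow> (real \<Rightarrow> 'a measure) \<Rightarrow> (real \<Rightarrow> 'a \<Rightarrow> real) \<Rightarrow>
     (real \<Rightarrow> 'a \<Rightarrow> real) \<Rightarrow> (real \<Rightarrow> 'a \<Rightarrow> real) \<Rightarrow> (real \<Rightarrow> 'a \<Rightarrow> real) \<Rightarrow> bool" where
  "ito_process M T F w b H Y \<longleftrightarrow>
     (\<forall>t\<in>{0..T}. Y t \<in> borel_measurable M) \<and>
     (\<exists>I. ito_integral M T F w H I \<and>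
        (AE \<omega> in M. set_integrable lborel {0..T} (\<lambda>s. b s \<omega>) \<and>
           (\<forall>t\<in>{0..T}. Y t \<omega> = Y 0 \<omega> + (LINT s:{0..t}|lborel. b s \<omega>) + I t \<omega>)))"


section \<open>Matrices and derivatives\<close>

definition outer_square :: "real^'p \<Rightarrow> real^'p^'p" where
  "outer_square x = (\<chi> i j. x $ i * x $ j)"

definition min_eigenvalue :: "real^'p^'p \<Rightarrow> real" where
  "min_eigenvalue A = Min {l. \<exists>v. v \<noteq> 0 \<and> A *v v = l *\<^sub>R v}"

definition positive_definite :: "real^'p^'p \<Rightarrow> bool" where
  "positive_definite A \<longleftrightarrow> transpose A = A \<and> (\<forall>x. x \<noteq> 0 \<longrightarrow> x \<bullet> (A *v x) > 0)"

definition partial :: "'p::finite \<Rightarrow> (real^'p \<Rightarrow> real) \<Rightarrow> real^'p \<Rightarrow> real" where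
  "partial i f x = deriv (\<lambda>t. f (x + t *\<^sub>R axis i 1)) 0"

definition grad :: "(real^'p \<Rightarrow> real) \<Rightarrow> real^'p::finite \<Rightarrow> real^'p" where
  "grad f x = (\<chi> i. partial i f x)"

definition hessian :: "(real^'p \<Rightarrow> real) \<Rightarrow> real^'p::finite \<Rightarrow> real^'p^'p" where
  "hessian f x = (\<chi> i j. partial i (partial j f) x)"

text \<open>\<open>k\<close> times continuously differentiable, for open \<open>S\<close>.\<close>

primrec Ck_on :: "nat \<Rightarrow> (real^'p::finite \<Rightarrow> real) \<Rightarrow> (real^'p) set \<Rightarrow> bool" where
  "Ck_on 0 f S \<longleftrightarrow> continuous_on S f"
| "Ck_on (Suc k) f S \<longleftrightarrow> f differentiable_on S \<and> (\<forall>i. Ck_on k (partial i f) S)"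


section \<open>Volatility regression\<close>

definition vol :: "real^'p \<Rightarrow> real^'p \<Rightarrow> real" where
  "vol x \<theta> = exp ((x \<bullet> \<theta>) / 2)"

definition step :: "real \<Rightarrow> nat \<Rightarrow> real" where
  "step T n = T / real n"

definition obs_time :: "real \<Rightarrow> nat \<Rightarrow> nat \<Rightarrow> real" where
  "obs_time T n j = real j * step T n"

definition increment :: "real \<Rightarrow> (real \<Rightarrow> 'a \<Rightarrow> real) \<Rightarrow> nat \<Rightarrow> nat \<Rightarrow> 'a \<Rightarrow> real" where
  "increment T Y n j \<omega> = Y (obs_time T n j) \<omega> - Y (obs_time T n (j - 1)) \<omega>"

definition quasi_loglik ::
    "real \<Rightarrow> (real \<Rightarrow> 'a \<Rightarrow> real^'p) \<Rightarrow> (real \<Rightarrow> 'a \<Rightarrow> real) \<Rightarrow> nat \<Rightarrow> 'a \<Rightarrow> real^'p \<Rightarrow> real" where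
  "quasi_loglik T X Y n \<omega> \<theta> =
     - (1/2) * (\<Sum>j=1..n. X (obs_time T n (j - 1)) \<omega> \<bullet> \<theta> +
         1 / step T n * (increment T Y n j \<omega>)\<^sup>2 * exp (- (X (obs_time T n (j - 1)) \<omega> \<bullet> \<theta>)))"

text \<open>The moment bound on increments is not strict, since both sides are \<open>0\<close> for \<open>s = t\<close>.
  Moments are nonnegative integrals, hence infinite (not \<open>0\<close>) without integrability.\<close>

definition cond_V1 ::
    "'a measure \<Rightarrow> real \<Rightarrow> (real \<Rightarrow> 'a \<Rightarrow> real^'p) \<Rightarrow> (real \<Rightarrow> 'a \<Rightarrow> real) \<Rightarrow> bool" where
  "cond_V1 M T X b \<longleftrightarrow> (\<forall>q>0.
     (\<integral>\<^sup>+\<omega>. ennreal (norm (X 0 \<omega>) powr q) \<partial>M) < \<infinity> \<and>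
     (\<exists>C>0. \<forall>s\<in>{0..T}. \<forall>t\<in>{0..T}.
        (\<integral>\<^sup>+\<omega>. ennreal (norm (X t \<omega> - X s \<omega>) powr q) \<partial>M) \<le> ennreal (C * \<bar>t - s\<bar> powr (q/2))) \<and>
     (SUP t\<in>{0..T}. \<integral>\<^sup>+\<omega>. ennreal (\<bar>b t \<omega>\<bar> powr q) \<partial>M) < \<infinity>)"

definition cond_V2 :: "'a measure \<Rightarrow> real \<Rightarrow> (real \<Rightarrow> 'a \<Rightarrow> real^'p) \<Rightarrow> bool" where
  "cond_V2 M T X \<longleftrightarrow>
     bounded {X t \<omega> |t \<omega>. t \<in> {0..T} \<and> \<omega> \<in> space M} \<and>
     (\<forall>L>0. \<exists>C>0. \<forall>r>0.
        measure M {\<omega> \<in> space M.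
          min_eigenvalue (LINT t:{0..T}|lborel. outer_square (X t \<omega>)) \<le> 1 / r} \<le> C / r powr L)"


section \<open>Hypotheses of the expansion of the marginal quasi-log likelihood\<close>

text \<open>Below, \<open>H n \<omega> \<theta>\<close> is a quasi-log likelihood, \<open>\<theta>h n \<omega>\<close> an estimator and \<open>\<pi> n\<close> a prior
  density; only indices \<open>n \<ge> 1\<close> matter.\<close>

definition rate_matrix :: "nat \<Rightarrow> real^'p^'p" where
  "rate_matrix n = mat (real n powr (-1/2))"

definition cond_A1 ::
    "'a measure \<Rightarrow> (real^'p) set \<Rightarrow> real^'p \<Rightarrow> (nat \<Rightarrow> 'a \<Rightarrow> real^'p::finite \<Rightarrow> real) \<Rightarrow> bool" where
  "cond_A1 M \<Theta> \<theta>0 H \<longleftrightarrow>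
     (\<forall>n\<ge>1. \<forall>\<omega>\<in>space M. Ck_on 3 (H n \<omega>) \<Theta>) \<and>
     bounded_in_prob M (\<lambda>n \<omega>. rate_matrix n *v grad (H n \<omega>) \<theta>0) \<and>
     (\<exists>\<Gamma> \<in> borel_measurable M.
        (AE \<omega> in M. positive_definite (\<Gamma> \<omega>)) \<and>
        converges_in_prob M
          (\<lambda>n \<omega>. - (rate_matrix n ** hessian (H n \<omega>) \<theta>0 ** rate_matrix n)) \<Gamma>) \<and>
     vanishes_in_prob M
       (\<lambda>n \<omega>. MAX (i, j, k) \<in> UNIV. SUP \<theta>\<in>\<Theta>.
          ennreal \<bar>real n powr (-3/2) * partial i (partial j (partial k (H n \<omega>))) \<theta>\<bar>)"

definition prior_densities :: "(real^'p) set \<Rightarrow> (nat \<Rightarrow> real^'p \<Rightarrow> real) \<Rightarrow> bool" where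
  "prior_densities \<Theta> \<pi> \<longleftrightarrow> (\<forall>n\<ge>1.
     \<pi> n \<in> borel_measurable (restrict_space borel \<Theta>) \<and> (\<forall>\<theta>\<in>\<Theta>. \<pi> n \<theta> \<ge> 0) \<and>
     (\<integral>\<^sup>+\<theta>\<in>\<Theta>. ennreal (\<pi> n \<theta>) \<partial>lborel) = 1)"

definition cond_A2 :: "(real^'p) set \<Rightarrow> real^'p \<Rightarrow> (nat \<Rightarrow> real^'p::finite \<Rightarrow> real) \<Rightarrow> bool" where
  "cond_A2 \<Theta> \<theta>0 \<pi> \<longleftrightarrow>
     (\<forall>n\<ge>1. \<pi> n \<theta>0 > 0) \<and>
     (SUP n\<in>{1..}. SUP \<theta>\<in>\<Theta>. ennreal (\<pi> n \<theta>)) < \<infinity> \<and>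
     (\<forall>K>0. (\<lambda>n. SUP u\<in>ball 0 K. ennreal \<bar>\<pi> n (\<theta>0 + rate_matrix n *v u) - \<pi> n \<theta>0\<bar>)
        \<longlonglongrightarrow> 0)"

definition local_params :: "(real^'p) set \<Rightarrow> real^'p \<Rightarrow> nat \<Rightarrow> (real^'p::finite) set" where
  "local_params \<Theta> \<theta>0 n = {u. \<theta>0 + rate_matrix n *v u \<in> \<Theta>}"

definition lik_ratio ::
    "real^'p \<Rightarrow> (nat \<Rightarrow> 'a \<Rightarrow> real^'p \<Rightarrow> real) \<Rightarrow> nat \<Rightarrow> 'a \<Rightarrow> real^'p::finite \<Rightarrow> real" where
  "lik_ratio \<theta>0 H n \<omega> u = exp (H n \<omega> (\<theta>0 + rate_matrix n *v u) - H n \<omega> \<theta>0)"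

definition cond_A3 ::
    "'a measure \<Rightarrow> (real^'p) set \<Rightarrow> real^'p \<Rightarrow> (nat \<Rightarrow> 'a \<Rightarrow> real^'p::finite \<Rightarrow> real) \<Rightarrow> bool" where
  "cond_A3 M \<Theta> \<theta>0 H \<longleftrightarrow>
     (\<forall>\<epsilon>::real. \<epsilon> > 0 \<longrightarrow> (\<exists>K>0. \<exists>N.
        (SUP n\<in>{N..}. outer_measure_of M {\<omega> \<in> space M.
           (\<integral>\<^sup>+u\<in>local_params \<Theta> \<theta>0 n \<inter> {u. norm u \<ge> K}. ennreal (lik_ratio \<theta>0 H n \<omega> u) \<partial>lborel)
             > ennreal \<epsilon>}) < ennreal \<epsilon>))"

text \<open>The logarithm with \<open>log 0 = -\<infinity>\<close>: the prior may vanish at the estimator, where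
  \<^term>\<open>ln (0::real) = 0\<close> would be misleading.\<close>

definition ext_log :: "real \<Rightarrow> ereal" where
  "ext_log x = (if x > 0 then ereal (ln x) else -\<infinity>)"

definition log_prior_consistent ::
    "'a measure \<Rightarrow> real^'p \<Rightarrow> (nat \<Rightarrow> 'a \<Rightarrow> real^'p) \<Rightarrow> (nat \<Rightarrow> real^'p \<Rightarrow> real) \<Rightarrow> bool" where
  "log_prior_consistent M \<theta>0 \<theta>h \<pi> \<longleftrightarrow>
     vanishes_in_prob M (\<lambda>n \<omega>. e2ennreal \<bar>ext_log (\<pi> n (\<theta>h n \<omega>)) - ext_log (\<pi> n \<theta>0)\<bar>)"

definition marginal_expansion_hyps ::
    "'a measure \<Rightarrow> (real^'p) set \<Rightarrow> real^'p \<Rightarrow> (nat \<Rightarrow> 'a \<Rightarrow> real^'p::finite \<Rightarrow> real) \<Rightarrow>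
     (nat \<Rightarrow> 'a \<Rightarrow> real^'p) \<Rightarrow> (nat \<Rightarrow> real^'p \<Rightarrow> real) \<Rightarrow> bool" where
  "marginal_expansion_hyps M \<Theta> \<theta>0 H \<theta>h \<pi> \<longleftrightarrow>
     cond_A1 M \<Theta> \<theta>0 H \<and> cond_A2 \<Theta> \<theta>0 \<pi> \<and> cond_A3 M \<Theta> \<theta>0 H \<and>
     converges_in_prob M \<theta>h (\<lambda>_. \<theta>0) \<and> log_prior_consistent M \<theta>0 \<theta>h \<pi>"

text \<open>\<open>f\<close> is the quasi-log likelihood at the data, \<open>\<theta>\<close> its maximizer.\<close>

definition qbic :: "(real^'p \<Rightarrow> real) \<Rightarrow> real^'p::finite \<Rightarrow> real" where
  "qbic f \<theta> = - 2 * f \<theta> + ln (det (- hessian f \<theta>))"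

end

theory Submission
  imports Defs "HOL-Real_Asymp.Real_Asymp"
begin

text \<open>Since \<open>X\<close> and the parameters are bounded, the Hessian of the (concave) quasi-log likelihood at
  any parameter is, as a quadratic form, at most a fixed positive multiple of the Hessian at
  \<open>\<theta>0\<close>. Hence, with the normalised score \<open>\<Delta>\<close> and the normalised observed information
  \<open>\<Gamma>\<close> at \<open>\<theta>0\<close>, the log-likelihood ratio at \<open>u\<close> is at most
  \<open>u \<bullet> \<Delta> - c * (u \<bullet> \<Gamma> u)\<close> on the whole parameter set. As \<open>\<Delta>\<close> is tight and
  \<open>\<Gamma>\<close> converges to the almost surely positive definite \<open>(1 / (2 * T)) * \<integral> X X'\<close>, this
  Gaussian bound gives (A3) and the consistency of the maximizer at once.

  The limits at \<open>\<theta>0\<close> follow from \<open>L\<^sup>1\<close> estimates. Write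
  \<open>\<Delta>Y = \<sigma> \<Delta>w + R\<close>, freezing \<open>\<sigma>\<close> at the left end point. The squares \<open>(\<Delta>w)\<^sup>2 - h\<close> are
  martingale differences, and \<open>R\<close> has second moment of order \<open>h\<^sup>2\<close>, so that the cross terms
  already have the right order after \<open>2 * \<bar>\<Delta>w * R\<bar> \<le> sqrt h * (\<Delta>w)\<^sup>2 + R\<^sup>2 / sqrt h\<close>. The
  second moment of the stochastic integral in \<open>R\<close> is bounded by stopping the approximating
  simple integrands before their energy becomes large.\<close>

text \<open>The shaping obstacle is that \<open>ito_integral\<close> provides limits in probability
  only, with no moments attached, whereas the estimates need a second moment. Stopping makes the
  approximants uniformly square integrable, truncation of the limit at a level \<open>L\<close>
  makes rare events negligible, and monotone convergence removes \<open>L\<close>; the price is a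
  factor 4. The weights X, X X' and 1 are bounded and known at the left end point, so one L1
  estimate of order sqrt n, uniform over such weights, serves the score, the observed information
  and the third derivatives. Moments are nonnegative integrals, so that estimates can be chained
  before integrability is known. Remainders are dominated by measurable majorants and only then
  handed to outer probabilities. (V2)(ii) is applied with L = 1, both for positive definiteness of
  the limit and for a lower eigenvalue bound that holds up to a prescribed probability. For the
  maximizer the argument gives the rate sqrt n.\<close>

abbreviation mean :: "'a measure \<Rightarrow> ('a \<Rightarrow> real) \<Rightarrow> ennreal" where
  "mean M f \<equiv> \<integral>\<^sup>+z. ennreal (f z) \<partial>M"

abbreviation sq_int :: "real set \<Rightarrow> (real \<Rightarrow> real) \<Rightarrow> ennreal" where
  "sq_int A f \<equiv> \<integral>\<^sup>+u\<in>A. ennreal ((f u)^2) \<partial>lborel"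

text \<open>Processes matter on \<open>{0..T}\<close> only; clamping the time makes them measurable on
  the whole line.\<close>

abbreviation jointly_measurable ::
    "'a measure \<Rightarrow> real \<Rightarrow> (real \<Rightarrow> 'a \<Rightarrow> 'b::topological_space) \<Rightarrow> bool" where
  "jointly_measurable M T Z \<equiv>
     (\<lambda>p. Z (max 0 (min T (fst p))) (snd p)) \<in> borel_measurable (borel \<Otimes>\<^sub>M M)"

section \<open>Derivatives of the quasi-log likelihood\<close>

lemma partial_eq:
  assumes "(f has_derivative f') (at x)"
  shows "partial i f x = f' (axis i 1)"
proof -
  interpret bounded_linear f' using assms by (rule has_derivative_bounded_linear)
  have 1: "((\<lambda>t::real. x + t *\<^sub>R axis i (1::real)) has_derivative (\<lambda>t. t *\<^sub>R axis i 1)) (at 0)"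
    by (auto intro!: derivative_eq_intros)
  have "((\<lambda>t. f (x + t *\<^sub>R axis i 1)) has_derivative (\<lambda>t. f' (t *\<^sub>R axis i 1))) (at 0)"
    using has_derivative_compose[OF 1, of f f'] assms by simp
  then have "((\<lambda>t. f (x + t *\<^sub>R axis i 1)) has_field_derivative f' (axis i 1)) (at 0)"
    unfolding has_field_derivative_def by (simp add: scaleR mult_commute_abs)
  then show ?thesis unfolding partial_def by (rule DERIV_imp_deriv)
qed

text \<open>Affine functions plus combinations of exponentials are closed under partial derivatives.\<close>

definition affine_exp_sum ::
    "real \<Rightarrow> real^'p \<Rightarrow> ('i \<Rightarrow> real) \<Rightarrow> ('i \<Rightarrow> real^'p) \<Rightarrow> 'i set \<Rightarrow> real^'p \<Rightarrow> real" where
  "affine_exp_sum c v g a J \<theta> = c + v \<bullet> \<theta> + (\<Sum>j\<in>J. g j * exp (- (a j \<bullet> \<theta>)))"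

lemma affine_exp_sum_has_derivative:
  "(affine_exp_sum c v g a J has_derivative
     (\<lambda>d. v \<bullet> d + (\<Sum>j\<in>J. - (g j * (a j \<bullet> d * exp (- (a j \<bullet> \<theta>))))))) (at \<theta>)"
proof -
  have "affine_exp_sum c v g a J = (\<lambda>\<theta>. c + v \<bullet> \<theta> + (\<Sum>j\<in>J. g j * exp (- (a j \<bullet> \<theta>))))"
    by (simp add: fun_eq_iff affine_exp_sum_def)
  then show ?thesis
    by (auto intro!: derivative_eq_intros)
qed

text \<open>An equality of functions rather than of values, so that the simplifier evaluates nested
  partial derivatives from the inside out.\<close>

lemma partial_affine_exp_sum [simp]:
  "partial i (affine_exp_sum c v g a J) = affine_exp_sum (v $ i) 0 (\<lambda>j. - (g j * a j $ i)) a J"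
  unfolding fun_eq_iff partial_eq[OF affine_exp_sum_has_derivative]
  by (simp add: affine_exp_sum_def inner_axis algebra_simps)

lemma Ck_on_affine_exp_sum: "Ck_on k (affine_exp_sum c v g a J) S"
\<comment> \<open>Differentiation changes the constant, the linear part and the coefficients, but
  neither the exponents nor the index set.\<close>
proof (induction k arbitrary: c v g)
  case 0
  show ?case
    unfolding Ck_on.simps affine_exp_sum_def by (intro continuous_intros)
next
  case (Suc k)
  have "affine_exp_sum c v g a J differentiable_on S"
    unfolding differentiable_on_def differentiable_def
    using has_derivative_at_withinI[OF affine_exp_sum_has_derivative] by blast
  then show ?case using Suc by simp
qed

section \<open>The quasi-log likelihood as an affine-exponential sum\<close>

definition obs :: "real \<Rightarrow> (real \<Rightarrow> 'a \<Rightarrow> 'b) \<Rightarrow> nat \<Rightarrow> nat \<Rightarrow> 'a \<Rightarrow> 'b" where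
  "obs T X n j z = X (obs_time T n (j - 1)) z"

definition scaled_sq_incr :: "real \<Rightarrow> (real \<Rightarrow> 'a \<Rightarrow> real) \<Rightarrow> nat \<Rightarrow> nat \<Rightarrow> 'a \<Rightarrow> real" where
  "scaled_sq_incr T Y n j z = 1 / step T n * (increment T Y n j z)^2"

lemma quasi_loglik_affine_exp_sum:
  "quasi_loglik T X Y n z =
     affine_exp_sum 0 (- (1/2) *\<^sub>R (\<Sum>j=1..n. obs T X n j z))
       (\<lambda>j. - (1/2) * scaled_sq_incr T Y n j z) (\<lambda>j. obs T X n j z) {1..n}"
  by (simp add: fun_eq_iff quasi_loglik_def affine_exp_sum_def obs_def scaled_sq_incr_def
      sum.distrib inner_sum_left sum_distrib_left algebra_simps sum_divide_distrib sum_negf)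

lemma grad_quasi_loglik:
  "grad (quasi_loglik T X Y n z) \<theta> $ i =
     1/2 * (\<Sum>j=1..n. obs T X n j z $ i *
       (scaled_sq_incr T Y n j z * exp (- (obs T X n j z \<bullet> \<theta>)) - 1))"
  by (simp add: grad_def quasi_loglik_affine_exp_sum) (simp add: affine_exp_sum_def
      sum_distrib_left sum_negf sum_subtractf sum_divide_distrib diff_divide_distrib algebra_simps)

lemma hessian_quasi_loglik:
  "hessian (quasi_loglik T X Y n z) \<theta> $ i $ k =
     - (1/2) * (\<Sum>j=1..n. obs T X n j z $ i * obs T X n j z $ k *
       (scaled_sq_incr T Y n j z * exp (- (obs T X n j z \<bullet> \<theta>))))"
  by (simp add: hessian_def quasi_loglik_affine_exp_sum) (simp add: affine_exp_sum_def
      sum_divide_distrib sum_negf algebra_simps)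

lemma partial3_quasi_loglik:
  "partial i (partial k (partial l (quasi_loglik T X Y n z))) \<theta> =
     1/2 * (\<Sum>j=1..n. obs T X n j z $ i * obs T X n j z $ k * obs T X n j z $ l *
       (scaled_sq_incr T Y n j z * exp (- (obs T X n j z \<bullet> \<theta>))))"
  by (simp add: quasi_loglik_affine_exp_sum) (simp add: affine_exp_sum_def
      sum_distrib_left algebra_simps)

text \<open>The factor 1/2 of the Hessian and the 1/h of the scaled squares merge into 1/(2h); the
  logarithms are then of the determinant of one and the same matrix.\<close>

lemma qbic_quasi_loglik:
  "qbic (quasi_loglik T X Y n z) \<theta> =
     (\<Sum>j=1..n. X (obs_time T n (j - 1)) z \<bullet> \<theta> +
        1 / step T n * (increment T Y n j z)^2 * exp (- (X (obs_time T n (j - 1)) z \<bullet> \<theta>))) +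
     ln (det ((1 / (2 * step T n)) *\<^sub>R
       (\<Sum>j=1..n. ((increment T Y n j z)^2 * exp (- (X (obs_time T n (j - 1)) z \<bullet> \<theta>))) *\<^sub>R
          outer_square (X (obs_time T n (j - 1)) z))))"
proof -
  have "- hessian (quasi_loglik T X Y n z) \<theta> = (1 / (2 * step T n)) *\<^sub>R
       (\<Sum>j=1..n. ((increment T Y n j z)^2 * exp (- (X (obs_time T n (j - 1)) z \<bullet> \<theta>))) *\<^sub>R
          outer_square (X (obs_time T n (j - 1)) z))"
    unfolding vec_eq_iff
    by (auto simp: hessian_quasi_loglik obs_def scaled_sq_incr_def
        outer_square_def sum_divide_distrib sum_negf mult_ac)
  then show ?thesis by (simp add: qbic_def quasi_loglik_def)
qed

text \<open>Taylor expansion with Lagrange remainder: the intermediate point has modulus at most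
  \<open>D\<close>, which bounds the second-order coefficient from below. This is the source of the
  strong concavity on the whole parameter set.\<close>

lemma exp_minus_quadratic_lower_bound:
  fixes y :: real
  assumes "\<bar>y\<bar> \<le> D"
  shows "1 - y + exp (- D) / 2 * y^2 \<le> exp (- y)"
proof -
  obtain t where t: "\<bar>t\<bar> \<le> \<bar>- y\<bar>" "exp (- y) = (\<Sum>m<2. (- y) ^ m / fact m) + exp t / fact 2 * (- y) ^ 2"
    using Maclaurin_exp_le[of "- y" 2] by blast
  have "exp (- D) \<le> exp t" using t(1) assms by auto
  then have "exp (- D) / 2 * y^2 \<le> exp t / 2 * y^2" by (intro mult_right_mono) auto
  then show ?thesis using t(2) by (simp add: numeral_2_eq_2)
qed

text \<open>Each summand is linear in the parameter plus a nonnegative weight \<open>c j\<close>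
  times an exponential. The scalar bound is applied to each exponential, and the same weights
  \<open>c j\<close> form the Hessian at \<open>\<theta>0\<close>, so the quadratic terms add up to
  exactly that Hessian.\<close>

lemma quasi_loglik_quadratic_bound:
  fixes \<theta> \<theta>0 :: "real^'p::finite"
  assumes T: "T \<ge> 0" and D: "\<And>j. j \<in> {1..n} \<Longrightarrow> \<bar>obs T X n j z \<bullet> (\<theta> - \<theta>0)\<bar> \<le> D"
  shows "quasi_loglik T X Y n z \<theta> - quasi_loglik T X Y n z \<theta>0 \<le>
    (\<theta> - \<theta>0) \<bullet> grad (quasi_loglik T X Y n z) \<theta>0 -
    exp (- D) / 2 * ((\<theta> - \<theta>0) \<bullet> (- hessian (quasi_loglik T X Y n z) \<theta>0 *v (\<theta> - \<theta>0)))"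
proof -
  define a where "a j = obs T X n j z" for j
  define c where "c j = scaled_sq_incr T Y n j z * exp (- (a j \<bullet> \<theta>0))" for j
  define d where "d = \<theta> - \<theta>0"
  have c: "c j \<ge> 0" for j using T by (simp add: c_def scaled_sq_incr_def step_def)
  have q: "quasi_loglik T X Y n z \<theta> = -(1/2) * (\<Sum>j=1..n. a j \<bullet> \<theta> + scaled_sq_incr T Y n j z * exp (- (a j \<bullet> \<theta>)))" for \<theta>
    by (simp add: quasi_loglik_def a_def obs_def scaled_sq_incr_def)
  have g: "d \<bullet> grad (quasi_loglik T X Y n z) \<theta>0 = 1/2 * (\<Sum>j=1..n. (a j \<bullet> d) * (c j - 1))"
  proof -
    have "d \<bullet> grad (quasi_loglik T X Y n z) \<theta>0 = 1/2 * (\<Sum>i\<in>UNIV. \<Sum>j=1..n. d $ i * a j $ i * (c j - 1))"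
      by (simp add: inner_vec_def grad_quasi_loglik a_def c_def sum_distrib_left mult_ac)
    also have "(\<Sum>i\<in>UNIV. \<Sum>j=1..n. d $ i * a j $ i * (c j - 1)) = (\<Sum>j=1..n. (a j \<bullet> d) * (c j - 1))"
      by (subst sum.swap) (simp add: inner_vec_def sum_distrib_left mult_ac)
    finally show ?thesis .
  qed
  have h: "d \<bullet> (- hessian (quasi_loglik T X Y n z) \<theta>0 *v d) = 1/2 * (\<Sum>j=1..n. c j * (a j \<bullet> d)^2)"
  proof -
    have "d \<bullet> (- hessian (quasi_loglik T X Y n z) \<theta>0 *v d) =
        (\<Sum>i\<in>UNIV. d $ i * (\<Sum>k\<in>UNIV. (1/2 * (\<Sum>j=1..n. a j $ i * a j $ k * c j)) * d $ k))"
      by (simp add: inner_vec_def[of d] matrix_vector_mult_def hessian_quasi_loglik a_def c_def)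
    also have "\<dots> = 1/2 * (\<Sum>i\<in>UNIV. \<Sum>k\<in>UNIV. \<Sum>j=1..n. c j * (a j $ i * d $ i) * (a j $ k * d $ k))"
      by (simp add: sum_distrib_left sum_distrib_right mult_ac)
    also have "(\<Sum>i\<in>UNIV. \<Sum>k\<in>UNIV. \<Sum>j=1..n. c j * (a j $ i * d $ i) * (a j $ k * d $ k)) =
       (\<Sum>j=1..n. \<Sum>i\<in>UNIV. \<Sum>k\<in>UNIV. c j * (a j $ i * d $ i) * (a j $ k * d $ k))"
      by (subst sum.swap[of _ "{1..n}"], subst sum.swap[of _ "{1..n}"]) simp
    also have "\<dots> = (\<Sum>j=1..n. c j * (a j \<bullet> d)^2)"
      by (simp add: inner_vec_def power2_eq_square sum_product sum_distrib_left mult_ac)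
    finally show ?thesis .
  qed
  have summand: "a j \<bullet> d + c j * (exp (- (a j \<bullet> d)) - 1) \<ge> - ((a j \<bullet> d) * (c j - 1)) + exp (- D) / 2 * (c j * (a j \<bullet> d)^2)"
    if "j \<in> {1..n}" for j
  proof -
    have "c j * (1 - a j \<bullet> d + exp (- D) / 2 * (a j \<bullet> d)^2) \<le> c j * exp (- (a j \<bullet> d))"
      using exp_minus_quadratic_lower_bound D[OF that] c by (intro mult_left_mono) (auto simp: a_def d_def)
    then show ?thesis by (simp add: algebra_simps)
  qed
  have "(\<Sum>j=1..n. - ((a j \<bullet> d) * (c j - 1)) + exp (- D) / 2 * (c j * (a j \<bullet> d)^2))
     \<le> (\<Sum>j=1..n. a j \<bullet> d + c j * (exp (- (a j \<bullet> d)) - 1))"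
    by (intro sum_mono summand)
  also have "\<dots> = -2 * (quasi_loglik T X Y n z \<theta> - quasi_loglik T X Y n z \<theta>0)"
  proof -
    have *: "c j * exp (- (a j \<bullet> d)) = scaled_sq_incr T Y n j z * exp (- (a j \<bullet> \<theta>))" for j
      unfolding c_def d_def mult.assoc exp_add[symmetric] by (simp add: inner_diff_right)
    show ?thesis
      unfolding q right_diff_distrib *
      by (simp add: sum.distrib sum_subtractf algebra_simps d_def inner_diff_right c_def)
  qed
  finally have "- (\<Sum>j=1..n. (a j \<bullet> d) * (c j - 1)) + exp (- D) / 2 * (\<Sum>j=1..n. c j * (a j \<bullet> d)^2)
     \<le> -2 * (quasi_loglik T X Y n z \<theta> - quasi_loglik T X Y n z \<theta>0)"
    unfolding sum.distrib sum_negf sum_distrib_left .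
  then show ?thesis
    unfolding d_def[symmetric] g h by (simp add: field_simps)
qed

section \<open>Smallest eigenvalues\<close>

text \<open>The norm of a matrix is here its Frobenius norm, so Cauchy-Schwarz is applied row by
  row.\<close>

lemma norm_matrix_vector_le:
  fixes A :: "real^'p^'q::finite"
  shows "norm (A *v x) \<le> norm A * norm x"
proof -
  have "norm (A *v x) = L2_set (\<lambda>i. A $ i \<bullet> x) UNIV"
    by (simp add: norm_vec_def matrix_vector_mult_def inner_vec_def) (simp add: L2_set_def)
  also have "\<dots> \<le> L2_set (\<lambda>i. norm (A $ i) * norm x) UNIV"
    by (auto simp: L2_set_def intro!: sum_mono) (metis Cauchy_Schwarz_ineq2 abs_ge_zero power2_abs power_mono power_mult_distrib)
  also have "\<dots> = norm A * norm x"
    by (simp add: norm_vec_def[of A] L2_set_left_distrib)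
  finally show ?thesis .
qed

lemma abs_quadratic_form_le:
  fixes A :: "real^'p^'p::finite"
  shows "\<bar>x \<bullet> (A *v x)\<bar> \<le> norm A * (norm x)^2"
proof -
  have "\<bar>x \<bullet> (A *v x)\<bar> \<le> norm x * norm (A *v x)" by (rule Cauchy_Schwarz_ineq2)
  also have "\<dots> \<le> norm x * (norm A * norm x)" by (intro mult_left_mono norm_matrix_vector_le) auto
  finally show ?thesis by (simp add: power2_eq_square mult_ac)
qed

lemma symmetric_inner:
  fixes A :: "real^'p^'p::finite"
  assumes "transpose A = A"
  shows "x \<bullet> (A *v y) = y \<bullet> (A *v x)"
  by (metis assms dot_lmul_matrix inner_commute vector_transpose_matrix)

text \<open>Eigenvectors of distinct eigenvalues are orthogonal, hence independent, hence finitely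
  many. The \<open>Min\<close> in \<open>min_eigenvalue\<close> is meaningful only for a finite
  set.\<close>

lemma finite_eigenvalues_symmetric:
  fixes A :: "real^'p^'p::finite"
  assumes "transpose A = A"
  shows "finite {l. \<exists>v. v \<noteq> 0 \<and> A *v v = l *\<^sub>R v}" (is "finite ?L")
proof -
  define e where "e l = (SOME v. v \<noteq> 0 \<and> A *v v = l *\<^sub>R v)" for l
  have e: "e l \<noteq> 0" "A *v e l = l *\<^sub>R e l" if "l \<in> ?L" for l
    using that someI_ex[of "\<lambda>v. v \<noteq> 0 \<and> A *v v = l *\<^sub>R v"] by (auto simp: e_def)
  have orth: "e l \<bullet> e m = 0" if "l \<in> ?L" "m \<in> ?L" "l \<noteq> m" for l m
    using symmetric_inner[OF assms, of "e l" "e m"] e that by (auto simp: inner_commute)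
  have "inj_on e ?L"
  proof (rule inj_onI, rule ccontr)
    fix l m assume *: "l \<in> ?L" "m \<in> ?L" "e l = e m" "l \<noteq> m"
    then have "e l \<bullet> e l = 0" using orth[of l m] by simp
    then show False using e(1)[OF *(1)] by simp
  qed
  moreover have "independent (e ` ?L)"

  proof (rule pairwise_orthogonal_independent)
    show "pairwise orthogonal (e ` ?L)"
      unfolding pairwise_def orthogonal_def using orth by blast
    show "0 \<notin> e ` ?L" using e(1) by fastforce
  qed
  then have "finite (e ` ?L)" by (rule finiteI_independent)
  ultimately show ?thesis by (rule finite_imageD[rotated])
qed

text \<open>Rayleigh's principle: the minimum of the quadratic form over the compact unit sphere is
  attained, and the first variation shows that the minimizer is an eigenvector.\<close>

lemma min_eigenvalue_symmetric:
  fixes A :: "real^'p^'p::finite"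
  assumes sym: "transpose A = A"
  shows "\<exists>v. norm v = 1 \<and> v \<bullet> (A *v v) = min_eigenvalue A"
    and "min_eigenvalue A * (norm x)^2 \<le> x \<bullet> (A *v x)"
proof -
  have "continuous_on (sphere (0::real^'p) 1) (\<lambda>x. x \<bullet> (A *v x))"
    by (intro continuous_on_inner continuous_on_id linear_continuous_on matrix_vector_mul_bounded_linear)
  moreover have "sphere (0::real^'p) 1 \<noteq> {}" by simp
  ultimately obtain v where v: "norm v = 1" "\<And>x. norm x = 1 \<Longrightarrow> v \<bullet> (A *v v) \<le> x \<bullet> (A *v x)"
    using continuous_attains_inf[of "sphere (0::real^'p) 1" "\<lambda>x. x \<bullet> (A *v x)"] by auto
  define m where "m = v \<bullet> (A *v v)"
  have le: "m * (norm x)^2 \<le> x \<bullet> (A *v x)" for x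
  proof (cases "x = 0")
    case False
    have "m \<le> (x /\<^sub>R norm x) \<bullet> (A *v (x /\<^sub>R norm x))"
      unfolding m_def using False by (intro v(2)) simp
    also have "\<dots> = (x \<bullet> (A *v x)) / (norm x)^2"
      by (simp add: matrix_vector_mult_scaleR power2_eq_square divide_inverse mult_ac)
    finally show ?thesis using False by (simp add: field_simps)
  qed simp
  \<comment> \<open>The residual of the eigenvector equation. The form of A - m I is nonnegative and
    vanishes at \<open>v\<close>; if \<open>y\<close> were nonzero, a small move from
    \<open>v\<close> against \<open>y\<close> would make it negative.\<close>
  define y where "y = A *v v - m *\<^sub>R v"
  have "y \<bullet> y = 0"
  proof (rule ccontr)
    assume *: "y \<bullet> y \<noteq> 0"
    define c where "c = y \<bullet> y"
    define d where "d = \<bar>y \<bullet> (A *v y) - m * (y \<bullet> y)\<bar> + 1"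
    have c: "c > 0" using * by (simp add: c_def)
    have d: "d > 0" by (simp add: d_def)
    have q: "0 \<le> 2 * t * c + t^2 * (y \<bullet> (A *v y) - m * (y \<bullet> y))" for t
    proof -
      have "0 \<le> (v + t *\<^sub>R y) \<bullet> (A *v (v + t *\<^sub>R y)) - m * ((v + t *\<^sub>R y) \<bullet> (v + t *\<^sub>R y))"
        using le[of "v + t *\<^sub>R y"] by (simp add: power2_norm_eq_inner)
      also have "\<dots> = 2 * t * (y \<bullet> (A *v v) - m * (y \<bullet> v)) + t^2 * (y \<bullet> (A *v y) - m * (y \<bullet> y))
          + (v \<bullet> (A *v v) - m * (v \<bullet> v))"
        using symmetric_inner[OF sym, of v y]
        by (simp add: matrix_vector_right_distrib matrix_vector_mult_scaleR inner_add_left inner_add_right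
            inner_commute power2_eq_square algebra_simps)
      also have "y \<bullet> (A *v v) - m * (y \<bullet> v) = c"
        unfolding c_def by (subst (3) y_def) (simp add: inner_diff_right)
      also have "v \<bullet> (A *v v) - m * (v \<bullet> v) = 0"
        using v(1) by (simp add: m_def power2_norm_eq_inner[symmetric])
      finally show ?thesis by simp
    qed
    have "t^2 * (y \<bullet> (A *v y) - m * (y \<bullet> y)) \<le> t^2 * d" for t
      by (intro mult_left_mono) (auto simp: d_def)
    \<comment> \<open>The choice t = - c / d minimizes 2 * t * c + t^2 * d; the \<open>+ 1\<close>
      in the definition of \<open>d\<close> keeps \<open>d\<close> positive.\<close>
    then have "0 \<le> 2 * (- (c / d)) * c + (- (c / d))^2 * d"
      using q[of "- (c / d)"] by (smt (verit))
    also have "\<dots> = - (c^2 / d)" using d by (simp add: power2_eq_square field_simps)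
    also have "\<dots> < 0" using c d by simp
    finally show False by simp
  qed
  then have eig: "A *v v = m *\<^sub>R v" by (simp add: y_def)
  have "min_eigenvalue A = m"
    unfolding min_eigenvalue_def
  proof (rule Min_eqI[OF finite_eigenvalues_symmetric[OF sym]])
    show "m \<in> {l. \<exists>v. v \<noteq> 0 \<and> A *v v = l *\<^sub>R v}" using eig v(1) by (auto intro!: exI[of _ v])
  next
    fix l assume "l \<in> {l. \<exists>v. v \<noteq> 0 \<and> A *v v = l *\<^sub>R v}"
    then obtain x where x: "x \<noteq> 0" "A *v x = l *\<^sub>R x" by auto
    then show "m \<le> l" using le[of x] by (simp add: power2_norm_eq_inner)
  qed
  then show "\<exists>v. norm v = 1 \<and> v \<bullet> (A *v v) = min_eigenvalue A"
    and "min_eigenvalue A * (norm x)^2 \<le> x \<bullet> (A *v x)"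
    using v(1) le[of x] by (auto simp: m_def)
qed

text \<open>The unit vector that is optimal for \<open>B\<close> is a competitor for
  \<open>A\<close>.\<close>

lemma min_eigenvalue_diff_le:
  fixes A B :: "real^'p^'p::finite"
  assumes "transpose A = A" "transpose B = B"
  shows "min_eigenvalue A - min_eigenvalue B \<le> norm (A - B)"
proof -
  obtain v where v: "norm v = 1" "v \<bullet> (B *v v) = min_eigenvalue B"
    using min_eigenvalue_symmetric(1)[OF assms(2)] by auto
  have "min_eigenvalue A \<le> v \<bullet> (A *v v)"
    using min_eigenvalue_symmetric(2)[OF assms(1), of v] v by simp
  also have "\<dots> = v \<bullet> (B *v v) + v \<bullet> ((A - B) *v v)"
    by (simp add: matrix_vector_mult_diff_rdistrib inner_diff_right)
  also have "\<dots> \<le> min_eigenvalue B + norm (A - B)"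
    using v abs_quadratic_form_le[of v "A - B"] by simp
  finally show ?thesis by simp
qed

text \<open>The Lipschitz bound is available for symmetric matrices only. Composing with the
  symmetrization \<open>S\<close>, a contraction that fixes symmetric matrices, yields a function
  continuous on all matrices.\<close>

lemma borel_measurable_min_eigenvalue:
  fixes G :: "'a \<Rightarrow> real^'p^'p::finite"
  assumes "G \<in> borel_measurable M" "\<And>z. z \<in> space M \<Longrightarrow> transpose (G z) = G z"
  shows "(\<lambda>z. min_eigenvalue (G z)) \<in> borel_measurable M"
proof -
  define S where "S A = (1/2) *\<^sub>R (A + transpose A)" for A :: "real^'p^'p"
  have tS: "transpose (S A) = S A" for A
    by (simp add: S_def transpose_def vec_eq_iff)
  have SS: "norm (S A - S B) \<le> norm (A - B)" for A B
  proof -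
    have t: "norm (transpose C) = norm C" for C :: "real^'p^'p"
    proof -
      have "(norm C)^2 = (\<Sum>i\<in>UNIV. \<Sum>j\<in>UNIV. (C $ i $ j)^2)" for C :: "real^'p^'p"
        by (simp add: norm_vec_def L2_set_def sum_nonneg)
      from this[of C] this[of "transpose C"] have "(norm (transpose C))^2 = (norm C)^2"
        by (simp add: transpose_def) (subst sum.swap, simp)
      then show ?thesis by (simp add: power2_eq_iff_nonneg)
    qed
    have "S A - S B = (1/2) *\<^sub>R ((A - B) + transpose (A - B))"
      by (simp add: S_def transpose_def vec_eq_iff algebra_simps)
    then have "norm (S A - S B) \<le> (norm (A - B) + norm (transpose (A - B))) / 2"
      using norm_triangle_ineq[of "A - B" "transpose (A - B)"] by simp
    then show ?thesis by (simp add: t)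
  qed
  have "dist (min_eigenvalue (S A)) (min_eigenvalue (S B)) \<le> dist A B" for A B
    using min_eigenvalue_diff_le[OF tS tS, of A B] min_eigenvalue_diff_le[OF tS tS, of B A] SS[of A B]
    by (simp add: dist_norm norm_minus_commute abs_le_iff)
  then have "continuous_on UNIV (\<lambda>A. min_eigenvalue (S A))"
    unfolding continuous_on_iff by (metis le_less_trans)
  then have "(\<lambda>A. min_eigenvalue (S A)) \<in> borel_measurable borel"
    by (rule borel_measurable_continuous_onI)
  from measurable_compose[OF assms(1) this]
  have "(\<lambda>z. min_eigenvalue (S (G z))) \<in> borel_measurable M" .
  moreover have "S (G z) = G z" if "z \<in> space M" for z
    using assms(2)[OF that] by (simp add: S_def vec_eq_iff)
  ultimately show ?thesis by (simp cong: measurable_cong)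
qed

section \<open>Outer probabilities\<close>

lemma outer_measure_of_Un_le:
  assumes "A \<subseteq> space M" "B \<subseteq> space M"
  shows "outer_measure_of M (A \<union> B) \<le> outer_measure_of M A + outer_measure_of M B"
proof -
  obtain A' where A: "A' \<in> sets M" "A \<subseteq> A'" "outer_measure_of M A = emeasure M A'"
    using outer_measure_of_attain[OF assms(1)] by auto
  obtain B' where B: "B' \<in> sets M" "B \<subseteq> B'" "outer_measure_of M B = emeasure M B'"
    using outer_measure_of_attain[OF assms(2)] by auto
  have "outer_measure_of M (A \<union> B) \<le> outer_measure_of M (A' \<union> B')"
    using A B by (intro outer_measure_of_mono) auto
  also have "\<dots> \<le> emeasure M A' + emeasure M B'"
    using A B by (simp add: emeasure_subadditive)
  finally show ?thesis using A B by simp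
qed

text \<open>Measurable hulls of the exceptional events: their indicators can be integrated, although
  \<open>Z\<close> itself need not be measurable.\<close>

lemma vanishes_in_prob_cover:
  assumes "vanishes_in_prob M Z" "\<epsilon> > (0::real)"
  obtains A where "\<And>k. A k \<in> sets M" "\<And>k z. z \<in> space M \<Longrightarrow> z \<notin> A k \<Longrightarrow> Z k z \<le> ennreal \<epsilon>"
    "(\<lambda>k. emeasure M (A k)) \<longlonglongrightarrow> 0"
proof -
  have "\<exists>A. A \<in> sets M \<and> {z \<in> space M. Z k z > ennreal \<epsilon>} \<subseteq> A \<and>
      outer_measure_of M {z \<in> space M. Z k z > ennreal \<epsilon>} = emeasure M A" for k
    using outer_measure_of_attain[of "{z \<in> space M. Z k z > ennreal \<epsilon>}" M] by auto
  then obtain A where A: "\<And>k. A k \<in> sets M" "\<And>k. {z \<in> space M. Z k z > ennreal \<epsilon>} \<subseteq> A k"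
      "\<And>k. outer_measure_of M {z \<in> space M. Z k z > ennreal \<epsilon>} = emeasure M (A k)"
    by metis
  show ?thesis
  proof (rule that[of A])
    show "(\<lambda>k. emeasure M (A k)) \<longlonglongrightarrow> 0"
      using assms unfolding vanishes_in_prob_def A(3)[symmetric] by blast
    show "Z k z \<le> ennreal \<epsilon>" if "z \<in> space M" "z \<notin> A k" for k z
      using A(2)[of k] that by (auto simp: not_less[symmetric])
  qed (use A in auto)
qed

lemma outer_measure_of_Markov:
  assumes [measurable]: "f \<in> borel_measurable M" and "c > 0"
    and "\<And>z. z \<in> space M \<Longrightarrow> Z z \<le> f z"
  shows "outer_measure_of M {z \<in> space M. Z z > ennreal c} \<le> (\<integral>\<^sup>+z. f z \<partial>M) / ennreal c"
proof -
  have "outer_measure_of M {z \<in> space M. Z z > ennreal c} \<le> outer_measure_of M {z \<in> space M. 1 \<le> ennreal (1/c) * f z}"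
  proof (intro outer_measure_of_mono subsetI CollectI conjI)
    fix z assume "z \<in> {z \<in> space M. Z z > ennreal c}"
    then have *: "z \<in> space M" "ennreal c \<le> f z" using assms(3)[of z] by auto
    then show "z \<in> space M" by simp
    have "ennreal (1/c) * ennreal c \<le> ennreal (1/c) * f z"
      using * by (intro mult_left_mono) auto
    moreover have "ennreal (1/c) * ennreal c = 1" using assms(2) by (simp flip: ennreal_mult')
    ultimately show "1 \<le> ennreal (1/c) * f z" by simp
  qed
  also have "\<dots> = emeasure M {z \<in> space M. 1 \<le> ennreal (1/c) * f z}"
    by (intro outer_measure_of_eq) measurable
  also have "\<dots> \<le> ennreal (1/c) * (\<integral>\<^sup>+z. f z * indicator (space M) z \<partial>M)"
    by (intro nn_integral_Markov_inequality) auto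
  also have "(\<integral>\<^sup>+z. f z * indicator (space M) z \<partial>M) = (\<integral>\<^sup>+z. f z \<partial>M)"
    by (intro nn_integral_cong) auto
  also have "ennreal (1/c) * (\<integral>\<^sup>+z. f z \<partial>M) = (\<integral>\<^sup>+z. f z \<partial>M) / ennreal c"
  proof -
    have "inverse (ennreal c) = ennreal (1/c)" using assms(2) by (simp add: inverse_ennreal inverse_eq_divide)
    then show ?thesis unfolding divide_ennreal_def by (simp only: mult.commute)
  qed
  finally show ?thesis .
qed

text \<open>Markov's inequality for a measurable majorant of \<open>Z\<close>. The bounds start at n
  = 1 because the step length is 0 for n = 0.\<close>

lemma vanishes_in_probI_mean:
  assumes "\<And>n. n \<ge> 1 \<Longrightarrow> f n \<in> borel_measurable M"
    and "\<And>n z. n \<ge> 1 \<Longrightarrow> z \<in> space M \<Longrightarrow> Z n z \<le> f n z"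
    and "\<And>n. n \<ge> 1 \<Longrightarrow> (\<integral>\<^sup>+z. f n z \<partial>M) \<le> ennreal (r n)"
    and r: "r \<longlonglongrightarrow> 0"
  shows "vanishes_in_prob M Z"
  unfolding vanishes_in_prob_def
proof (intro allI impI)
  fix \<epsilon> :: real assume e: "\<epsilon> > 0"
  have "(\<lambda>n. ennreal (r n / \<epsilon>)) \<longlonglongrightarrow> ennreal (0 / \<epsilon>)"
    using e by (intro tendsto_ennrealI tendsto_divide r tendsto_const) auto
  then have lim: "(\<lambda>n. ennreal (r n / \<epsilon>)) \<longlonglongrightarrow> 0" by simp
  have "outer_measure_of M {z \<in> space M. Z n z > ennreal \<epsilon>} \<le> ennreal (r n / \<epsilon>)" if "n \<ge> 1" for n
  proof -
    have "outer_measure_of M {z \<in> space M. Z n z > ennreal \<epsilon>} \<le> (\<integral>\<^sup>+z. f n z \<partial>M) / ennreal \<epsilon>"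
      using assms that e by (intro outer_measure_of_Markov) auto
    also have "\<dots> \<le> ennreal (r n) / ennreal \<epsilon>"
      using assms(3)[OF that] by (rule divide_right_mono_ennreal)
    also have "\<dots> = ennreal (r n / \<epsilon>)"
      using e by (cases "r n \<ge> 0") (auto simp: divide_ennreal ennreal_neg divide_nonpos_pos)
    finally show ?thesis .
  qed
  then show "(\<lambda>n. outer_measure_of M {z \<in> space M. Z n z > ennreal \<epsilon>}) \<longlonglongrightarrow> 0"
    by (intro tendsto_sandwich[OF _ _ tendsto_const lim]) (auto simp: eventually_at_top_linorder)
qed

section \<open>Sums of martingale differences\<close>

text \<open>Orthogonality of martingale increments. Instead of conditional expectations, the
  assumptions \<open>mean\<close> and \<open>var\<close> test \<open>D i\<close> and its square
  against integrable functions known at stage \<open>i\<close>; they say that \<open>D i\<close> has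
  conditional mean 0 and deterministic conditional variance \<open>v i\<close>.\<close>

lemma (in prob_space) martingale_transform_square:
  fixes G :: "nat \<Rightarrow> 'a measure" and \<xi> D :: "nat \<Rightarrow> 'a \<Rightarrow> real"
  assumes sub: "\<And>i. i \<le> m \<Longrightarrow> subalgebra M (G i)"
    and mono: "\<And>i. i < m \<Longrightarrow> subalgebra (G (Suc i)) (G i)"
    and \<xi>: "\<And>i. i < m \<Longrightarrow> \<xi> i \<in> borel_measurable (G i)"
    and bnd: "\<And>i. i < m \<Longrightarrow> \<exists>K. \<forall>z\<in>space M. \<bar>\<xi> i z\<bar> \<le> K"
    and D: "\<And>i. i < m \<Longrightarrow> D i \<in> borel_measurable (G (Suc i))"
    and mean: "\<And>i f. i < m \<Longrightarrow> f \<in> borel_measurable (G i) \<Longrightarrow> integrable M f \<Longrightarrow>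
      has_bochner_integral M (\<lambda>z. f z * D i z) 0"
    and var: "\<And>i f. i < m \<Longrightarrow> f \<in> borel_measurable (G i) \<Longrightarrow> integrable M f \<Longrightarrow>
      has_bochner_integral M (\<lambda>z. f z * (D i z)^2) (expectation f * v i)"
  shows "(\<lambda>z. \<Sum>i<m. \<xi> i z * D i z) \<in> borel_measurable (G m) \<and>
    has_bochner_integral M (\<lambda>z. (\<Sum>i<m. \<xi> i z * D i z)^2) (\<Sum>i<m. expectation (\<lambda>z. (\<xi> i z)^2) * v i)"
  using assms
proof (induction m)
  case 0
  then show ?case by (simp add: has_bochner_integral_zero)
next
  case (Suc m)
  define S where "S z = (\<Sum>i<m. \<xi> i z * D i z)" for z
  have IH: "S \<in> borel_measurable (G m)"
    "has_bochner_integral M (\<lambda>z. (S z)^2) (\<Sum>i<m. expectation (\<lambda>z. (\<xi> i z)^2) * v i)"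
    using Suc.IH Suc.prems unfolding S_def by simp_all
  have subm: "subalgebra M (G m)" using Suc.prems(1)[of m] by simp
  have \<xi>m[measurable]: "\<xi> m \<in> borel_measurable (G m)" using Suc.prems(3) by simp
  have [measurable]: "\<xi> m \<in> borel_measurable M" "S \<in> borel_measurable M"
    by (rule measurable_from_subalg[OF subm \<xi>m], rule measurable_from_subalg[OF subm IH(1)])
  obtain K where K: "\<And>z. z \<in> space M \<Longrightarrow> \<bar>\<xi> m z\<bar> \<le> K" using Suc.prems(4)[of m] by auto
  have "integrable M S"
    by (rule square_integrable_imp_integrable[OF _ integrable.intros[OF IH(2)]]) measurable
  then have "integrable M (\<lambda>z. K * S z)" by simp
  then have int1: "integrable M (\<lambda>z. S z * \<xi> m z)"
  proof (rule Bochner_Integration.integrable_bound)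
    have "\<bar>S z\<bar> * \<bar>\<xi> m z\<bar> \<le> \<bar>S z\<bar> * \<bar>K\<bar>" if "z \<in> space M" for z
      using K[OF that] by (intro mult_left_mono) auto
    then show "AE z in M. norm (S z * \<xi> m z) \<le> norm (K * S z)"
      by (intro AE_I2) (simp add: abs_mult mult.commute)
  qed measurable
  have int2: "integrable M (\<lambda>z. (\<xi> m z)^2)"
  proof (intro integrable_const_bound[of _ "K^2"] AE_I2)
    fix z assume "z \<in> space M"
    then show "norm ((\<xi> m z)^2) \<le> K^2"
      using power_mono[OF K, of z 2] by simp
  qed measurable
  note m = IH(1)[measurable]
  \<comment> \<open>The past sum times the next weight is known at stage \<open>m\<close> and, the
    weight being bounded, integrable: an admissible test function.\<close>
  have cross: "has_bochner_integral M (\<lambda>z. 2 * (S z * \<xi> m z * D m z)) 0"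
    using has_bochner_integral_mult_right[OF Suc.prems(6)[OF _ _ int1], of 2] by simp
  have sq: "has_bochner_integral M (\<lambda>z. (\<xi> m z)^2 * (D m z)^2) (expectation (\<lambda>z. (\<xi> m z)^2) * v m)"
    using Suc.prems(7)[OF _ _ int2] by simp
  have "has_bochner_integral M (\<lambda>z. (S z)^2 + 2 * (S z * \<xi> m z * D m z) + (\<xi> m z)^2 * (D m z)^2)
      ((\<Sum>i<m. expectation (\<lambda>z. (\<xi> i z)^2) * v i) + 0 + expectation (\<lambda>z. (\<xi> m z)^2) * v m)"
    by (intro has_bochner_integral_add IH cross sq)
  moreover have "(S z)^2 + 2 * (S z * \<xi> m z * D m z) + (\<xi> m z)^2 * (D m z)^2 = (\<Sum>i<Suc m. \<xi> i z * D i z)^2" for z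
    by (simp add: S_def power2_sum power_mult_distrib)
  moreover have "(\<lambda>z. \<Sum>i<Suc m. \<xi> i z * D i z) \<in> borel_measurable (G (Suc m))"
  proof -
    have s: "subalgebra (G (Suc m)) (G m)" using Suc.prems(2)[of m] by simp
    have [measurable]: "\<xi> m \<in> borel_measurable (G (Suc m))" "S \<in> borel_measurable (G (Suc m))"
      "D m \<in> borel_measurable (G (Suc m))"
      by (rule measurable_from_subalg[OF s \<xi>m], rule measurable_from_subalg[OF s IH(1)], rule Suc.prems(5)) simp
    have "(\<lambda>z. S z + \<xi> m z * D m z) \<in> borel_measurable (G (Suc m))" by measurable
    then show ?thesis by (simp add: S_def)
  qed
  ultimately show ?case by simp
qed

section \<open>Increments of the Wiener process\<close>

locale filtered_wiener = prob_space M
  for M :: "'a measure" and T :: real and F :: "real \<Rightarrow> 'a measure" and w :: "real \<Rightarrow> 'a \<Rightarrow> real" +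
  assumes filtration: "filtration_upto M T F" and wiener: "wiener_process M T F w"
begin

lemma sub: "0 \<le> t \<Longrightarrow> t \<le> T \<Longrightarrow> subalgebra M (F t)"
  and sub_mono: "0 \<le> s \<Longrightarrow> s \<le> t \<Longrightarrow> t \<le> T \<Longrightarrow> subalgebra (F t) (F s)"
  using filtration by (auto simp: filtration_upto_def)

lemma space_F: "0 \<le> t \<Longrightarrow> t \<le> T \<Longrightarrow> space (F t) = space M"
  using sub by (auto simp: subalgebra_def)

lemma measurable_M: "0 \<le> t \<Longrightarrow> t \<le> T \<Longrightarrow> f \<in> measurable (F t) N \<Longrightarrow> f \<in> measurable M N"
  using measurable_from_subalg sub by blast

lemma measurable_F_mono:
  "0 \<le> s \<Longrightarrow> s \<le> t \<Longrightarrow> t \<le> T \<Longrightarrow> f \<in> measurable (F s) N \<Longrightarrow> f \<in> measurable (F t) N"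
  using measurable_from_subalg sub_mono by blast

lemma w_measurable_F: "0 \<le> s \<Longrightarrow> s \<le> t \<Longrightarrow> t \<le> T \<Longrightarrow> w s \<in> borel_measurable (F t)"
  using wiener by (intro measurable_F_mono[of s t]) (auto simp: wiener_process_def)

lemma w_measurable: "0 \<le> t \<Longrightarrow> t \<le> T \<Longrightarrow> w t \<in> borel_measurable M"
  using w_measurable_F[of t t] measurable_M by auto

text \<open>A variable known at time \<open>s\<close> is independent of the later increment, so the
  expectation of the product factorizes; the second factor is an integral against the normal
  density.\<close>

lemma has_bochner_integral_increment:
  assumes st: "0 \<le> s" "s < t" "t \<le> T"
    and f: "f \<in> borel_measurable (F s)" "integrable M f"
    and g[measurable]: "g \<in> borel_measurable borel"
    and I: "has_bochner_integral lborel (\<lambda>x. normal_density 0 (sqrt (t - s)) x * g x) c"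
  shows "has_bochner_integral M (\<lambda>z. f z * g (w t z - w s z)) (expectation f * c)"
proof -
  define V where "V z = w t z - w s z" for z
  have [measurable]: "f \<in> borel_measurable M" by (rule measurable_M[OF _ _ f(1)]) (use st in auto)
  have [measurable]: "V \<in> borel_measurable M"
    unfolding V_def using st by (intro borel_measurable_diff w_measurable) auto
  have ind: "indep_set (sets (F s)) {V -` B \<inter> space M |B. B \<in> sets borel}"
    and dist: "distributed M lborel V (normal_density 0 (sqrt (t - s)))"
    using wiener st unfolding wiener_process_def V_def by auto
  \<comment> \<open>Independence is given for the family of preimages under the increment. Both
    families are stable under intersection, so it extends to the generated sigma algebras, as
    \<open>indep_var\<close> requires.\<close>
  have "indep_set (sigma_sets (space M) (sets (F s))) (sigma_sets (space M) {V -` B \<inter> space M |B. B \<in> sets borel})"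
  proof (intro indep_set_sigma_sets ind)
    show "Int_stable {V -` B \<inter> space M |B. B \<in> sets borel}"
    proof (rule Int_stableI)
      fix a b assume "a \<in> {V -` B \<inter> space M |B. B \<in> sets borel}" "b \<in> {V -` B \<inter> space M |B. B \<in> sets borel}"
      then obtain A B where AB: "A \<in> sets borel" "B \<in> sets borel" "a = V -` A \<inter> space M" "b = V -` B \<inter> space M"
        by blast
      then have "a \<inter> b = V -` (A \<inter> B) \<inter> space M" "A \<inter> B \<in> sets borel" by auto
      then show "a \<inter> b \<in> {V -` B \<inter> space M |B. B \<in> sets borel}" by blast
    qed
  qed (rule sets.Int_stable)
  moreover have "sigma_sets (space M) {f -` A \<inter> space M |A. A \<in> sets borel} \<subseteq> sigma_sets (space M) (sets (F s))"
  proof (rule sigma_sets_mono')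
    show "{f -` A \<inter> space M |A. A \<in> sets borel} \<subseteq> sets (F s)"
      using measurable_sets[OF f(1)] space_F[of s] st by fastforce
  qed
  ultimately have "indep_set (sigma_sets (space M) {f -` A \<inter> space M |A. A \<in> sets borel})
      (sigma_sets (space M) {V -` B \<inter> space M |B. B \<in> sets borel})"
    unfolding indep_sets2_eq by blast
  then have "indep_var borel f borel V"
    unfolding indep_var_eq by simp
  from indep_var_compose[OF this, of "\<lambda>x. x" borel g borel]
  have iv: "indep_var borel f borel (\<lambda>z. g (V z))"
    by (simp add: comp_def)
  have int: "integrable M (\<lambda>z. g (V z))"
    using distributed_integrable[OF dist, of g] I by (auto simp: has_bochner_integral_iff)
  have ex: "expectation (\<lambda>z. g (V z)) = c"
    using distributed_integral[OF dist, of g] I by (auto simp: has_bochner_integral_iff)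
  show ?thesis
    using indep_var_integrable[OF iv f(2) int] indep_var_lebesgue_integral[OF iv f(2) int]
    by (simp add: has_bochner_integral_iff ex[unfolded V_def] V_def)
qed

text \<open>Gaussian moments up to order four; with h = t - s, the last constant arises as 3 h^2 - 2
  h^2 + h^2 = 2 h^2.\<close>

lemma increment_moments:
  assumes st: "0 \<le> s" "s \<le> t" "t \<le> T"
    and f: "f \<in> borel_measurable (F s)" "integrable M f"
  shows "has_bochner_integral M (\<lambda>z. f z * (w t z - w s z)) 0" (is ?A)
    and "has_bochner_integral M (\<lambda>z. f z * (w t z - w s z)^2) (expectation f * (t - s))" (is ?B)
    and "has_bochner_integral M (\<lambda>z. f z * ((w t z - w s z)^2 - (t - s))) 0" (is ?C)
    and "has_bochner_integral M (\<lambda>z. f z * ((w t z - w s z)^2 - (t - s))^2) (expectation f * (2 * (t - s)^2))" (is ?D)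
proof -
  have "?A \<and> ?B \<and> ?C \<and> ?D"
  \<comment> \<open>\<open>wiener_process\<close> describes increments over proper intervals only,
    while partitions of simple integrands may contain repeated points.\<close>
  proof (cases "s = t")
    case True
    then show ?thesis by (simp add: has_bochner_integral_zero)
  next
    case False
    define \<sigma> where "\<sigma> = sqrt (t - s)"
    have \<sigma>: "\<sigma> > 0" "t - s = \<sigma>^2" using False st by (auto simp: \<sigma>_def)
    note * = has_bochner_integral_increment[OF st(1) _ st(3) f, folded \<sigma>_def]
    have n0: "has_bochner_integral lborel (\<lambda>x. normal_density 0 \<sigma> x * 1) 1"
      using normal_moment_even[OF \<sigma>(1), of 0 0] by simp
    have n1: "has_bochner_integral lborel (\<lambda>x. normal_density 0 \<sigma> x * x) 0"
      using normal_moment_odd[OF \<sigma>(1), of 0 0] by simp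
    have n2: "has_bochner_integral lborel (\<lambda>x. normal_density 0 \<sigma> x * x^2) (\<sigma>^2)"
      using normal_moment_even[OF \<sigma>(1), of 0 1] by simp
    have n4: "has_bochner_integral lborel (\<lambda>x. normal_density 0 \<sigma> x * x ^ 4) (3 * \<sigma> ^ 4)"
      using normal_moment_even[OF \<sigma>(1), of 0 2] \<sigma>(1) by (simp add: fact_numeral power_divide)
    have n3: "has_bochner_integral lborel (\<lambda>x. normal_density 0 \<sigma> x * (x^2 - \<sigma>^2)) 0"
      using has_bochner_integral_diff[OF n2 has_bochner_integral_mult_right[OF n0, of "\<sigma>^2"]]
      by (simp add: algebra_simps)
    have n5: "has_bochner_integral lborel (\<lambda>x. normal_density 0 \<sigma> x * (x^2 - \<sigma>^2)^2) (2 * (\<sigma>^2)^2)"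
    proof -
      have "has_bochner_integral lborel (\<lambda>x. normal_density 0 \<sigma> x * x ^ 4 - 2 * \<sigma>^2 * (normal_density 0 \<sigma> x * x^2)
          + \<sigma> ^ 4 * (normal_density 0 \<sigma> x * 1)) (3 * \<sigma> ^ 4 - 2 * \<sigma>^2 * \<sigma>^2 + \<sigma> ^ 4 * 1)"
        by (intro has_bochner_integral_add has_bochner_integral_diff has_bochner_integral_mult_right n0 n2 n4)
      moreover have "normal_density 0 \<sigma> x * x ^ 4 - 2 * \<sigma>^2 * (normal_density 0 \<sigma> x * x^2)
          + \<sigma> ^ 4 * (normal_density 0 \<sigma> x * 1) = normal_density 0 \<sigma> x * (x^2 - \<sigma>^2)^2" for x
        by algebra
      moreover have "3 * \<sigma> ^ 4 - 2 * \<sigma>^2 * \<sigma>^2 + \<sigma> ^ 4 * 1 = 2 * (\<sigma>^2)^2" by algebra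
      ultimately show ?thesis by (simp only:)
    qed
    have lt: "s < t" using False st by simp
    have ?A using *[OF lt _ n1] by simp
    moreover have ?B using *[OF lt _ n2] \<sigma>(2) by simp
    moreover have ?C using *[OF lt _ n3] \<sigma>(2) by simp
    moreover have ?D unfolding \<sigma>(2) by (rule *[OF lt _ n5]) measurable
    ultimately show ?thesis by blast
  qed
  then show ?A ?B ?C ?D by auto
qed

end

section \<open>Stochastic integrals of bounded integrands\<close>

text \<open>Adjacent half-open steps are disjoint and concatenate, so the integral is additive over
  them. Steps of length zero impose no value on \<open>f\<close>.\<close>

lemma nn_integral_step_function:
  fixes r :: "nat \<Rightarrow> real"
  assumes [measurable]: "f \<in> borel_measurable borel"
    and r: "\<And>i. i < n \<Longrightarrow> r i \<le> r (Suc i)"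
    and g: "\<And>i. i < n \<Longrightarrow> 0 \<le> g i"
    and f: "\<And>i u. i < n \<Longrightarrow> r i < u \<Longrightarrow> u \<le> r (Suc i) \<Longrightarrow> f u = ennreal (g i)"
  shows "(\<integral>\<^sup>+u\<in>{r 0<..r n}. f u \<partial>lborel) = ennreal (\<Sum>i<n. g i * (r (Suc i) - r i))"
  using r g f
proof (induction n)
  case (Suc n)
  have "r 0 \<le> r j" if "j \<le> n" for j
    using that
  proof (induction j)
    case (Suc j)
    then show ?case using Suc.prems Suc.IH order_trans[of "r 0" "r j" "r (Suc j)"] \<open>\<And>i. i < Suc n \<Longrightarrow> r i \<le> r (Suc i)\<close>[of j] by simp
  qed simp
  then have eq: "{r 0<..r (Suc n)} = {r 0<..r n} \<union> {r n<..r (Suc n)}"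
    using Suc.prems(1)[of n] by (intro ivl_disj_un_two(6)[symmetric]) auto
  have "(\<integral>\<^sup>+u\<in>{r 0<..r (Suc n)}. f u \<partial>lborel) =
      (\<integral>\<^sup>+u\<in>{r 0<..r n}. f u \<partial>lborel) + (\<integral>\<^sup>+u\<in>{r n<..r (Suc n)}. f u \<partial>lborel)"
    unfolding eq by (intro nn_integral_disjoint_pair) auto
  also have "(\<integral>\<^sup>+u\<in>{r n<..r (Suc n)}. f u \<partial>lborel) = (\<integral>\<^sup>+u. ennreal (g n) * indicator {r n<..r (Suc n)} u \<partial>lborel)"
    using Suc.prems(3)[of n] by (intro nn_integral_cong) (auto split: split_indicator)
  also have "\<dots> = ennreal (g n) * ennreal (r (Suc n) - r n)"
    using Suc.prems(1)[of n] by (simp add: nn_integral_cmult)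
  also have "\<dots> = ennreal (g n * (r (Suc n) - r n))"
    using Suc.prems(1,2)[of n] by (simp add: ennreal_mult)
  also have "(\<integral>\<^sup>+u\<in>{r 0<..r n}. f u \<partial>lborel) = ennreal (\<Sum>i<n. g i * (r (Suc i) - r i))"
    using Suc by simp
  also have "\<dots> + ennreal (g n * (r (Suc n) - r n)) = ennreal (\<Sum>i<Suc n. g i * (r (Suc i) - r i))"
    using Suc.prems(1,2) by (subst ennreal_plus[symmetric]) (auto intro!: sum_nonneg mult_nonneg_nonneg)
  finally show ?case .
qed simp

text \<open>A simple integrand is stopped before its energy exceeds a level \<open>K\<close>. The energy up to
  the end of a step is known at its beginning, so stopping preserves adaptedness.\<close>

definition stopped :: "real \<Rightarrow> (nat \<Rightarrow> real) \<Rightarrow> (nat \<Rightarrow> real) \<Rightarrow> nat \<Rightarrow> real" where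
  "stopped K r g i = (if (\<Sum>l\<le>i. (g l)^2 * (r (Suc l) - r l)) \<le> K then g i else 0)"

text \<open>If the full energy is within \<open>K\<close>, stopping only removes terms; otherwise
  the last term is already stopped and the bound is inherited from the previous step.\<close>

lemma stopped_energy:
  assumes r: "\<And>i. i < n \<Longrightarrow> r i \<le> r (Suc i)" and "K \<ge> 0"
  shows "(\<Sum>i<n. (stopped K r g i)^2 * (r (Suc i) - r i)) \<le> min K (\<Sum>i<n. (g i)^2 * (r (Suc i) - r i))"
  using r
proof (induction n)
  case (Suc n)
  show ?case
  proof (cases "(\<Sum>l\<le>n. (g l)^2 * (r (Suc l) - r l)) \<le> K")
    case True
    have "(\<Sum>i<Suc n. (stopped K r g i)^2 * (r (Suc i) - r i)) \<le> (\<Sum>i<Suc n. (g i)^2 * (r (Suc i) - r i))"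
      using Suc.prems by (intro sum_mono mult_right_mono) (auto simp: stopped_def)
    then show ?thesis using True by (simp add: lessThan_Suc_atMost)
  next
    case False
    have "0 \<le> (g n)^2 * (r (Suc n) - r n)" using Suc.prems[of n] by simp
    moreover have "stopped K r g n = 0" using False by (simp add: stopped_def)
    moreover have "(\<Sum>i<n. (stopped K r g i)^2 * (r (Suc i) - r i)) \<le> min K (\<Sum>i<n. (g i)^2 * (r (Suc i) - r i))"
      using Suc by simp
    ultimately show ?thesis by simp
  qed
qed (use assms in simp)

text \<open>Partial energies increase to the total, so none of them exceeds \<open>K\<close> if the
  total does not.\<close>

lemma stopped_eq:
  assumes r: "\<And>i. i < n \<Longrightarrow> r i \<le> r (Suc i)"
    and le: "(\<Sum>i<n. (g i)^2 * (r (Suc i) - r i)) \<le> K" and i: "i < n"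
  shows "stopped K r g i = g i"
proof -
  have "(\<Sum>l\<le>i. (g l)^2 * (r (Suc l) - r l)) \<le> (\<Sum>i<n. (g i)^2 * (r (Suc i) - r i))"
    using r i by (intro sum_mono2) auto
  then show ?thesis using le by (simp add: stopped_def)
qed

text \<open>Passing from the integral up to \<open>t\<close> minus the integral up to
  \<open>s\<close> to an integral over a grid clamped to the interval between them. The case
  distinction has the same form as the cut-off of integrand values revealed after
  \<open>t\<close>.\<close>

lemma increment_clamp:
  fixes f :: "real \<Rightarrow> real"
  assumes "x \<le> y" "s \<le> t"
  shows "f (min t y) - f (min t x) - (f (min s y) - f (min s x)) =
    (if x \<le> t then f (max s (min t y)) - f (max s (min t x)) else 0)"
  using assms by (auto simp: min_def max_def)

section \<open>Isometry for simple integrands and its passage to the limit\<close>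

context filtered_wiener
begin

text \<open>The martingale transform with Wiener increments, whose conditional variances are the
  step lengths. The energy stays under the expectation because it is estimated path by path
  afterwards.\<close>

lemma simple_isometry:
  assumes r: "\<And>i. i \<le> m \<Longrightarrow> 0 \<le> r i \<and> r i \<le> T" "\<And>i. i < m \<Longrightarrow> r i \<le> r (Suc i)"
    and \<xi>: "\<And>i. i < m \<Longrightarrow> \<xi> i \<in> borel_measurable (F (r i))"
    and bnd: "\<And>i. i < m \<Longrightarrow> \<exists>K. \<forall>z\<in>space M. \<bar>\<xi> i z\<bar> \<le> K"
  shows "mean M (\<lambda>z. (\<Sum>i<m. \<xi> i z * (w (r (Suc i)) z - w (r i) z))^2) =
    mean M (\<lambda>z. \<Sum>i<m. (\<xi> i z)^2 * (r (Suc i) - r i))"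
proof -
  let ?v = "\<Sum>i<m. expectation (\<lambda>z. (\<xi> i z)^2) * (r (Suc i) - r i)"
  have 1: "has_bochner_integral M (\<lambda>z. (\<Sum>i<m. \<xi> i z * (w (r (Suc i)) z - w (r i) z))^2) ?v"
  proof (intro conjunct2[OF martingale_transform_square[where G = "\<lambda>i. F (r i)"]])
    fix i assume i: "i < m"
    then have ri: "0 \<le> r i" "r i \<le> r (Suc i)" "r (Suc i) \<le> T" using r(1)[of i] r(1)[of "Suc i"] r(2) by auto
    show "subalgebra (F (r (Suc i))) (F (r i))" using ri by (rule sub_mono)
    show "(\<lambda>z. w (r (Suc i)) z - w (r i) z) \<in> borel_measurable (F (r (Suc i)))"
      using ri by (intro borel_measurable_diff w_measurable_F) auto
    fix f :: "'a \<Rightarrow> real" assume "f \<in> borel_measurable (F (r i))" "integrable M f"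
    then show "has_bochner_integral M (\<lambda>z. f z * (w (r (Suc i)) z - w (r i) z)) 0"
      "has_bochner_integral M (\<lambda>z. f z * (w (r (Suc i)) z - w (r i) z)^2) (expectation f * (r (Suc i) - r i))"
      using increment_moments(1,2)[OF ri] by auto
  qed (use r \<xi> bnd sub in auto)
  have int: "integrable M (\<lambda>z. (\<xi> i z)^2)" if i: "i < m" for i
  proof -
    obtain K where K: "\<And>z. z \<in> space M \<Longrightarrow> \<bar>\<xi> i z\<bar> \<le> K" using bnd[OF i] by auto
    have "\<xi> i \<in> borel_measurable M"
      by (rule measurable_M[OF _ _ \<xi>[OF i]]) (use r(1)[of i] i in auto)
    moreover have "norm ((\<xi> i z)^2) \<le> K^2" if "z \<in> space M" for z
      using power_mono[OF K[OF that], of 2] by simp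
    ultimately show ?thesis by (intro integrable_const_bound[of _ "K^2"] AE_I2) auto
  qed
  have 2: "has_bochner_integral M (\<lambda>z. \<Sum>i<m. (\<xi> i z)^2 * (r (Suc i) - r i)) ?v"
    using int by (intro has_bochner_integral_sum has_bochner_integral_mult_left has_bochner_integral_integrable) auto
  have nn: "0 \<le> (\<Sum>i<m. (\<xi> i z)^2 * (r (Suc i) - r i))" for z
    using r(2) by (intro sum_nonneg) auto
  have "mean M (\<lambda>z. (\<Sum>i<m. \<xi> i z * (w (r (Suc i)) z - w (r i) z))^2) = ennreal ?v"
    using 1 by (subst nn_integral_eq_integral) (auto simp: has_bochner_integral_iff)
  also have "ennreal ?v = mean M (\<lambda>z. \<Sum>i<m. (\<xi> i z)^2 * (r (Suc i) - r i))"
    using 2 nn by (subst nn_integral_eq_integral) (auto simp: has_bochner_integral_iff)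
  finally show ?thesis .
qed

lemma stopped_simple_integral:
  assumes simple: "simple_integrand T F m \<rho> \<xi>"
    and Hm: "jointly_measurable M T H"
    and st: "0 \<le> s" "s \<le> t" "t \<le> T"
    and c: "c \<in> borel_measurable (F s)" "\<And>z. z \<in> space M \<Longrightarrow> \<bar>c z\<bar> \<le> Kc"
    and Q: "\<And>z. z \<in> space M \<Longrightarrow> sq_int {s<..t} (\<lambda>u. H u z - c z) \<le> ennreal K0" "K0 \<ge> 0"
  obtains S E where "S \<in> borel_measurable M" "E \<in> borel_measurable M"
    "mean M (\<lambda>z. (S z)^2) = mean M (\<lambda>z. E z)"
    "\<And>z. E z \<le> 2 * K0 + 2"
    "\<And>z. z \<in> space M \<Longrightarrow> ennreal (E z) \<le>
       2 * sq_int {0..T} (\<lambda>u. simple_value m \<rho> \<xi> u z - H u z) +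
       2 * sq_int {s<..t} (\<lambda>u. H u z - c z)"
    "\<And>z. z \<in> space M \<Longrightarrow>
       sq_int {0..T} (\<lambda>u. simple_value m \<rho> \<xi> u z - H u z) \<le> 1 \<Longrightarrow>
       S z = simple_integral w m \<rho> \<xi> t z - simple_integral w m \<rho> \<xi> s z - c z * (w t z - w s z)"
proof -
  have \<rho>: "\<And>i. i \<le> m \<Longrightarrow> 0 \<le> \<rho> i \<and> \<rho> i \<le> T" "\<And>i. i < m \<Longrightarrow> \<rho> i \<le> \<rho> (Suc i)"
    and \<xi>: "\<And>i. i < m \<Longrightarrow> \<xi> i \<in> borel_measurable (F (\<rho> i))"
    and \<xi>b: "\<And>i. i < m \<Longrightarrow> bounded (\<xi> i ` space (F (\<rho> i)))"
    using simple by (auto simp: simple_integrand_def)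
  have \<rho>_mono: "\<rho> i \<le> \<rho> j" if "i \<le> j" "j \<le> m" for i j
    using that by (induction j) (auto simp: le_Suc_eq intro: order_trans[OF _ \<rho>(2)])
  define cl where "cl x = max s (min t x)" for x
  \<comment> \<open>The partition points clamped to the interval, preceded by \<open>s\<close> and
    followed by \<open>t\<close>; this gives m + 2 steps.\<close>
  define r where "r i = (if i = 0 then s else if i \<le> Suc m then cl (\<rho> (i - 1)) else t)" for i
  \<comment> \<open>The two outer steps carry the value 0 of the simple integrand outside its
    partition. A value revealed after \<open>t\<close> is replaced by 0 as well: it belongs to a
    step of length zero at \<open>t\<close> and would violate adaptedness there.\<close>
  define \<zeta> where "\<zeta> i z = (if 0 < i \<and> i \<le> m \<and> \<rho> (i - 1) \<le> t then \<xi> (i - 1) z else 0)" for i z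
  define g where "g z i = \<zeta> i z - c z" for z i
  define N where "N = Suc (Suc m)"
  \<comment> \<open>The energy is at most 2 * D z + 2 * Q' z, and so at most \<open>K\<close> as
    soon as D z is at most 1.\<close>
  define K where "K = 2 * K0 + 2"
  define S where "S z = (\<Sum>i<N. stopped K r (g z) i * (w (r (Suc i)) z - w (r i) z))" for z
  define E where "E z = (\<Sum>i<N. (stopped K r (g z) i)^2 * (r (Suc i) - r i))" for z
  define D where "D z = sq_int {0..T} (\<lambda>u. simple_value m \<rho> \<xi> u z - H u z)" for z
  define Q' where "Q' z = sq_int {s<..t} (\<lambda>u. H u z - c z)" for z
  have K: "K \<ge> 0" using Q(2) by (simp add: K_def)
  have cl: "s \<le> cl x" "cl x \<le> t" for x using st by (auto simp: cl_def)
  have r_range: "s \<le> r i" "r i \<le> t" for i using cl st by (auto simp: r_def)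
  have r_step: "r i \<le> r (Suc i)" for i
  proof -
    consider "i = 0" | l where "i = Suc l" "l < m" | "i \<ge> Suc m" by (metis not_less_eq_eq not0_implies_Suc not_le Suc_less_eq)
    then show ?thesis
    proof cases
      case 2
      then show ?thesis using \<rho>(2)[of l] by (auto simp: r_def cl_def)
    qed (use cl r_range in \<open>auto simp: r_def\<close>)
  qed
  have r_mono: "r i \<le> r j" if "i \<le> j" for i j by (rule lift_Suc_mono_le[of r, OF r_step that])
  have r0T: "0 \<le> r i" "r i \<le> T" for i using r_range[of i] st by auto
  have g_meas: "(\<lambda>z. g z i) \<in> borel_measurable (F (r i))" if "i < N" for i
  proof -
    have "c \<in> borel_measurable (F (r i))"
      using r_range[of i] st by (intro measurable_F_mono[OF _ _ _ c(1)]) auto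
    moreover have "\<zeta> i \<in> borel_measurable (F (r i))"
    proof (cases "0 < i \<and> i \<le> m \<and> \<rho> (i - 1) \<le> t")
      case True
      then have "\<zeta> i = \<xi> (i - 1)" by (simp add: \<zeta>_def fun_eq_iff)
      moreover have "\<rho> (i - 1) \<le> r i" using True by (auto simp: r_def cl_def)
      moreover have "i - 1 < m" "0 \<le> \<rho> (i - 1)" using True \<rho>(1)[of "i - 1"] by auto
      ultimately show ?thesis using measurable_F_mono[OF _ _ r0T(2) \<xi>[of "i - 1"]] by simp
    next
      case False
      then have "\<zeta> i = (\<lambda>_. 0)" by (auto simp: \<zeta>_def fun_eq_iff)
      then show ?thesis by simp
    qed
    ultimately show ?thesis unfolding g_def by (intro borel_measurable_diff)
  qed
  have st_meas: "(\<lambda>z. stopped K r (g z) i) \<in> borel_measurable (F (r i))" if i: "i < N" for i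
  proof -
    have gl: "(\<lambda>z. g z l) \<in> borel_measurable (F (r i))" if "l \<le> i" for l
      using that i by (intro measurable_F_mono[OF _ _ _ g_meas[of l]] r0T r_mono) auto
    note [measurable] = g_meas[OF i]
    have [measurable]: "(\<lambda>z. \<Sum>l\<le>i. (g z l)^2 * (r (Suc l) - r l)) \<in> borel_measurable (F (r i))"
      using gl by (intro borel_measurable_sum borel_measurable_times borel_measurable_power) auto
    show ?thesis unfolding stopped_def by measurable
  qed
  have st_bnd: "\<exists>B. \<forall>z\<in>space M. \<bar>stopped K r (g z) i\<bar> \<le> B" if i: "i < N" for i
  proof -
    have "\<exists>B\<ge>0. \<forall>z\<in>space M. \<bar>\<zeta> i z\<bar> \<le> B"
    proof (cases "0 < i \<and> i \<le> m")
      case True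
      then have "bounded (\<xi> (i - 1) ` space M)"
        using \<xi>b[of "i - 1"] space_F[of "\<rho> (i - 1)"] \<rho>(1)[of "i - 1"] by auto
      then obtain B where "B > 0" "\<forall>z\<in>space M. \<bar>\<xi> (i - 1) z\<bar> \<le> B"
        unfolding bounded_pos by auto
      then show ?thesis by (intro exI[of _ B]) (auto simp: \<zeta>_def)
    next
      case False
      then show ?thesis by (intro exI[of _ 0]) (auto simp: \<zeta>_def)
    qed
    then obtain B where B: "B \<ge> 0" "\<And>z. z \<in> space M \<Longrightarrow> \<bar>\<zeta> i z\<bar> \<le> B" by auto
    have "\<bar>stopped K r (g z) i\<bar> \<le> B + Kc" if "z \<in> space M" for z
      using B(2)[OF that] c(2)[OF that] by (auto simp: stopped_def g_def)
    then show ?thesis by auto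
  qed
  have sv: "simple_value m \<rho> \<xi> u z = \<zeta> i z" if i: "i < N" and u: "r i < u" "u \<le> r (Suc i)" for i u z
  proof -
    have su: "s < u" "u \<le> t" using r_range[of i] r_range[of "Suc i"] u by auto
    have cl1: "u \<le> cl x \<longleftrightarrow> u \<le> x" for x using su by (auto simp: cl_def)
    have cl2: "cl x < u \<longleftrightarrow> x < u" for x using su by (auto simp: cl_def)
    consider "i = 0" | l where "i = Suc l" "l < m" | "i = Suc m" using i unfolding N_def
      by (metis less_Suc_eq not0_implies_Suc Suc_less_eq)
    then show ?thesis
    proof cases
      case 1
      then have "u \<le> \<rho> 0" using u cl1 by (simp add: r_def)
      then have "\<not> \<rho> j < u" if "j < m" for j using \<rho>_mono[of 0 j] that by auto
      then show ?thesis using 1 by (auto simp: simple_value_def \<zeta>_def intro!: sum.neutral)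
    next
      case 2
      then have u': "\<rho> l < u" "u \<le> \<rho> (Suc l)" using u cl1 cl2 by (auto simp: r_def)
      have "simple_value m \<rho> \<xi> u z = (\<Sum>j<m. if j = l then \<xi> l z else 0)"
        unfolding simple_value_def
      proof (intro sum.cong refl)
        fix j assume j: "j \<in> {..<m}"
        consider "j = l" | "Suc j \<le> l" | "Suc l \<le> j" by linarith
        then show "\<xi> j z * indicator {\<rho> j<..\<rho> (Suc j)} u = (if j = l then \<xi> l z else 0)"
        proof cases
          case 2
          then show ?thesis using \<rho>_mono[of "Suc j" l] u' \<open>l < m\<close> by auto
        next
          case 3
          then show ?thesis using \<rho>_mono[of "Suc l" j] u' j by auto
        qed (use u' in auto)
      qed
      also have "\<dots> = \<xi> l z" using 2 by simp
      also have "\<dots> = \<zeta> i z" using 2 u' su by (simp add: \<zeta>_def)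
      finally show ?thesis .
    next
      case 3
      then have "\<rho> m < u" using u cl2 by (simp add: r_def)
      then have "\<not> u \<le> \<rho> (Suc j)" if "j < m" for j using \<rho>_mono[of "Suc j" m] that by auto
      then show ?thesis using 3 by (auto simp: simple_value_def \<zeta>_def intro!: sum.neutral)
    qed
  qed
  have sv_meas[measurable]: "(\<lambda>u. simple_value m \<rho> \<xi> u z) \<in> borel_measurable borel" for z
    unfolding simple_value_def by measurable
  have energy: "ennreal (\<Sum>i<N. (g z i)^2 * (r (Suc i) - r i)) \<le> 2 * D z + 2 * Q' z" if z: "z \<in> space M" for z
  proof -
    define h where "h u = H (max 0 (min T u)) z" for u
    have [measurable]: "h \<in> borel_measurable borel"
      unfolding h_def using measurable_compose[OF _ Hm, of "\<lambda>u. (u, z)" borel] z by simp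
    have hH: "h u = H u z" if "u \<in> {0..T}" for u using that by (simp add: h_def)
    have "ennreal (\<Sum>i<N. (g z i)^2 * (r (Suc i) - r i)) =
        (\<integral>\<^sup>+u\<in>{r 0<..r N}. ennreal ((simple_value m \<rho> \<xi> u z - c z)^2) \<partial>lborel)"
      using r_step sv by (intro nn_integral_step_function[symmetric]) (auto simp: g_def)
    also have "\<dots> \<le> (\<integral>\<^sup>+u. 2 * (ennreal ((simple_value m \<rho> \<xi> u z - h u)^2) * indicator {0..T} u) +
        2 * (ennreal ((h u - c z)^2) * indicator {s<..t} u) \<partial>lborel)"
    proof (intro nn_integral_mono)
      fix u
      have "(simple_value m \<rho> \<xi> u z - c z)^2 \<le> 2 * (simple_value m \<rho> \<xi> u z - h u)^2 + 2 * (h u - c z)^2"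
        using sum_squares_ge_zero[of "simple_value m \<rho> \<xi> u z - h u - (h u - c z)" 0]
        by (simp add: power2_eq_square algebra_simps)
      then have "ennreal ((simple_value m \<rho> \<xi> u z - c z)^2) \<le>
          2 * ennreal ((simple_value m \<rho> \<xi> u z - h u)^2) + 2 * ennreal ((h u - c z)^2)"
        by (simp add: ennreal_mult'[symmetric] ennreal_plus[symmetric] ennreal_numeral[symmetric]
            del: ennreal_plus ennreal_numeral)
      moreover have "r 0 = s" "r N = t" by (auto simp: r_def N_def)
      ultimately show "ennreal ((simple_value m \<rho> \<xi> u z - c z)^2) * indicator {r 0<..r N} u \<le>
          2 * (ennreal ((simple_value m \<rho> \<xi> u z - h u)^2) * indicator {0..T} u) +
          2 * (ennreal ((h u - c z)^2) * indicator {s<..t} u)"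
        using st by (auto split: split_indicator)
    qed
    also have "\<dots> = 2 * sq_int {0..T} (\<lambda>u. simple_value m \<rho> \<xi> u z - h u) +
        2 * sq_int {s<..t} (\<lambda>u. h u - c z)"
      by (subst nn_integral_add) (auto simp: nn_integral_cmult)
    also have "sq_int {0..T} (\<lambda>u. simple_value m \<rho> \<xi> u z - h u) = D z"
      unfolding D_def using hH by (intro nn_integral_cong) (auto split: split_indicator)
    also have "sq_int {s<..t} (\<lambda>u. h u - c z) = Q' z"
      unfolding Q'_def using hH st by (intro nn_integral_cong) (auto split: split_indicator)
    finally show ?thesis .
  qed
  show ?thesis
  proof (rule that[of S E])
    have stM: "(\<lambda>z. stopped K r (g z) i) \<in> borel_measurable M" if "i < N" for i
      by (rule measurable_M[OF _ _ st_meas[OF that]]) (use r0T in auto)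
    show "S \<in> borel_measurable M"
      unfolding S_def using stM r0T by (intro borel_measurable_sum borel_measurable_times borel_measurable_diff w_measurable) auto
    show "E \<in> borel_measurable M"
      unfolding E_def using stM by (intro borel_measurable_sum borel_measurable_times borel_measurable_power) auto
    show "mean M (\<lambda>z. (S z)^2) = mean M (\<lambda>z. E z)"
      unfolding S_def E_def using r0T r_step st_meas st_bnd by (intro simple_isometry) auto
    show "E z \<le> 2 * K0 + 2" for z
      using stopped_energy[of N r K "g z"] r_step K by (simp add: E_def K_def)
    fix z assume z: "z \<in> space M"
    have "E z \<le> (\<Sum>i<N. (g z i)^2 * (r (Suc i) - r i))"
      using stopped_energy[of N r K "g z"] r_step K by (simp add: E_def)
    then show "ennreal (E z) \<le> 2 * sq_int {0..T} (\<lambda>u. simple_value m \<rho> \<xi> u z - H u z) +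
       2 * sq_int {s<..t} (\<lambda>u. H u z - c z)"
      using energy[OF z] unfolding D_def Q'_def by (blast intro: order_trans ennreal_leI)
    assume "sq_int {0..T} (\<lambda>u. simple_value m \<rho> \<xi> u z - H u z) \<le> 1"
    then have "2 * D z + 2 * Q' z \<le> 2 * 1 + 2 * ennreal K0"
      unfolding D_def Q'_def using Q(1)[OF z] by (intro add_mono mult_left_mono) auto
    also have "\<dots> = ennreal K"
      using Q(2) by (simp add: K_def ennreal_plus ennreal_mult add.commute)
    finally have "(\<Sum>i<N. (g z i)^2 * (r (Suc i) - r i)) \<le> K"
      using energy[OF z] K by (meson ennreal_le_iff order_trans)
    then have "S z = (\<Sum>i<N. g z i * (w (r (Suc i)) z - w (r i) z))"
      unfolding S_def using r_step by (intro sum.cong refl) (simp add: stopped_eq)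
    also have "\<dots> = (\<Sum>i<N. \<zeta> i z * (w (r (Suc i)) z - w (r i) z)) - c z * (\<Sum>i<N. w (r (Suc i)) z - w (r i) z)"
      by (simp only: g_def left_diff_distrib sum_subtractf[symmetric] sum_distrib_left)
    also have "(\<Sum>i<N. w (r (Suc i)) z - w (r i) z) = w t z - w s z"
      by (subst sum_lessThan_telescope[of "\<lambda>i. w (r i) z"]) (simp add: r_def N_def)
    also have "(\<Sum>i<N. \<zeta> i z * (w (r (Suc i)) z - w (r i) z)) =
        (\<Sum>i<m. \<xi> i z * (if \<rho> i \<le> t then w (cl (\<rho> (Suc i))) z - w (cl (\<rho> i)) z else 0))"
      unfolding N_def sum.lessThan_Suc_shift[of _ "Suc m"] sum.lessThan_Suc[of _ m]
      by (auto simp: \<zeta>_def r_def intro!: sum.cong)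
    also have "\<dots> = (\<Sum>i<m. \<xi> i z * (w (min t (\<rho> (Suc i))) z - w (min t (\<rho> i)) z -
        (w (min s (\<rho> (Suc i))) z - w (min s (\<rho> i)) z)))"
      using \<rho>(2) st by (intro sum.cong refl) (simp only: increment_clamp[of _ _ s t "\<lambda>x. w x z"] cl_def lessThan_iff)
    also have "\<dots> = simple_integral w m \<rho> \<xi> t z - simple_integral w m \<rho> \<xi> s z"
      by (simp add: simple_integral_def sum_subtractf[symmetric] algebra_simps)
    finally show "S z = simple_integral w m \<rho> \<xi> t z - simple_integral w m \<rho> \<xi> s z - c z * (w t z - w s z)" .
  qed
qed

text \<open>The stopped approximants agree with the simple integrals off small events, and their
  second moments are known. The constant 4 is 2 * 2: one factor from splitting the energy, one from
  replacing the limit by its approximant.\<close>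

lemma ito_increment_bound:
  assumes ito: "ito_integral M T F w H I"
    and Hm: "jointly_measurable M T H"
    and st: "0 \<le> s" "s \<le> t" "t \<le> T"
    and c: "c \<in> borel_measurable (F s)" "\<And>z. z \<in> space M \<Longrightarrow> \<bar>c z\<bar> \<le> Kc"
    and Q: "\<And>z. z \<in> space M \<Longrightarrow> sq_int {s<..t} (\<lambda>u. H u z - c z) \<le> ennreal K0" "K0 \<ge> 0"
  shows "mean M (\<lambda>z. (I t z - I s z - c z * (w t z - w s z))^2) \<le>
    4 * (\<integral>\<^sup>+z. sq_int {s<..t} (\<lambda>u. H u z - c z) \<partial>M)"
proof -
  have I: "\<And>t. t \<in> {0..T} \<Longrightarrow> I t \<in> borel_measurable M" using ito by (auto simp: ito_integral_def)
  obtain m \<rho> \<xi> where simple: "\<And>k. simple_integrand T F (m k) (\<rho> k) (\<xi> k)"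
    and approx: "vanishes_in_prob M
        (\<lambda>k z. \<integral>\<^sup>+t\<in>{0..T}. ennreal ((simple_value (m k) (\<rho> k) (\<xi> k) t z - H t z)^2) \<partial>lborel)"
    and lim: "\<And>t. t \<in> {0..T} \<Longrightarrow> converges_in_prob M (\<lambda>k. simple_integral w (m k) (\<rho> k) (\<xi> k) t) (I t)"
    using ito unfolding ito_integral_def by blast
  define D where "D k z = sq_int {0..T} (\<lambda>t. simple_value (m k) (\<rho> k) (\<xi> k) t z - H t z)" for k z
  define Q' where "Q' z = sq_int {s<..t} (\<lambda>u. H u z - c z)" for z
  define J where "J z = I t z - I s z - c z * (w t z - w s z)" for z
  define V where "V k z = simple_integral w (m k) (\<rho> k) (\<xi> k) t z - simple_integral w (m k) (\<rho> k) (\<xi> k) s z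
      - c z * (w t z - w s z)" for k z
  define q where "q = (\<integral>\<^sup>+z. Q' z \<partial>M)"
  have cM[measurable]: "c \<in> borel_measurable M" by (rule measurable_M[OF _ _ c(1)]) (use st in auto)
  have Jm[measurable]: "J \<in> borel_measurable M"
    unfolding J_def using st by (intro borel_measurable_diff borel_measurable_times w_measurable I cM) auto
  have Q'm[measurable]: "Q' \<in> borel_measurable M"
  proof -
    have [measurable]: "(\<lambda>p. H (max 0 (min T (snd p))) (fst p)) \<in> borel_measurable (M \<Otimes>\<^sub>M lborel)"
      using measurable_compose[OF _ Hm, of "\<lambda>p. (snd p, fst p)" "M \<Otimes>\<^sub>M lborel"] by simp
    have clamp: "max 0 (min T u) = u" if "u \<in> {s<..t}" for u using that st by auto
    have "(\<lambda>z. \<integral>\<^sup>+u\<in>{s<..t}. ennreal ((H (max 0 (min T (snd (z, u)))) (fst (z, u)) - c z)^2) \<partial>lborel) \<in> borel_measurable M"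
      by measurable
    also have "(\<lambda>z. \<integral>\<^sup>+u\<in>{s<..t}. ennreal ((H (max 0 (min T (snd (z, u)))) (fst (z, u)) - c z)^2) \<partial>lborel) = Q'"
      unfolding Q'_def by (intro ext nn_integral_cong) (simp add: clamp split: split_indicator)
    finally show ?thesis .
  qed
  \<comment> \<open>On the exceptional events nothing is known about \<open>J\<close>; truncation at
    \<open>L\<close> makes their contribution at most \<open>L\<close> times a vanishing
    probability.\<close>
  have bound_L: "mean M (\<lambda>z. min ((J z)^2) L) \<le> 4 * q" if L: "L \<ge> 0" for L
  proof (rule ennreal_le_epsilon)
    fix e :: real assume e: "e > 0"
    \<comment> \<open>The bound 1 ensures that stopping is invisible off the exceptional events;
      then 4 * d + 2 * d^2 is at most 6 * d and hence at most \<open>e\<close>.\<close>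
    define d where "d = min 1 (e / 6)"
    have d: "d > 0" "4 * d + 2 * d^2 \<le> e"
    proof -
      show "d > 0" using e by (simp add: d_def)
      then have "d * d \<le> 1 * d" by (intro mult_right_mono) (auto simp: d_def)
      moreover have "d \<le> e / 6" by (simp add: d_def)
      ultimately show "4 * d + 2 * d^2 \<le> e" by (simp add: power2_eq_square)
    qed
    obtain A where A[measurable]: "\<And>k. A k \<in> sets M" and AD: "\<And>k z. z \<in> space M \<Longrightarrow> z \<notin> A k \<Longrightarrow> D k z \<le> ennreal d"
      and A0: "(\<lambda>k. emeasure M (A k)) \<longlonglongrightarrow> 0"
      using vanishes_in_prob_cover[OF approx d(1)] unfolding D_def by blast
    have "\<exists>B. (\<forall>k. B k \<in> sets M) \<and> (\<forall>k. \<forall>z\<in>space M. z \<notin> B k \<longrightarrow>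
        \<bar>simple_integral w (m k) (\<rho> k) (\<xi> k) u z - I u z\<bar> \<le> d / 2) \<and> (\<lambda>k. emeasure M (B k)) \<longlonglongrightarrow> 0"
      if u: "u \<in> {0..T}" for u
    proof -
      have "d / 2 > 0" using d by simp
      show ?thesis
      proof (rule vanishes_in_prob_cover[OF lim[OF u, unfolded converges_in_prob_def] \<open>d / 2 > 0\<close>])
        fix B assume B: "\<And>k. B k \<in> sets M" "(\<lambda>k. emeasure M (B k)) \<longlonglongrightarrow> 0"
          "\<And>k z. z \<in> space M \<Longrightarrow> z \<notin> B k \<Longrightarrow>
            ennreal (norm (simple_integral w (m k) (\<rho> k) (\<xi> k) u z - I u z)) \<le> ennreal (d / 2)"
        have "\<bar>simple_integral w (m k) (\<rho> k) (\<xi> k) u z - I u z\<bar> \<le> d / 2"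
          if "z \<in> space M" "z \<notin> B k" for k z
          using B(3)[OF that] d by simp
        then show ?thesis using B(1,2) by blast
      qed
    qed
    note cover = this
    have "t \<in> {0..T}" "s \<in> {0..T}" using st by auto
    obtain B where B'[measurable]: "\<And>k. B k \<in> sets M" and B0: "(\<lambda>k. emeasure M (B k)) \<longlonglongrightarrow> 0"
      and B: "\<And>k z. z \<in> space M \<Longrightarrow> z \<notin> B k \<Longrightarrow> \<bar>simple_integral w (m k) (\<rho> k) (\<xi> k) t z - I t z\<bar> \<le> d / 2"
      using cover[OF \<open>t \<in> {0..T}\<close>] by blast
    obtain C where C'[measurable]: "\<And>k. C k \<in> sets M" and C0: "(\<lambda>k. emeasure M (C k)) \<longlonglongrightarrow> 0"
      and C: "\<And>k z. z \<in> space M \<Longrightarrow> z \<notin> C k \<Longrightarrow> \<bar>simple_integral w (m k) (\<rho> k) (\<xi> k) s z - I s z\<bar> \<le> d / 2"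
      using cover[OF \<open>s \<in> {0..T}\<close>] by blast
    define K where "K = 2 * K0 + 2"
    have K: "K \<ge> 0" using Q(2) by (simp add: K_def)
    \<comment> \<open>The error budget: twice the second moment of \<open>S\<close>, with worst-case
      energy \<open>K\<close> on \<open>A k\<close>, the distance between \<open>J\<close> and its
      approximant, and the level \<open>L\<close> on the three exceptional events.\<close>
    define R where "R k = 2 * (2 * q + ennreal (2 * d) + ennreal K * emeasure M (A k)) + ennreal (2 * d^2) +
       ennreal L * (emeasure M (A k) + emeasure M (B k) + emeasure M (C k))" for k
    have le: "mean M (\<lambda>z. min ((J z)^2) L) \<le> R k" for k
    proof -
      obtain S E where SE: "S \<in> borel_measurable M" "E \<in> borel_measurable M"
          "mean M (\<lambda>z. (S z)^2) = mean M (\<lambda>z. E z)"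
          "\<And>z. E z \<le> 2 * K0 + 2"
          "\<And>z. z \<in> space M \<Longrightarrow> ennreal (E z) \<le> 2 * D k z + 2 * Q' z"
          "\<And>z. z \<in> space M \<Longrightarrow> D k z \<le> 1 \<Longrightarrow> S z = V k z"
        by (rule stopped_simple_integral[OF simple[of k] Hm st c Q, folded D_def Q'_def V_def],
            assumption, assumption, rule that)
      note [measurable] = SE(1,2)
      have "mean M (\<lambda>z. E z) \<le> (\<integral>\<^sup>+z. 2 * Q' z + ennreal (2 * d) + ennreal K * indicator (A k) z \<partial>M)"
      proof (rule nn_integral_mono)
        fix z assume z: "z \<in> space M"
        show "ennreal (E z) \<le> 2 * Q' z + ennreal (2 * d) + ennreal K * indicator (A k) z"
        proof (cases "z \<in> A k")
          case True
          have "ennreal (E z) \<le> ennreal K" using SE(4)[of z] by (intro ennreal_leI) (simp add: K_def)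
          also have "\<dots> \<le> 2 * Q' z + ennreal (2 * d) + ennreal K" by (rule add_increasing) simp_all
          finally show ?thesis using True by simp
        next
          case False
          have "2 * D k z + 2 * Q' z \<le> 2 * ennreal d + 2 * Q' z"
            using AD[OF z False] by (intro add_mono mult_left_mono) auto
          then show ?thesis using SE(5)[OF z] False d by (simp add: ennreal_mult add.commute order_trans)
        qed
      qed
      also have "\<dots> = 2 * q + ennreal (2 * d) + ennreal K * emeasure M (A k)"
        unfolding q_def by (simp add: nn_integral_add nn_integral_cmult emeasure_space_1)
      finally have S2: "mean M (\<lambda>z. (S z)^2) \<le> 2 * q + ennreal (2 * d) + ennreal K * emeasure M (A k)"
        using SE(3) by simp
      have "mean M (\<lambda>z. min ((J z)^2) L) \<le> (\<integral>\<^sup>+z. 2 * ennreal ((S z)^2) + ennreal (2 * d^2) +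
          ennreal L * (indicator (A k) z + indicator (B k) z + indicator (C k) z) \<partial>M)"
      proof (rule nn_integral_mono)
        fix z assume z: "z \<in> space M"
        show "ennreal (min ((J z)^2) L) \<le> 2 * ennreal ((S z)^2) + ennreal (2 * d^2) +
          ennreal L * (indicator (A k) z + indicator (B k) z + indicator (C k) z)"
        proof (cases "z \<in> A k \<union> B k \<union> C k")
          case True
          then have "1 \<le> (indicator (A k) z + indicator (B k) z + indicator (C k) z :: ennreal)"
            by (auto intro: add_increasing add_increasing2)
          then have "ennreal L * 1 \<le> ennreal L * (indicator (A k) z + indicator (B k) z + indicator (C k) z)"
            by (rule mult_left_mono) simp
          moreover have "ennreal (min ((J z)^2) L) \<le> ennreal L * 1" by (simp add: ennreal_leI)
          ultimately show ?thesis by (blast intro: order_trans add_increasing zero_le)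
        next
          case False
          have "D k z \<le> ennreal d" using AD z False by auto
          also have "\<dots> \<le> 1" by (simp add: d_def)
          finally have S: "S z = V k z" using SE(6) z by auto
          have "\<bar>J z - V k z\<bar> \<le> d"
            using B[OF z, of k] C[OF z, of k] False unfolding J_def V_def abs_le_iff Un_iff by argo
          then have "(J z - V k z)^2 \<le> d^2" using power_mono[of "\<bar>J z - V k z\<bar>" d 2] by simp
          moreover have "(J z)^2 \<le> 2 * (V k z)^2 + 2 * (J z - V k z)^2"
            using zero_le_power2[of "2 * V k z - J z"] by (simp add: power2_eq_square algebra_simps)
          ultimately have "min ((J z)^2) L \<le> 2 * (S z)^2 + 2 * d^2" using S by simp
          then have "ennreal (min ((J z)^2) L) \<le> ennreal (2 * (S z)^2 + 2 * d^2)" by (rule ennreal_leI)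
          then show ?thesis using False by (simp add: ennreal_plus ennreal_mult)
        qed
      qed
      also have "\<dots> = 2 * mean M (\<lambda>z. (S z)^2) + ennreal (2 * d^2) +
          ennreal L * (emeasure M (A k) + emeasure M (B k) + emeasure M (C k))"
        by (simp add: nn_integral_add nn_integral_cmult emeasure_space_1)
      also have "\<dots> \<le> R k"
        unfolding R_def using S2 by (intro add_mono mult_left_mono) auto
      finally show ?thesis .
    qed
    have "R \<longlonglongrightarrow> 2 * (2 * q + ennreal (2 * d) + ennreal K * 0) + ennreal (2 * d^2) + ennreal L * (0 + 0 + 0)"
      unfolding R_def by (intro tendsto_add ennreal_tendsto_cmult tendsto_const A0 B0 C0) auto
    then have "mean M (\<lambda>z. min ((J z)^2) L) \<le>
        2 * (2 * q + ennreal (2 * d) + ennreal K * 0) + ennreal (2 * d^2) + ennreal L * (0 + 0 + 0)"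
      using le by (intro LIMSEQ_le_const) auto
    also have "\<dots> = 4 * q + ennreal (4 * d + 2 * d^2)"
    proof -
      have "2 * ennreal (2 * d) = ennreal (4 * d)" using ennreal_mult[of 2 "2 * d"] d by simp
      moreover have "ennreal (4 * d) + ennreal (2 * d^2) = ennreal (4 * d + 2 * d^2)"
        using d by (intro ennreal_plus[symmetric]) auto
      moreover have "2 * (2 * q) = 4 * q" by (simp add: mult.assoc[symmetric])
      ultimately show ?thesis by (simp only: distrib_left add.assoc mult_zero_right add_0_right)
    qed
    also have "\<dots> \<le> 4 * q + ennreal e" using d by (intro add_left_mono ennreal_leI)
    finally show "mean M (\<lambda>z. min ((J z)^2) L) \<le> 4 * q + ennreal e" .
  qed
  \<comment> \<open>The truncated bound does not depend on the level, so monotone convergence along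
    integer levels removes the truncation.\<close>
  have "mean M (\<lambda>z. (J z)^2) = (\<integral>\<^sup>+z. (SUP n. ennreal (min ((J z)^2) (real n))) \<partial>M)"
  proof (intro nn_integral_cong antisym SUP_least)
    fix z
    obtain n where "(J z)^2 \<le> real n" using real_arch_simple by blast
    then have "ennreal ((J z)^2) \<le> ennreal (min ((J z)^2) (real n))" by simp
    then show "ennreal ((J z)^2) \<le> (SUP n. ennreal (min ((J z)^2) (real n)))"
      by (rule order_trans) (rule SUP_upper, simp)
  qed (auto intro!: ennreal_leI)
  also have "\<dots> = (SUP n. \<integral>\<^sup>+z. ennreal (min ((J z)^2) (real n)) \<partial>M)"
    by (intro nn_integral_monotone_convergence_SUP) (auto simp: incseq_def le_fun_def intro!: ennreal_leI)
  also have "\<dots> \<le> 4 * q" by (intro SUP_least bound_L) simp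
  finally show ?thesis unfolding J_def q_def Q'_def .
qed

end

section \<open>The volatility regression model\<close>

lemma exp_diff_le:
  fixes x y c :: real
  assumes "x \<le> c" "y \<le> c"
  shows "\<bar>exp x - exp y\<bar> \<le> exp c * \<bar>x - y\<bar>"
proof -
  have *: "exp x - exp y \<le> exp c * \<bar>x - y\<bar>" if "x \<le> c" for x y :: real
  proof -
    have "1 - exp (y - x) \<le> x - y" using exp_ge_add_one_self[of "y - x"] by linarith
    then have "exp x * (1 - exp (y - x)) \<le> exp x * (x - y)" by (rule mult_left_mono) simp
    also have "\<dots> \<le> exp x * \<bar>x - y\<bar>" by (intro mult_left_mono) auto
    also have "\<dots> \<le> exp c * \<bar>x - y\<bar>" using that by (intro mult_right_mono) auto
    finally show ?thesis by (simp add: algebra_simps exp_diff)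
  qed
  show ?thesis using *[OF assms(1), of y] *[OF assms(2), of x] by (simp add: abs_le_iff abs_minus_commute)
qed

lemma mean_abs_sum_le:
  assumes "\<And>j. j \<in> J \<Longrightarrow> f j \<in> borel_measurable M" "finite J"
    and "\<And>j. j \<in> J \<Longrightarrow> mean M (\<lambda>z. \<bar>f j z\<bar>) \<le> ennreal c" "c \<ge> 0"
  shows "mean M (\<lambda>z. \<bar>\<Sum>j\<in>J. f j z\<bar>) \<le> ennreal (real (card J) * c)"
proof -
  have "mean M (\<lambda>z. \<bar>\<Sum>j\<in>J. f j z\<bar>) \<le> (\<integral>\<^sup>+z. (\<Sum>j\<in>J. ennreal \<bar>f j z\<bar>) \<partial>M)"
    by (intro nn_integral_mono) (simp add: sum_ennreal ennreal_leI)
  also have "\<dots> = (\<Sum>j\<in>J. \<integral>\<^sup>+z. ennreal \<bar>f j z\<bar> \<partial>M)"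
    using assms(1) by (intro nn_integral_sum) auto
  also have "\<dots> \<le> (\<Sum>j\<in>J. ennreal c)" by (intro sum_mono assms(3))
  also have "\<dots> = ennreal (real (card J) * c)" using assms(4) by (simp add: ennreal_mult ennreal_of_nat_eq_real_of_nat)
  finally show ?thesis .
qed

section \<open>Joint measurability and time integrals under the mean\<close>

context filtered_wiener
begin

text \<open>Progressive measurability at the final time, composed with the clamping map from the
  line to \<open>{0..T}\<close>.\<close>

lemma progressive_clamp_measurable:
  fixes Z :: "real \<Rightarrow> 'a \<Rightarrow> 'b::topological_space"
  assumes prog: "progressive_upto T F Z" and T: "T \<ge> 0"
  shows "jointly_measurable M T Z"
proof -
  have Z: "(\<lambda>(s, z). Z s z) \<in> borel_measurable (restrict_space borel {0..T} \<Otimes>\<^sub>M F T)"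
    using prog T by (auto simp: progressive_upto_def)
  have 1: "(\<lambda>p::real \<times> 'a. max 0 (min T (fst p))) \<in> measurable (borel \<Otimes>\<^sub>M M) (restrict_space borel {0..T})"
    using T by (intro measurable_restrict_space2) auto
  have 2: "snd \<in> measurable (borel \<Otimes>\<^sub>M M) (F T)"
    using sub[of T] T measurable_snd[of borel M] by (auto simp: measurable_def subalgebra_def)
  show ?thesis
    using measurable_compose[OF measurable_Pair[OF 1 2] Z] by simp
qed

lemma progressive_adapted:
  fixes Z :: "real \<Rightarrow> 'a \<Rightarrow> 'b::topological_space"
  assumes prog: "progressive_upto T F Z" and t: "0 \<le> t" "t \<le> T"
  shows "Z t \<in> borel_measurable (F t)"
proof -
  have Z: "(\<lambda>(s, z). Z s z) \<in> borel_measurable (restrict_space borel {0..t} \<Otimes>\<^sub>M F t)"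
    using prog t by (auto simp: progressive_upto_def)
  have "(\<lambda>z. (t, z)) \<in> measurable (F t) (restrict_space borel {0..t} \<Otimes>\<^sub>M F t)"
    using t by (intro measurable_Pair measurable_const measurable_ident) (auto simp: space_restrict_space)
  from measurable_compose[OF this Z] show ?thesis by simp
qed

text \<open>Tonelli's theorem: the mean of the time integral is the time integral of means, each at
  most \<open>K\<close>.\<close>

lemma mean_time_integral_le:
  fixes g :: "real \<Rightarrow> 'a \<Rightarrow> ennreal"
  assumes gm: "jointly_measurable M T g"
    and st: "0 \<le> s" "s \<le> t" "t \<le> T"
    and le: "\<And>u. s < u \<Longrightarrow> u \<le> t \<Longrightarrow> (\<integral>\<^sup>+z. g u z \<partial>M) \<le> ennreal K" and K: "K \<ge> 0"
  shows "(\<lambda>z. \<integral>\<^sup>+u\<in>{s<..t}. g u z \<partial>lborel) \<in> borel_measurable M"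
    and "(\<integral>\<^sup>+z. (\<integral>\<^sup>+u\<in>{s<..t}. g u z \<partial>lborel) \<partial>M) \<le> ennreal (K * (t - s))"
proof -
  have clamp: "max 0 (min T u) = u" if "u \<in> {s<..t}" for u using that st by auto
  define G where "G u z = g (max 0 (min T u)) z * indicator {s<..t} u" for u z
  have eq: "g u z * indicator {s<..t} u = G u z" for u z
    by (simp add: G_def clamp split: split_indicator)
  interpret P: pair_sigma_finite lborel M
    by (intro pair_sigma_finite.intro sigma_finite_lborel sigma_finite_measure_axioms)
  have gm'[measurable]: "(\<lambda>p. g (max 0 (min T (fst p))) (snd p)) \<in> borel_measurable (lborel \<Otimes>\<^sub>M M)"
    using gm by (simp cong: measurable_cong_sets sets_pair_measure_cong)
  have Gm: "case_prod G \<in> borel_measurable (lborel \<Otimes>\<^sub>M M)"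
    unfolding G_def split_beta' by measurable
  have "(\<lambda>z. \<integral>\<^sup>+u. G u z \<partial>lborel) \<in> borel_measurable M"
    using measurable_pair_swap[OF Gm] by (intro lborel.borel_measurable_nn_integral) simp
  then show "(\<lambda>z. \<integral>\<^sup>+u\<in>{s<..t}. g u z \<partial>lborel) \<in> borel_measurable M" by (simp only: eq)
  have "(\<integral>\<^sup>+z. (\<integral>\<^sup>+u. G u z \<partial>lborel) \<partial>M) = (\<integral>\<^sup>+u. (\<integral>\<^sup>+z. G u z \<partial>M) \<partial>lborel)"
    by (rule P.Fubini'[OF Gm])
  also have "\<dots> \<le> (\<integral>\<^sup>+u. ennreal K * indicator {s<..t} u \<partial>lborel)"
  proof (rule nn_integral_mono)
    fix u
    show "(\<integral>\<^sup>+z. G u z \<partial>M) \<le> ennreal K * indicator {s<..t} u"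
      using le[of u] by (simp add: G_def clamp split: split_indicator)
  qed
  also have "\<dots> = ennreal (K * (t - s))" using st K by (simp add: nn_integral_cmult ennreal_mult)
  finally show "(\<integral>\<^sup>+z. (\<integral>\<^sup>+u\<in>{s<..t}. g u z \<partial>lborel) \<partial>M) \<le> ennreal (K * (t - s))" by (simp only: eq)
qed

end

section \<open>The model and its uniform bounds\<close>

locale volatility_regression = filtered_wiener M T F w
  for M :: "'a measure" and T F w +
  fixes b :: "real \<Rightarrow> 'a \<Rightarrow> real" and X :: "real \<Rightarrow> 'a \<Rightarrow> real^'p::finite"
    and Y :: "real \<Rightarrow> 'a \<Rightarrow> real" and \<theta>0 :: "real^'p"
  assumes T: "T > 0" and b: "progressive_upto T F b" and X: "progressive_upto T F X"
    and Y: "ito_process M T F w b (\<lambda>t z. vol (X t z) \<theta>0) Y"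
    and V1: "cond_V1 M T X b" and V2: "cond_V2 M T X"
begin

text \<open>The uniform bound of (V2)(i), chosen positive and fixed once so that all later constants
  can refer to it.\<close>

definition B :: real where
  "B = (SOME B. B > 0 \<and> (\<forall>t\<in>{0..T}. \<forall>z\<in>space M. norm (X t z) \<le> B))"

lemma B:
  shows "B > 0" and "0 \<le> t \<Longrightarrow> t \<le> T \<Longrightarrow> z \<in> space M \<Longrightarrow> norm (X t z) \<le> B"
proof -
  have "bounded {X t z |t z. t \<in> {0..T} \<and> z \<in> space M}" using V2 by (simp add: cond_V2_def)
  then have "\<exists>B. B > 0 \<and> (\<forall>t\<in>{0..T}. \<forall>z\<in>space M. norm (X t z) \<le> B)"
    unfolding bounded_pos by blast
  from someI_ex[OF this, folded B_def]
  show "B > 0" and "0 \<le> t \<Longrightarrow> t \<le> T \<Longrightarrow> z \<in> space M \<Longrightarrow> norm (X t z) \<le> B" by auto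
qed

lemma X_measurable_F: "0 \<le> t \<Longrightarrow> t \<le> T \<Longrightarrow> X t \<in> borel_measurable (F t)"
  by (rule progressive_adapted[OF X])

lemma X_measurable: "0 \<le> t \<Longrightarrow> t \<le> T \<Longrightarrow> X t \<in> borel_measurable M"
  using measurable_M[OF _ _ X_measurable_F] by blast

lemma Y_measurable: "0 \<le> t \<Longrightarrow> t \<le> T \<Longrightarrow> Y t \<in> borel_measurable M"
  using Y by (simp add: ito_process_def)

lemma X_clamp: "jointly_measurable M T X"
  using progressive_clamp_measurable[OF X] T by simp

lemma X_increment:
  assumes "q > 0"
  obtains C where "C > 0" "\<And>s t. s \<in> {0..T} \<Longrightarrow> t \<in> {0..T} \<Longrightarrow>
    mean M (\<lambda>z. norm (X t z - X s z) powr q) \<le> ennreal (C * \<bar>t - s\<bar> powr (q/2))"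
  using V1 assms unfolding cond_V1_def by blast

lemma b_square:
  obtains C where "C \<ge> 0" "\<And>t. t \<in> {0..T} \<Longrightarrow> mean M (\<lambda>z. (b t z)^2) \<le> ennreal C"
proof -
  have fin: "(SUP t\<in>{0..T}. \<integral>\<^sup>+z. ennreal (\<bar>b t z\<bar> powr 2) \<partial>M) < \<infinity>"
    using V1 unfolding cond_V1_def by (meson zero_less_numeral)
  then obtain C where C: "C \<ge> 0" "(SUP t\<in>{0..T}. \<integral>\<^sup>+z. ennreal (\<bar>b t z\<bar> powr 2) \<partial>M) = ennreal C"
    using less_top_ennreal by auto
  have "mean M (\<lambda>z. (b t z)^2) \<le> ennreal C" if "t \<in> {0..T}" for t
    unfolding C(2)[symmetric] by (rule SUP_upper2[OF that]) simp
  then show ?thesis using C(1) by (intro that) auto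
qed

abbreviation \<sigma> :: "real \<Rightarrow> 'a \<Rightarrow> real" where "\<sigma> t z \<equiv> vol (X t z) \<theta>0"

lemma \<sigma>_bounds:
  obtains A where "A \<ge> 1" "\<And>t z. 0 \<le> t \<Longrightarrow> t \<le> T \<Longrightarrow> z \<in> space M \<Longrightarrow> \<sigma> t z \<le> A"
    "\<And>t z. 0 \<le> t \<Longrightarrow> t \<le> T \<Longrightarrow> z \<in> space M \<Longrightarrow> 1 / \<sigma> t z \<le> A"
    "\<And>t s z. 0 \<le> t \<Longrightarrow> t \<le> T \<Longrightarrow> 0 \<le> s \<Longrightarrow> s \<le> T \<Longrightarrow> z \<in> space M \<Longrightarrow>
       \<bar>\<sigma> t z - \<sigma> s z\<bar> \<le> A * norm (X t z - X s z)"
proof -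
  define \<beta> where "\<beta> = B * norm \<theta>0 / 2"
  \<comment> \<open>One constant for three purposes: the summand 1 makes \<open>A\<close> dominate
    the volatility and its reciprocal, and \<open>norm \<theta>0\<close> is a Lipschitz constant of
    the linear exponent.\<close>
  define A where "A = exp \<beta> * (1 + norm \<theta>0)"
  have \<beta>: "\<beta> \<ge> 0" using B(1) by (simp add: \<beta>_def)
  have le: "\<bar>(X t z \<bullet> \<theta>0) / 2\<bar> \<le> \<beta>" if "0 \<le> t" "t \<le> T" "z \<in> space M" for t z
  proof -
    have "\<bar>X t z \<bullet> \<theta>0\<bar> \<le> norm (X t z) * norm \<theta>0" by (rule Cauchy_Schwarz_ineq2)
    also have "\<dots> \<le> B * norm \<theta>0" using B(2)[OF that] by (intro mult_right_mono) auto
    finally show ?thesis by (simp add: \<beta>_def)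
  qed
  have A: "exp \<beta> \<le> A" unfolding A_def by simp
  show ?thesis
  proof (rule that[of A])
    have "1 \<le> exp \<beta>" using \<beta> by simp
    with A show "A \<ge> 1" by linarith
    fix t z assume t: "0 \<le> t" "t \<le> T" "z \<in> space M"
    have "\<sigma> t z \<le> exp \<beta>" using le[OF t] by (simp add: vol_def)
    with A show "\<sigma> t z \<le> A" by linarith
    have "1 / \<sigma> t z = exp (- ((X t z \<bullet> \<theta>0) / 2))"
      unfolding vol_def exp_minus by (rule divide_inverse[of 1, simplified])
    also have "\<dots> \<le> exp \<beta>" using abs_le_D2[OF le[OF t]] by simp
    finally show "1 / \<sigma> t z \<le> A" using A by linarith
    fix s assume s: "0 \<le> s" "s \<le> T"
    have 1: "\<bar>\<sigma> t z - \<sigma> s z\<bar> \<le> exp \<beta> * \<bar>(X t z \<bullet> \<theta>0) / 2 - (X s z \<bullet> \<theta>0) / 2\<bar>"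
      unfolding vol_def by (rule exp_diff_le[OF abs_le_D1[OF le[OF t]] abs_le_D1[OF le[OF s t(3)]]])
    have "(X t z \<bullet> \<theta>0) / 2 - (X s z \<bullet> \<theta>0) / 2 = ((X t z - X s z) \<bullet> \<theta>0) / 2"
      unfolding inner_diff_left diff_divide_distrib ..
    then have "\<bar>(X t z \<bullet> \<theta>0) / 2 - (X s z \<bullet> \<theta>0) / 2\<bar> = \<bar>(X t z - X s z) \<bullet> \<theta>0\<bar> / 2"
      by (simp only: abs_divide)
    also have "\<dots> \<le> \<bar>(X t z - X s z) \<bullet> \<theta>0\<bar>" by simp
    also have "\<dots> \<le> norm (X t z - X s z) * norm \<theta>0" by (rule Cauchy_Schwarz_ineq2)
    also have "\<dots> \<le> (1 + norm \<theta>0) * norm (X t z - X s z)" by (simp add: distrib_right mult.commute)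
    finally have 2: "exp \<beta> * \<bar>(X t z \<bullet> \<theta>0) / 2 - (X s z \<bullet> \<theta>0) / 2\<bar> \<le>
        exp \<beta> * ((1 + norm \<theta>0) * norm (X t z - X s z))"
      by (rule mult_left_mono) simp
    show "\<bar>\<sigma> t z - \<sigma> s z\<bar> \<le> A * norm (X t z - X s z)"
      using order_trans[OF 1 2] by (simp only: A_def mult.assoc)
  qed
qed

lemma \<sigma>_pos: "\<sigma> t z > 0" by (simp add: vol_def)

lemma vol_measurable: "(\<lambda>x. vol x \<theta>0) \<in> borel_measurable borel"
  unfolding vol_def by measurable

lemma \<sigma>_measurable_F: "0 \<le> t \<Longrightarrow> t \<le> T \<Longrightarrow> \<sigma> t \<in> borel_measurable (F t)"
  using measurable_compose[OF X_measurable_F vol_measurable] .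

lemma \<sigma>_measurable: "0 \<le> t \<Longrightarrow> t \<le> T \<Longrightarrow> \<sigma> t \<in> borel_measurable M"
  using measurable_compose[OF X_measurable vol_measurable] .

text \<open>The drift of Y over the interval plus the error of freezing the volatility at its left
  end.\<close>

definition remainder :: "real \<Rightarrow> real \<Rightarrow> 'a \<Rightarrow> real" where
  "remainder s t z = Y t z - Y s z - \<sigma> s z * (w t z - w s z)"

lemma remainder_measurable: "0 \<le> s \<Longrightarrow> s \<le> t \<Longrightarrow> t \<le> T \<Longrightarrow> remainder s t \<in> borel_measurable M"
  unfolding remainder_def
  by (intro borel_measurable_diff borel_measurable_times Y_measurable \<sigma>_measurable w_measurable) auto

lemma remainder_bound:
  obtains C where "C \<ge> 0" "\<And>s t. 0 \<le> s \<Longrightarrow> s \<le> t \<Longrightarrow> t \<le> T \<Longrightarrow>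
    mean M (\<lambda>z. (remainder s t z)^2) \<le> ennreal (C * (t - s)^2)"
proof -
  obtain I where ito: "ito_integral M T F w \<sigma> I" and AE_Y: "AE z in M. set_integrable lborel {0..T} (\<lambda>s. b s z) \<and>
      (\<forall>t\<in>{0..T}. Y t z = Y 0 z + (LINT s:{0..t}|lborel. b s z) + I t z)"
    using Y unfolding ito_process_def by blast
  have I: "\<And>t. t \<in> {0..T} \<Longrightarrow> I t \<in> borel_measurable M" using ito by (auto simp: ito_integral_def)
  obtain A where A: "A \<ge> 1" "\<And>t z. 0 \<le> t \<Longrightarrow> t \<le> T \<Longrightarrow> z \<in> space M \<Longrightarrow> \<sigma> t z \<le> A"
    and lip: "\<And>t s z. 0 \<le> t \<Longrightarrow> t \<le> T \<Longrightarrow> 0 \<le> s \<Longrightarrow> s \<le> T \<Longrightarrow> z \<in> space M \<Longrightarrow>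
       \<bar>\<sigma> t z - \<sigma> s z\<bar> \<le> A * norm (X t z - X s z)"
    by (rule \<sigma>_bounds) blast
  have "(0::real) < 2" by simp
  then obtain CX where CX: "CX > 0" "\<And>s t. s \<in> {0..T} \<Longrightarrow> t \<in> {0..T} \<Longrightarrow>
      mean M (\<lambda>z. norm (X t z - X s z) powr 2) \<le> ennreal (CX * \<bar>t - s\<bar> powr (2/2))"
    by (rule X_increment) blast
  obtain Cb where Cb: "Cb \<ge> 0" "\<And>t. t \<in> {0..T} \<Longrightarrow> mean M (\<lambda>z. (b t z)^2) \<le> ennreal Cb"
    by (rule b_square) blast
  have b_clamp: "jointly_measurable M T b"
    using progressive_clamp_measurable[OF b] T by simp
  have \<sigma>_clamp: "jointly_measurable M T \<sigma>"
    using measurable_compose[OF X_clamp vol_measurable] .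
  \<comment> \<open>Here 8 is 2 * 4: the 2 comes from the square of a sum, the 4 from
    \<open>ito_increment_bound\<close>.\<close>
  define C where "C = 2 * Cb + 8 * (A^2 * CX)"
  show ?thesis
  proof (rule that[of C])
    show "C \<ge> 0" using Cb CX by (simp add: C_def)
    fix s t assume st: "0 \<le> s" "s \<le> t" "t \<le> T"
    have sM[measurable]: "\<sigma> s \<in> borel_measurable M" using st by (intro \<sigma>_measurable) auto
    define J where "J z = I t z - I s z - \<sigma> s z * (w t z - w s z)" for z
    define W where "W z = sq_int {s<..t} (\<lambda>u. b u z)" for z
    have [measurable]: "J \<in> borel_measurable M"
      unfolding J_def using st by (intro borel_measurable_diff borel_measurable_times w_measurable I sM) auto
    have b2_clamp: "(\<lambda>p. ennreal ((b (max 0 (min T (fst p))) (snd p))^2)) \<in> borel_measurable (borel \<Otimes>\<^sub>M M)"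
      using b_clamp by measurable
    have b2_le: "mean M (\<lambda>z. (b u z)^2) \<le> ennreal Cb" if "s < u" "u \<le> t" for u
      using Cb(2)[of u] that st by simp
    have [measurable]: "W \<in> borel_measurable M"
      unfolding W_def by (rule mean_time_integral_le(1)[OF b2_clamp st b2_le Cb(1)])
    have Wle: "(\<integral>\<^sup>+z. W z \<partial>M) \<le> ennreal (Cb * (t - s))"
      unfolding W_def by (rule mean_time_integral_le(2)[OF b2_clamp st b2_le Cb(1)])
    have J: "mean M (\<lambda>z. (J z)^2) \<le> ennreal (4 * (A^2 * CX * (t - s)^2))"
    proof -
      have "mean M (\<lambda>z. (J z)^2) \<le> 4 * (\<integral>\<^sup>+z. sq_int {s<..t} (\<lambda>u. \<sigma> u z - \<sigma> s z) \<partial>M)"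
        unfolding J_def
      \<comment> \<open>Both volatilities lie between 0 and \<open>A\<close>, hence the crude
        pathwise energy \<open>A^2 * (t - s)\<close>. It sets the stopping level only and does not
        appear in the resulting bound.\<close>
      proof (rule ito_increment_bound[OF ito \<sigma>_clamp st, of "\<sigma> s" A "A^2 * (t - s)"])
        show "\<sigma> s \<in> borel_measurable (F s)" using st by (intro \<sigma>_measurable_F) auto
        show "\<bar>\<sigma> s z\<bar> \<le> A" if "z \<in> space M" for z
          using A(2)[of s z] \<sigma>_pos[of s z] that st by auto
        fix z assume z: "z \<in> space M"
        have "sq_int {s<..t} (\<lambda>u. \<sigma> u z - \<sigma> s z) \<le> (\<integral>\<^sup>+u. ennreal (A^2) * indicator {s<..t} u \<partial>lborel)"
        proof (rule nn_integral_mono)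
          fix u
          show "ennreal ((\<sigma> u z - \<sigma> s z)^2) * indicator {s<..t} u \<le> ennreal (A^2) * indicator {s<..t} u"
          proof (cases "u \<in> {s<..t}")
            case True
            then have "\<bar>\<sigma> u z - \<sigma> s z\<bar> \<le> A"
              using A(2)[of s z] \<sigma>_pos[of s z] A(2)[of u z] \<sigma>_pos[of u z] z st by (auto simp: abs_le_iff)
            then have "(\<sigma> u z - \<sigma> s z)^2 \<le> A^2"
              using power_mono[of "\<bar>\<sigma> u z - \<sigma> s z\<bar>" A 2] by simp
            then show ?thesis by (auto intro!: ennreal_leI split: split_indicator)
          qed simp
        qed
        also have "\<dots> = ennreal (A^2 * (t - s))" using st by (simp add: nn_integral_cmult ennreal_mult)
        finally show "sq_int {s<..t} (\<lambda>u. \<sigma> u z - \<sigma> s z) \<le> ennreal (A^2 * (t - s))" .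
      qed (use st in simp)
      also have "(\<integral>\<^sup>+z. sq_int {s<..t} (\<lambda>u. \<sigma> u z - \<sigma> s z) \<partial>M) \<le> ennreal (A^2 * (CX * (t - s)) * (t - s))"
      proof (rule mean_time_integral_le(2)[OF _ st])
        note [measurable] = \<sigma>_clamp
        show "(\<lambda>p. ennreal ((\<sigma> (max 0 (min T (fst p))) (snd p) - \<sigma> s (snd p))^2)) \<in> borel_measurable (borel \<Otimes>\<^sub>M M)"
          by measurable
        fix u assume u: "s < u" "u \<le> t"
        have "mean M (\<lambda>z. (\<sigma> u z - \<sigma> s z)^2) \<le> (\<integral>\<^sup>+z. ennreal (A^2) * ennreal (norm (X u z - X s z) powr 2) \<partial>M)"
        proof (rule nn_integral_mono)
          fix z assume z: "z \<in> space M"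
          have "\<bar>\<sigma> u z - \<sigma> s z\<bar>^2 \<le> (A * norm (X u z - X s z))^2"
            using lip[of u s z] u st z by (intro power_mono) auto
          then show "ennreal ((\<sigma> u z - \<sigma> s z)^2) \<le> ennreal (A^2) * ennreal (norm (X u z - X s z) powr 2)"
            by (simp add: ennreal_mult'[symmetric] power_mult_distrib ennreal_leI)
        qed
        also have "\<dots> = ennreal (A^2) * mean M (\<lambda>z. norm (X u z - X s z) powr 2)"
          using X_measurable[of u] X_measurable[of s] u st by (intro nn_integral_cmult) auto
        also have "\<dots> \<le> ennreal (A^2) * ennreal (CX * \<bar>u - s\<bar> powr (2/2))"
          using CX(2)[of s u] u st by (intro mult_left_mono) auto
        also have "\<dots> \<le> ennreal (A^2) * ennreal (CX * (t - s))"
          using u CX(1) by (intro mult_left_mono ennreal_leI) auto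
        also have "\<dots> = ennreal (A^2 * (CX * (t - s)))"
          using st CX(1) by (simp add: ennreal_mult)
        finally show "mean M (\<lambda>z. (\<sigma> u z - \<sigma> s z)^2) \<le> ennreal (A^2 * (CX * (t - s)))" .
      qed (use st CX in simp)
      finally have "mean M (\<lambda>z. (J z)^2) \<le> 4 * ennreal (A^2 * (CX * (t - s)) * (t - s))"
        by (simp add: mult_left_mono)
      also have "\<dots> = ennreal (4 * (A^2 * CX * (t - s)^2))"
      proof -
        have e: "A^2 * (CX * (t - s)) * (t - s) = A^2 * CX * (t - s)^2" by (simp add: power2_eq_square)
        have "0 \<le> A^2 * CX * (t - s)^2" using CX(1) by simp
        then show ?thesis unfolding e using ennreal_mult[of 4 "A^2 * CX * (t - s)^2"] by simp
      qed
      finally show ?thesis .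
    qed
    have "AE z in M. ennreal ((remainder s t z)^2) \<le> 2 * (ennreal (t - s) * W z) + 2 * ennreal ((J z)^2)"
      using AE_Y AE_space
    proof eventually_elim
      case (elim z)
      define \<beta> where "\<beta> = (LINT u:{s<..t}|lborel. b u z)"
      have int: "set_integrable lborel A (\<lambda>s. b s z)" if "A \<subseteq> {0..T}" "A \<in> sets lborel" for A
        by (rule set_integrable_subset[OF conjunct1[OF elim(1)] that(2) that(1)])
      have i1: "set_integrable lborel {0..s} (\<lambda>s. b s z)" and i2: "set_integrable lborel {s<..t} (\<lambda>s. b s z)"
        using st by (auto intro!: int)
      have clamp: "max 0 (min T u) = u" if "s < u" "u \<le> t" for u using that st by auto
      have "{0..s} \<inter> {s<..t} = {}" by auto
      moreover have "{0..t} = {0..s} \<union> {s<..t}" using st by auto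
      ultimately have eq: "(LINT u:{0..t}|lborel. b u z) = (LINT u:{0..s}|lborel. b u z) + \<beta>"
        unfolding \<beta>_def using set_integral_Un[OF _ i1 i2] by simp
      have "Y r z = Y 0 z + (LINT u:{0..r}|lborel. b u z) + I r z" if "0 \<le> r" "r \<le> T" for r
        by (rule bspec[OF conjunct2[OF elim(1)]]) (use that in simp)
      from this[of s] this[of t] have R: "remainder s t z = \<beta> + J z"
        using st eq by (simp add: remainder_def J_def)
      have "ennreal \<bar>\<beta>\<bar> \<le> (\<integral>\<^sup>+u. ennreal (norm (indicator {s<..t} u *\<^sub>R b u z)) \<partial>lborel)"
        unfolding \<beta>_def set_lebesgue_integral_def real_norm_def[symmetric]
        using i2 unfolding set_integrable_def by (rule integral_norm_bound_ennreal)
      \<comment> \<open>The indicator is doubled so that one factor of Cauchy-Schwarz integrates to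
        t - s; clamping the time makes the other factor measurable.\<close>
      also have "\<dots> = (\<integral>\<^sup>+u. indicator {s<..t} u * (indicator {s<..t} u * ennreal \<bar>b (max 0 (min T u)) z\<bar>) \<partial>lborel)"
        by (intro nn_integral_cong) (simp add: clamp split: split_indicator)
      finally have "(ennreal \<bar>\<beta>\<bar>)^2 \<le> (\<integral>\<^sup>+u. indicator {s<..t} u * (indicator {s<..t} u * ennreal \<bar>b (max 0 (min T u)) z\<bar>) \<partial>lborel)^2"
        by (intro power_mono) simp_all
      also have "\<dots> \<le> (\<integral>\<^sup>+u. (indicator {s<..t} u)^2 \<partial>lborel) * (\<integral>\<^sup>+u. (indicator {s<..t} u * ennreal \<bar>b (max 0 (min T u)) z\<bar>)^2 \<partial>lborel)"
      proof (rule Cauchy_Schwarz_nn_integral)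
        have [measurable]: "(\<lambda>u. b (max 0 (min T u)) z) \<in> borel_measurable lborel"
          using measurable_compose[OF _ b_clamp, of "\<lambda>u. (u, z)" borel] elim(2) by simp
        show "(\<lambda>u. indicator {s<..t} u * ennreal \<bar>b (max 0 (min T u)) z\<bar>) \<in> borel_measurable lborel"
          by measurable
      qed simp
      also have "(\<integral>\<^sup>+u. (indicator {s<..t} u)^2 \<partial>lborel) = ennreal (t - s)"
      proof -
        have "(indicator {s<..t} u)^2 = (indicator {s<..t} u :: ennreal)" for u
          by (simp add: power2_eq_square split: split_indicator)
        then show ?thesis using st by simp
      qed
      also have "(\<integral>\<^sup>+u. (indicator {s<..t} u * ennreal \<bar>b (max 0 (min T u)) z\<bar>)^2 \<partial>lborel) = W z"
        unfolding W_def
      proof (intro nn_integral_cong)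
        fix u
        show "(indicator {s<..t} u * ennreal \<bar>b (max 0 (min T u)) z\<bar>)^2 = ennreal ((b u z)^2) * indicator {s<..t} u"
          by (cases "s < u \<and> u \<le> t") (auto simp add: ennreal_power clamp)
      qed
      finally have \<beta>: "ennreal (\<beta>^2) \<le> ennreal (t - s) * W z" by (simp add: ennreal_power)
      have "(remainder s t z)^2 \<le> 2 * \<beta>^2 + 2 * (J z)^2"
        unfolding R using zero_le_power2[of "\<beta> - J z"] by (simp add: power2_eq_square algebra_simps)
      then have "ennreal ((remainder s t z)^2) \<le> ennreal (2 * \<beta>^2 + 2 * (J z)^2)" by (rule ennreal_leI)
      also have "\<dots> = 2 * ennreal (\<beta>^2) + 2 * ennreal ((J z)^2)" by (simp add: ennreal_plus ennreal_mult)
      also have "\<dots> \<le> 2 * (ennreal (t - s) * W z) + 2 * ennreal ((J z)^2)"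
        using \<beta> by (intro add_mono mult_left_mono) auto
      finally show ?case .
    qed
    then have "mean M (\<lambda>z. (remainder s t z)^2) \<le> (\<integral>\<^sup>+z. 2 * (ennreal (t - s) * W z) + 2 * ennreal ((J z)^2) \<partial>M)"
      by (rule nn_integral_mono_AE)
    also have "\<dots> = 2 * (ennreal (t - s) * (\<integral>\<^sup>+z. W z \<partial>M)) + 2 * mean M (\<lambda>z. (J z)^2)"
      by (simp add: nn_integral_add nn_integral_cmult)
    also have "\<dots> \<le> 2 * (ennreal (t - s) * ennreal (Cb * (t - s))) + 2 * ennreal (4 * (A^2 * CX * (t - s)^2))"
      using Wle J by (intro add_mono mult_left_mono) auto
    also have "\<dots> = ennreal (2 * ((t - s) * (Cb * (t - s))) + 2 * (4 * (A^2 * CX * (t - s)^2)))"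
      using st Cb CX by (simp add: ennreal_plus ennreal_mult)
    also have "2 * ((t - s) * (Cb * (t - s))) + 2 * (4 * (A^2 * CX * (t - s)^2)) = C * (t - s)^2"
      by (simp add: C_def power2_eq_square algebra_simps)
    finally show "mean M (\<lambda>z. (remainder s t z)^2) \<le> ennreal (C * (t - s)^2)" .
  qed
qed

end

section \<open>Fluctuations of the normalised squared increments\<close>

lemma mean_combination_le:
  assumes [measurable]: "f \<in> borel_measurable M" "g \<in> borel_measurable M"
    and "\<And>z. 0 \<le> f z" "\<And>z. 0 \<le> g z" "(a::real) \<ge> 0" "c \<ge> 0" "\<alpha> \<ge> 0" "\<gamma> \<ge> 0"
    and "mean M (\<lambda>z. f z) \<le> ennreal \<alpha>" "mean M (\<lambda>z. g z) \<le> ennreal \<gamma>"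
  shows "mean M (\<lambda>z. a * f z + c * g z) \<le> ennreal (a * \<alpha> + c * \<gamma>)"
proof -
  have "mean M (\<lambda>z. a * f z + c * g z) = (\<integral>\<^sup>+z. ennreal a * ennreal (f z) + ennreal c * ennreal (g z) \<partial>M)"
    using assms(3-6) by (intro nn_integral_cong) (simp add: ennreal_plus ennreal_mult)
  also have "\<dots> = ennreal a * mean M (\<lambda>z. f z) + ennreal c * mean M (\<lambda>z. g z)"
    by (simp add: nn_integral_add nn_integral_cmult)
  also have "\<dots> \<le> ennreal a * ennreal \<alpha> + ennreal c * ennreal \<gamma>"
    using assms by (intro add_mono mult_left_mono) auto
  also have "\<dots> = ennreal (a * \<alpha> + c * \<gamma>)"
    using assms(5-8) by (simp add: ennreal_plus ennreal_mult)
  finally show ?thesis .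
qed

section \<open>The normalised squared increments at \<open>\<theta>0\<close>\<close>

context volatility_regression
begin

abbreviation tm :: "nat \<Rightarrow> nat \<Rightarrow> real" where "tm \<equiv> obs_time T"
abbreviation Hn :: "nat \<Rightarrow> 'a \<Rightarrow> real^'p \<Rightarrow> real" where "Hn \<equiv> quasi_loglik T X Y"

lemma step_pos: "n \<ge> 1 \<Longrightarrow> step T n > 0"
  using T by (simp add: step_def)

lemma obs_time_range: "n \<ge> 1 \<Longrightarrow> i \<le> n \<Longrightarrow> 0 \<le> tm n i \<and> tm n i \<le> T"
  using T by (simp add: obs_time_def step_def field_simps)

lemma obs_time_Suc: "tm n (Suc i) - tm n i = step T n"
  by (simp add: obs_time_def algebra_simps)

lemma obs_time_mono: "n \<ge> 1 \<Longrightarrow> tm n i \<le> tm n (Suc i)"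
  using obs_time_Suc[of n i] step_pos[of n] by linarith

abbreviation Xn :: "nat \<Rightarrow> nat \<Rightarrow> 'a \<Rightarrow> real^'p" where "Xn n i \<equiv> X (tm n i)"

text \<open>The squared increment, normalised at the true parameter, minus its leading mean 1; score
  and Hessian at \<open>\<theta>0\<close> are affine in it. Counting from 0, index \<open>i\<close>
  belongs to observation \<open>Suc i\<close>, whose interval begins at \<open>tm n i\<close>, so
  that weights at \<open>tm n i\<close> are known in advance.\<close>

definition excess :: "nat \<Rightarrow> nat \<Rightarrow> 'a \<Rightarrow> real" where
  "excess n i z = scaled_sq_incr T Y n (Suc i) z * exp (- (obs T X n (Suc i) z \<bullet> \<theta>0)) - 1"

lemma excess_eq:
  "excess n i z = (Y (tm n (Suc i)) z - Y (tm n i) z)^2 /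
     (step T n * (\<sigma> (tm n i) z)^2) - 1"
proof -
  have "(\<sigma> (tm n i) z)^2 = exp (obs T X n (Suc i) z \<bullet> \<theta>0)"
    by (simp add: vol_def obs_def power2_eq_square exp_add[symmetric])
  then show ?thesis
    by (simp add: excess_def scaled_sq_incr_def increment_def exp_minus divide_inverse)
qed

lemma excess_measurable:
  assumes "n \<ge> 1" "i < n"
  shows "excess n i \<in> borel_measurable M"
proof -
  have [measurable]: "Y (tm n i) \<in> borel_measurable M" "Y (tm n (Suc i)) \<in> borel_measurable M"
    "\<sigma> (tm n i) \<in> borel_measurable M"
    using obs_time_range[OF assms(1), of i] obs_time_range[OF assms(1), of "Suc i"] assms(2)
    by (auto intro!: Y_measurable \<sigma>_measurable)
  show ?thesis unfolding excess_eq[abs_def] by measurable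
qed

text \<open>The summands are orthogonal, each with second moment at most 2 * L^2, which makes the
  second moment of the sum of order n.\<close>

lemma sum_wiener_squares_bound:
  assumes n: "n \<ge> 1"
    and \<phi>: "\<And>i. i < n \<Longrightarrow> \<phi> i \<in> borel_measurable (F (tm n i))"
    and L: "\<And>i z. i < n \<Longrightarrow> z \<in> space M \<Longrightarrow> \<bar>\<phi> i z\<bar> \<le> L"
  shows "mean M (\<lambda>z. \<bar>\<Sum>i<n. \<phi> i z *
      (((w (tm n (Suc i)) z - w (tm n i) z)^2 - step T n) / step T n)\<bar>)
    \<le> ennreal ((1 + L^2) * sqrt (real n))"
proof -
  define h where "h = step T n"
  define t where "t = obs_time T n"
  have h: "h > 0" using step_pos[OF n] by (simp add: h_def)
  have t: "0 \<le> t i" "t i \<le> t (Suc i)" "t (Suc i) \<le> T" "t (Suc i) - t i = h" if "i < n" for i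
    using obs_time_range[OF n, of i] obs_time_range[OF n, of "Suc i"] obs_time_mono[OF n] obs_time_Suc that
    by (auto simp: t_def h_def)
  define D where "D i z = (w (t (Suc i)) z - w (t i) z)^2 - h" for i z
  define S where "S z = (\<Sum>i<n. (\<phi> i z / h) * D i z)" for z
  have "S \<in> borel_measurable (F (t n)) \<and> has_bochner_integral M (\<lambda>z. (S z)^2)
      (\<Sum>i<n. expectation (\<lambda>z. (\<phi> i z / h)^2) * (2 * h^2))"
    unfolding S_def
  proof (rule martingale_transform_square[where G = "\<lambda>i. F (t i)"])
    show "subalgebra M (F (t i))" if "i \<le> n" for i
      using obs_time_range[OF n that] sub by (simp add: t_def)
    fix i assume i: "i < n"
    show "subalgebra (F (t (Suc i))) (F (t i))" using t[OF i] by (intro sub_mono) auto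
    show "(\<lambda>z. \<phi> i z / h) \<in> borel_measurable (F (t i))"
      using \<phi>[OF i] by (simp add: t_def)
    show "\<exists>K. \<forall>z\<in>space M. \<bar>\<phi> i z / h\<bar> \<le> K"
      using L[OF i] h by (intro exI[of _ "L / h"]) (auto simp: divide_right_mono)
    show "D i \<in> borel_measurable (F (t (Suc i)))"
      unfolding D_def using t[OF i] by (intro borel_measurable_diff borel_measurable_power w_measurable_F borel_measurable_const) auto
    fix f :: "'a \<Rightarrow> real" assume f: "f \<in> borel_measurable (F (t i))" "integrable M f"
    show "has_bochner_integral M (\<lambda>z. f z * D i z) 0"
      using increment_moments(3)[OF t(1-3)[OF i] f] t(4)[OF i] by (simp add: D_def)
    show "has_bochner_integral M (\<lambda>z. f z * (D i z)^2) (expectation f * (2 * h^2))"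
      using increment_moments(4)[OF t(1-3)[OF i] f] t(4)[OF i] by (simp add: D_def)
  qed
  then have Sm: "S \<in> borel_measurable (F (t n))"
    and S2: "has_bochner_integral M (\<lambda>z. (S z)^2) (\<Sum>i<n. expectation (\<lambda>z. (\<phi> i z / h)^2) * (2 * h^2))"
    by auto
  have [measurable]: "S \<in> borel_measurable M"
    by (rule measurable_M[OF _ _ Sm]) (use obs_time_range[OF n, of n] in \<open>auto simp: t_def\<close>)
  have "expectation (\<lambda>z. (\<phi> i z / h)^2) * (2 * h^2) \<le> 2 * L^2" if i: "i < n" for i
  proof -
    have "(\<phi> i z / h)^2 \<le> (L / h)^2" if "z \<in> space M" for z
      using power_mono[OF L[OF i that], of 2] h by (simp add: power_divide divide_right_mono)
    then have "AE z in M. (\<phi> i z / h)^2 \<le> (L / h)^2" by (rule AE_I2)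
    then have "expectation (\<lambda>z. (\<phi> i z / h)^2) \<le> (L / h)^2"
      by (rule integral_le_const[rotated])
         (rule integrable_const_bound[of _ "(L / h)^2"], use \<open>AE z in M. (\<phi> i z / h)^2 \<le> (L / h)^2\<close> in simp,
          use measurable_M[OF _ _ \<phi>[OF i]] t[OF i] in \<open>auto simp: t_def\<close>)
    then have "expectation (\<lambda>z. (\<phi> i z / h)^2) * (2 * h^2) \<le> (L / h)^2 * (2 * h^2)"
      by (rule mult_right_mono) simp
    then show ?thesis using h by (simp add: power_divide)
  qed
  then have "(\<Sum>i<n. expectation (\<lambda>z. (\<phi> i z / h)^2) * (2 * h^2)) \<le> (\<Sum>i<n. 2 * L^2)"
    by (intro sum_mono) auto
  moreover have "mean M (\<lambda>z. (S z)^2) = ennreal (\<Sum>i<n. expectation (\<lambda>z. (\<phi> i z / h)^2) * (2 * h^2))"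
    using S2 by (subst nn_integral_eq_integral) (auto simp: has_bochner_integral_iff)
  ultimately have S2': "mean M (\<lambda>z. (S z)^2) \<le> ennreal (real n * (2 * L^2))"
    by (simp add: ennreal_leI)
  define q where "q = sqrt (real n)"
  have q: "q > 0" "real n = q * q" using n by (auto simp: q_def)
  \<comment> \<open>Young's inequality with weight q = sqrt n balances the two terms and passes from
    the second moment to the first.\<close>
  have "mean M (\<lambda>z. \<bar>S z\<bar>) \<le> mean M (\<lambda>z. q * 1 + (1 / (2 * q)) * (S z)^2)"
  proof (intro nn_integral_mono ennreal_leI)
    fix z
    have "2 * q * \<bar>S z\<bar> \<le> q * q + (S z)^2"
      using zero_le_power2[of "\<bar>S z\<bar> - q"] by (simp add: power2_eq_square algebra_simps)
    then have "\<bar>S z\<bar> \<le> (q * q + (S z)^2) / (2 * q)" using q by (simp add: field_simps)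
    also have "\<dots> = q / 2 + (S z)^2 / (2 * q)" using q by (simp add: field_simps)
    also have "\<dots> \<le> q * 1 + (1 / (2 * q)) * (S z)^2" using q by simp
    finally show "\<bar>S z\<bar> \<le> q * 1 + (1 / (2 * q)) * (S z)^2" .
  qed
  also have "\<dots> \<le> ennreal (q * 1 + (1 / (2 * q)) * (real n * (2 * L^2)))"
    using q S2' by (intro mean_combination_le) (auto simp: emeasure_space_1)
  also have "q * 1 + (1 / (2 * q)) * (real n * (2 * L^2)) = (1 + L^2) * q"
    using q(1) unfolding q(2) by (simp add: field_simps)
  finally show ?thesis unfolding S_def D_def t_def h_def q_def by (simp add: mult.commute)
qed

text \<open>Expansion of the square of s W + R. Since W^2 has mean q^2 and R^2 has mean of order
  q^4, the two terms from the cross product are of order q in mean, and the one from R^2 alone is of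
  order q^2.\<close>

lemma excess_remainder_le:
  assumes n: "n \<ge> 1" "i < n" and z: "z \<in> space M"
    and A: "1 / \<sigma> (tm n i) z \<le> A"
  defines "W \<equiv> w (tm n (Suc i)) z - w (tm n i) z"
    and "R \<equiv> remainder (tm n i) (tm n (Suc i)) z" and "q \<equiv> sqrt (step T n)"
  shows "\<bar>excess n i z - (W^2 - step T n) / step T n\<bar> \<le> A / q * W^2 + (A / q ^ 3 + A^2 / q^2) * R^2"
proof -
  define s where "s = \<sigma> (tm n i) z"
  have s: "s > 0" "1 / s \<le> A" "0 \<le> 1 / s" using \<sigma>_pos A by (auto simp: s_def less_imp_le)
  have q: "q > 0" "step T n = q^2" using step_pos[OF n(1)] by (auto simp: q_def)
  have dY: "Y (tm n (Suc i)) z - Y (tm n i) z = s * W + R"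
    by (simp add: R_def remainder_def W_def s_def)
  have "excess n i z - (W^2 - step T n) / step T n = (1 / s) * (2 * (W * R) / q^2) + (1 / s)^2 * (R^2 / q^2)"
    unfolding excess_eq dY q(2) s_def[symmetric] using s(1) q(1)
    by (simp add: field_simps power2_eq_square)
  then have "\<bar>excess n i z - (W^2 - step T n) / step T n\<bar> \<le>
      \<bar>(1 / s) * (2 * (W * R) / q^2)\<bar> + \<bar>(1 / s)^2 * (R^2 / q^2)\<bar>" by linarith
  also have "\<bar>(1 / s) * (2 * (W * R) / q^2)\<bar> \<le> A * (W^2 / q + R^2 / q ^ 3)"
  proof -
    have "2 * (q * \<bar>W\<bar>) * \<bar>R\<bar> \<le> (q * \<bar>W\<bar>)^2 + \<bar>R\<bar>^2" by (rule sum_squares_bound)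
    then have "2 * (\<bar>W\<bar> * \<bar>R\<bar>) * q \<le> q^2 * W^2 + R^2" by (simp add: power_mult_distrib mult_ac)
    then have "2 * (\<bar>W\<bar> * \<bar>R\<bar>) * q / q ^ 3 \<le> (q^2 * W^2 + R^2) / q ^ 3"
      using q(1) by (intro divide_right_mono) auto
    also have "2 * (\<bar>W\<bar> * \<bar>R\<bar>) * q / q ^ 3 = \<bar>2 * (W * R) / q^2\<bar>"
      using q(1) by (simp add: abs_mult power2_eq_square power3_eq_cube)
    also have "(q^2 * W^2 + R^2) / q ^ 3 = W^2 / q + R^2 / q ^ 3"
      using q(1) by (simp add: add_divide_distrib power2_eq_square power3_eq_cube)
    finally have "(1 / s) * \<bar>2 * (W * R) / q^2\<bar> \<le> A * (W^2 / q + R^2 / q ^ 3)"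
      using s order_trans[OF s(3,2)] by (intro mult_mono) auto
    then show ?thesis using s(1) by (simp add: abs_mult)
  qed
  also have "\<bar>(1 / s)^2 * (R^2 / q^2)\<bar> \<le> A^2 * (R^2 / q^2)"
  proof -
    have "(1 / s)^2 * (R^2 / q^2) \<le> A^2 * (R^2 / q^2)"
      by (rule mult_right_mono[OF power_mono[OF s(2,3)]]) simp
    then show ?thesis by (subst abs_of_nonneg) auto
  qed
  finally show ?thesis by (simp add: algebra_simps)
qed

text \<open>The martingale part is of order sqrt n by orthogonality. The remaining n errors are each
  of order sqrt h, so a plain sum of them has the same order. The constant is chosen before
  \<open>n\<close> and the weights, depending on their bound \<open>L\<close> alone.\<close>

lemma sum_excess_bound:
  assumes L0: "L \<ge> 0"
  obtains C where "C \<ge> 0"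
    "\<And>n \<phi>. n \<ge> 1 \<Longrightarrow> (\<And>i. i < n \<Longrightarrow> \<phi> i \<in> borel_measurable (F (tm n i))) \<Longrightarrow>
       (\<And>i z. i < n \<Longrightarrow> z \<in> space M \<Longrightarrow> \<bar>\<phi> i z\<bar> \<le> L) \<Longrightarrow>
       mean M (\<lambda>z. \<bar>\<Sum>i<n. \<phi> i z * excess n i z\<bar>) \<le> ennreal (C * sqrt (real n))"
proof -
  obtain A where A: "A \<ge> 1" "\<And>t z. 0 \<le> t \<Longrightarrow> t \<le> T \<Longrightarrow> z \<in> space M \<Longrightarrow> 1 / \<sigma> t z \<le> A"
    by (rule \<sigma>_bounds) blast
  obtain CR where CR: "CR \<ge> 0" "\<And>s t. 0 \<le> s \<Longrightarrow> s \<le> t \<Longrightarrow> t \<le> T \<Longrightarrow>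
      mean M (\<lambda>z. (remainder s t z)^2) \<le> ennreal (CR * (t - s)^2)"
    by (rule remainder_bound) blast
  \<comment> \<open>The term with \<open>sqrt T\<close> comes from the square of R: since the step
    is at most T, q^2 is at most sqrt T * q.\<close>
  define C1 where "C1 = L * (A * (1 + CR) + A^2 * CR * sqrt T)"
  have C1: "C1 \<ge> 0" using L0 A(1) CR(1) T by (simp add: C1_def)
  show ?thesis
  proof (rule that[of "1 + L^2 + C1 * sqrt T"])
    show "1 + L^2 + C1 * sqrt T \<ge> 0" using C1 T by simp
    fix n :: nat and \<phi> assume n: "n \<ge> 1"
      and \<phi>: "\<And>i. i < n \<Longrightarrow> \<phi> i \<in> borel_measurable (F (tm n i))"
      and L: "\<And>i z. i < n \<Longrightarrow> z \<in> space M \<Longrightarrow> \<bar>\<phi> i z\<bar> \<le> L"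
    define q where "q = sqrt (step T n)"
    have q: "q > 0" "step T n = q^2" using step_pos[OF n(1)] by (auto simp: q_def)
    define W where "W i z = w (tm n (Suc i)) z - w (tm n i) z" for i z
    define R where "R i = remainder (tm n i) (tm n (Suc i))" for i
    define m where "m i z = ((W i z)^2 - step T n) / step T n" for i z
    have t: "0 \<le> tm n i" "tm n i \<le> tm n (Suc i)" "tm n (Suc i) \<le> T"
      "tm n i \<le> T" "0 \<le> tm n (Suc i)" if "i < n" for i
      using obs_time_range[OF n, of i] obs_time_range[OF n, of "Suc i"] obs_time_mono[OF n] that by auto
    have Wm: "W i \<in> borel_measurable M" if "i < n" for i
      unfolding W_def using t[OF that] by (intro borel_measurable_diff w_measurable) auto
    have Rm: "R i \<in> borel_measurable M" if "i < n" for i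
      unfolding R_def using t[OF that] by (intro remainder_measurable)
    have mm: "m i \<in> borel_measurable M" if "i < n" for i
      unfolding m_def using Wm[OF that] by measurable
    have \<phi>m: "\<phi> i \<in> borel_measurable M" if "i < n" for i
      using measurable_M[OF _ _ \<phi>[OF that]] t[OF that] by auto
    have err: "mean M (\<lambda>z. \<bar>\<phi> i z * (excess n i z - m i z)\<bar>) \<le> ennreal (C1 * q)" if i: "i < n" for i
    proof -
      have W2: "mean M (\<lambda>z. (W i z)^2) \<le> ennreal (q^2)"
      proof -
        have "has_bochner_integral M (\<lambda>z. 1 * (W i z)^2) (expectation (\<lambda>_. 1) * (tm n (Suc i) - tm n i))"
          unfolding W_def using t[OF i] by (intro increment_moments(2)) auto
        then have "has_bochner_integral M (\<lambda>z. (W i z)^2) (q^2)"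
          by (simp add: obs_time_Suc q(2) prob_space)
        then show ?thesis by (subst nn_integral_eq_integral) (auto simp: has_bochner_integral_iff)
      qed
      have R2: "mean M (\<lambda>z. (R i z)^2) \<le> ennreal (CR * (q^2)^2)"
        using CR(2)[OF t(1-3)[OF i]] by (simp add: R_def obs_time_Suc q(2))
      have "mean M (\<lambda>z. \<bar>\<phi> i z * (excess n i z - m i z)\<bar>) \<le>
          mean M (\<lambda>z. L * (A / q) * (W i z)^2 + L * (A / q ^ 3 + A^2 / q^2) * (R i z)^2)"
      proof (intro nn_integral_mono ennreal_leI)
        fix z assume z: "z \<in> space M"
        have "\<bar>\<phi> i z\<bar> * \<bar>excess n i z - m i z\<bar> \<le> L * (A / q * (W i z)^2 + (A / q ^ 3 + A^2 / q^2) * (R i z)^2)"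
          using L[OF i z] L0 excess_remainder_le[OF n i z A(2)[OF t(1,4)[OF i] z]]
          unfolding m_def W_def R_def q_def by (intro mult_mono) auto
        then show "\<bar>\<phi> i z * (excess n i z - m i z)\<bar> \<le> L * (A / q) * (W i z)^2 + L * (A / q ^ 3 + A^2 / q^2) * (R i z)^2"
          unfolding abs_mult mult.assoc[of L] distrib_left[of L "A / q * (W i z)^2", symmetric] .
      qed
      also have "\<dots> \<le> ennreal (L * (A / q) * q^2 + L * (A / q ^ 3 + A^2 / q^2) * (CR * (q^2)^2))"
        using W2 R2 Wm[OF i] Rm[OF i] L0 A(1) q(1) CR(1) by (intro mean_combination_le) auto
      also have "\<dots> \<le> ennreal (C1 * q)"
      proof (rule ennreal_leI)
        have "real n \<ge> 1" using n by simp
        then have "step T n \<le> T" unfolding step_def using T by (simp add: divide_le_eq mult_le_cancel_left1)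
        then have "q \<le> sqrt T" by (simp add: q_def)
        then have "L * (A^2 * CR * q) * q \<le> L * (A^2 * CR * sqrt T) * q"
          using L0 A(1) CR(1) q(1) by (intro mult_left_mono mult_right_mono) auto
        moreover have "L * (A / q) * q^2 + L * (A / q ^ 3 + A^2 / q^2) * (CR * (q^2)^2) =
            L * (A * (1 + CR)) * q + L * (A^2 * CR * q) * q"
          using q(1) by (simp add: field_simps power2_eq_square power3_eq_cube)
        ultimately show "L * (A / q) * q^2 + L * (A / q ^ 3 + A^2 / q^2) * (CR * (q^2)^2) \<le> C1 * q"
          by (simp add: C1_def algebra_simps)
      qed
      finally show ?thesis .
    qed
    have 1: "mean M (\<lambda>z. \<bar>\<Sum>i<n. \<phi> i z * m i z\<bar>) \<le> ennreal ((1 + L^2) * sqrt (real n))"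
      unfolding m_def W_def by (rule sum_wiener_squares_bound[OF n \<phi> L])
    have 2: "mean M (\<lambda>z. \<bar>\<Sum>i<n. \<phi> i z * (excess n i z - m i z)\<bar>) \<le> ennreal (real (card {..<n}) * (C1 * q))"
      using \<phi>m mm excess_measurable[OF n] err C1 q(1)
      by (intro mean_abs_sum_le borel_measurable_times borel_measurable_diff) auto
    have "mean M (\<lambda>z. \<bar>\<Sum>i<n. \<phi> i z * excess n i z\<bar>) \<le>
        mean M (\<lambda>z. 1 * \<bar>\<Sum>i<n. \<phi> i z * m i z\<bar> + 1 * \<bar>\<Sum>i<n. \<phi> i z * (excess n i z - m i z)\<bar>)"
    proof (intro nn_integral_mono ennreal_leI)
      fix z
      have "(\<Sum>i<n. \<phi> i z * excess n i z) = (\<Sum>i<n. \<phi> i z * m i z) + (\<Sum>i<n. \<phi> i z * (excess n i z - m i z))"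
        by (simp add: sum.distrib[symmetric] algebra_simps)
      then show "\<bar>\<Sum>i<n. \<phi> i z * excess n i z\<bar> \<le> 1 * \<bar>\<Sum>i<n. \<phi> i z * m i z\<bar> + 1 * \<bar>\<Sum>i<n. \<phi> i z * (excess n i z - m i z)\<bar>"
        by simp
    qed
    also have "\<dots> \<le> ennreal (1 * ((1 + L^2) * sqrt (real n)) + 1 * (real (card {..<n}) * (C1 * q)))"
      using \<phi>m mm excess_measurable[OF n] C1 q(1)
      by (intro mean_combination_le 1 2 borel_measurable_abs borel_measurable_sum borel_measurable_times borel_measurable_diff) auto
    also have "1 * ((1 + L^2) * sqrt (real n)) + 1 * (real (card {..<n}) * (C1 * q)) = (1 + L^2 + C1 * sqrt T) * sqrt (real n)"
    proof -
      have "real n * q = sqrt T * sqrt (real n)"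
        unfolding q_def step_def using n by (simp add: real_sqrt_divide real_div_sqrt field_simps)
      then have "real n * (C1 * q) = C1 * (sqrt T * sqrt (real n))" by (metis mult.left_commute)
      then show ?thesis by (simp add: algebra_simps)
    qed
    finally show "mean M (\<lambda>z. \<bar>\<Sum>i<n. \<phi> i z * excess n i z\<bar>) \<le> ennreal ((1 + L^2 + C1 * sqrt T) * sqrt (real n))" .
  qed
qed

end

section \<open>Score and observed information\<close>

lemma bounded_in_probI_mean:
  fixes Z :: "nat \<Rightarrow> 'a \<Rightarrow> 'b::real_normed_vector"
  assumes "\<And>n. n \<ge> 1 \<Longrightarrow> f n \<in> borel_measurable M"
    and "\<And>n z. n \<ge> 1 \<Longrightarrow> z \<in> space M \<Longrightarrow> norm (Z n z) \<le> f n z"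
    and "\<And>n. n \<ge> 1 \<Longrightarrow> mean M (\<lambda>z. f n z) \<le> ennreal c" and c: "c \<ge> 0"
  shows "bounded_in_prob M Z"
  unfolding bounded_in_prob_def
proof (intro allI impI)
  fix \<epsilon> :: real assume e: "\<epsilon> > 0"
  \<comment> \<open>The added 1 makes Markov's bound c / K strictly smaller than
    \<open>\<epsilon>\<close> and keeps \<open>K\<close> positive for c = 0.\<close>
  define K where "K = (c + 1) / \<epsilon>"
  have K: "K > 0" using c e by (simp add: K_def)
  have "c < c + 1" by simp
  also have "c + 1 = K * \<epsilon>" using e by (simp add: K_def)
  finally have cK: "c / K < \<epsilon>" using K by (simp add: divide_less_eq mult.commute)
  have "outer_measure_of M {z \<in> space M. norm (Z n z) > K} < ennreal \<epsilon>" if n: "n \<ge> 1" for n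
  proof -
    have "{z \<in> space M. norm (Z n z) > K} = {z \<in> space M. ennreal (norm (Z n z)) > ennreal K}"
      using K by (auto simp: ennreal_less_iff)
    then have "outer_measure_of M {z \<in> space M. norm (Z n z) > K} \<le> mean M (\<lambda>z. f n z) / ennreal K"
      using outer_measure_of_Markov[of "\<lambda>z. ennreal (f n z)" M K "\<lambda>z. ennreal (norm (Z n z))"] K assms(1,2)[OF n]
      by (simp add: ennreal_leI)
    also have "\<dots> \<le> ennreal c / ennreal K" using assms(3)[OF n] by (rule divide_right_mono_ennreal)
    also have "\<dots> = ennreal (c / K)" using c K by (simp add: divide_ennreal)
    also have "\<dots> < ennreal \<epsilon>" using cK c K e by (simp add: ennreal_less_iff)
    finally show ?thesis .
  qed
  then show "\<exists>K. \<forall>\<^sub>F n in sequentially. outer_measure_of M {z \<in> space M. norm (Z n z) > K} < ennreal \<epsilon>"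
    by (intro exI[of _ K]) (auto simp: eventually_at_top_linorder)
qed

lemma rate_matrix_mult_vec: "rate_matrix n *v u = (1 / sqrt (real n)) *\<^sub>R u"
proof -
  have "real n powr (-1/2) = 1 / sqrt (real n)"
    by (simp add: powr_minus_divide powr_half_sqrt)
  then show ?thesis
    by (simp add: vec_eq_iff rate_matrix_def matrix_vector_mult_def mat_def if_distrib[of "\<lambda>x. x * _"] cong: if_cong)
qed

lemma rate_matrix_conjugate: "rate_matrix n ** A ** rate_matrix n = (1 / real n) *\<^sub>R A"
proof -
  have r: "real n powr (-1/2) = 1 / sqrt (real n)"
    by (simp add: powr_minus_divide powr_half_sqrt)
  have "(rate_matrix n ** A ** rate_matrix n) $ i $ j = (1 / real n) * A $ i $ j" for i j
  proof -
    have "(rate_matrix n ** A ** rate_matrix n) $ i $ j = (1 / sqrt (real n)) * A $ i $ j * (1 / sqrt (real n))"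
      unfolding rate_matrix_def r
      by (simp add: matrix_matrix_mult_def mat_def if_distrib[of "\<lambda>x. x * _"]
          if_distrib[of "\<lambda>x. _ * x"] cong: if_cong)
    then show ?thesis by simp
  qed
  then show ?thesis by (simp add: vec_eq_iff)
qed

lemma norm_matrix_le_sum: "norm (A :: real^'p^'q::finite) \<le> (\<Sum>i\<in>UNIV. \<Sum>j\<in>UNIV. \<bar>A $ i $ j\<bar>)"
proof -
  have "norm A \<le> (\<Sum>i\<in>UNIV. norm (A $ i))"
    unfolding norm_vec_def[of A] by (rule L2_set_le_sum) simp
  also have "\<dots> \<le> (\<Sum>i\<in>UNIV. \<Sum>j\<in>UNIV. \<bar>A $ i $ j\<bar>)" by (intro sum_mono norm_le_l1_cart)
  finally show ?thesis .
qed

section \<open>Weighted sums of \<open>excess\<close>: score and third derivatives\<close>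

context volatility_regression
begin

lemma grad_quasi_loglik_excess:
  "grad (Hn n z) \<theta>0 $ l = 1/2 * (\<Sum>i<n. Xn n i z $ l * excess n i z)"
  unfolding grad_quasi_loglik One_nat_def sum.atLeast1_atMost_eq by (simp add: excess_def obs_def)

lemma hessian_quasi_loglik_excess:
  "hessian (Hn n z) \<theta>0 $ l $ k =
     - (1/2) * (\<Sum>i<n. Xn n i z $ l * Xn n i z $ k * (excess n i z + 1))"
  unfolding hessian_quasi_loglik One_nat_def sum.atLeast1_atMost_eq by (simp add: excess_def obs_def)

lemma partial3_quasi_loglik_excess:
  "partial m (partial l (partial k (Hn n z))) \<theta> =
     1/2 * (\<Sum>i<n. Xn n i z $ m * Xn n i z $ l * Xn n i z $ k *
       ((excess n i z + 1) * exp (- (Xn n i z \<bullet> (\<theta> - \<theta>0)))))"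
proof -
  have "(excess n i z + 1) * exp (- (Xn n i z \<bullet> (\<theta> - \<theta>0))) =
      scaled_sq_incr T Y n (Suc i) z * exp (- (Xn n i z \<bullet> \<theta>))" for i
    by (simp add: excess_def obs_def inner_diff_right mult.assoc exp_add[symmetric])
  then show ?thesis
    unfolding partial3_quasi_loglik One_nat_def sum.atLeast1_atMost_eq by (simp add: obs_def)
qed

lemma excess_ge: "n \<ge> 1 \<Longrightarrow> excess n i z + 1 \<ge> 0"
  using step_pos[of n] by (simp add: excess_def scaled_sq_incr_def)

lemma X_component_measurable_F:
  assumes "0 \<le> t" "t \<le> T"
  shows "(\<lambda>z. X t z $ l) \<in> borel_measurable (F t)"
proof -
  have "(\<lambda>z. X t z \<bullet> axis l 1) \<in> borel_measurable (F t)"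
    using X_measurable_F[OF assms] by measurable
  then show ?thesis by (simp add: inner_axis)
qed

lemma sum_X_excess_bounds:
  obtains C where "C \<ge> 0"
    "\<And>n l. n \<ge> 1 \<Longrightarrow> mean M (\<lambda>z. \<bar>\<Sum>i<n. Xn n i z $ l * excess n i z\<bar>) \<le> ennreal (C * sqrt (real n))"
    "\<And>n l k. n \<ge> 1 \<Longrightarrow> mean M (\<lambda>z. \<bar>\<Sum>i<n. Xn n i z $ l * Xn n i z $ k * excess n i z\<bar>)
       \<le> ennreal (C * sqrt (real n))"
    "\<And>n. n \<ge> 1 \<Longrightarrow> mean M (\<lambda>z. \<bar>\<Sum>i<n. excess n i z\<bar>) \<le> ennreal (C * sqrt (real n))"
proof -
  \<comment> \<open>A common bound for the weights 1, one component of X, and a product of two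
    components.\<close>
  define L where "L = 1 + B + B * B"
  have L: "L \<ge> 0" "1 \<le> L" "B \<le> L" "B * B \<le> L" using B(1) by (auto simp: L_def)
  obtain C where C: "C \<ge> 0" and bound:
    "\<And>n \<phi>. n \<ge> 1 \<Longrightarrow> (\<And>i. i < n \<Longrightarrow> \<phi> i \<in> borel_measurable (F (tm n i))) \<Longrightarrow>
       (\<And>i z. i < n \<Longrightarrow> z \<in> space M \<Longrightarrow> \<bar>\<phi> i z\<bar> \<le> L) \<Longrightarrow>
       mean M (\<lambda>z. \<bar>\<Sum>i<n. \<phi> i z * excess n i z\<bar>) \<le> ennreal (C * sqrt (real n))"
    using L(1) by (rule sum_excess_bound) blast
  have t: "0 \<le> tm n i" "tm n i \<le> T" if "n \<ge> 1" "i < n" for n i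
    using obs_time_range[OF that(1), of i] that(2) by auto
  have comp: "\<bar>Xn n i z $ l\<bar> \<le> B" if "n \<ge> 1" "i < n" "z \<in> space M" for n i z l
    using component_le_norm_cart[of "Xn n i z" l] B(2)[OF t[OF that(1,2)] that(3)] by linarith
  show ?thesis
  proof (rule that[OF C])
    fix n :: nat and l k assume n: "n \<ge> 1"
    show "mean M (\<lambda>z. \<bar>\<Sum>i<n. Xn n i z $ l * excess n i z\<bar>) \<le> ennreal (C * sqrt (real n))"
    proof (rule bound[OF n])
      fix i z assume i: "i < n"
      show "(\<lambda>z. Xn n i z $ l) \<in> borel_measurable (F (tm n i))"
        by (rule X_component_measurable_F[OF t[OF n i]])
      assume "z \<in> space M"
      then show "\<bar>Xn n i z $ l\<bar> \<le> L" using comp[OF n i] L(3) order_trans by blast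
    qed
    show "mean M (\<lambda>z. \<bar>\<Sum>i<n. Xn n i z $ l * Xn n i z $ k * excess n i z\<bar>) \<le> ennreal (C * sqrt (real n))"
    proof (rule bound[OF n])
      fix i z assume i: "i < n"
      show "(\<lambda>z. Xn n i z $ l * Xn n i z $ k) \<in> borel_measurable (F (tm n i))"
        by (intro borel_measurable_times X_component_measurable_F[OF t[OF n i]])
      assume z: "z \<in> space M"
      have "\<bar>Xn n i z $ l\<bar> * \<bar>Xn n i z $ k\<bar> \<le> B * B"
        using comp[OF n i z] B(1) by (intro mult_mono) auto
      then show "\<bar>Xn n i z $ l * Xn n i z $ k\<bar> \<le> L"
        using L(4) by (simp add: abs_mult)
    qed
    have "mean M (\<lambda>z. \<bar>\<Sum>i<n. 1 * excess n i z\<bar>) \<le> ennreal (C * sqrt (real n))"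
      by (rule bound[OF n]) (use L in auto)
    then show "mean M (\<lambda>z. \<bar>\<Sum>i<n. excess n i z\<bar>) \<le> ennreal (C * sqrt (real n))" by simp
  qed
qed

lemma X_component_measurable:
  assumes "n \<ge> 1" "i < n"
  shows "(\<lambda>z. Xn n i z $ l) \<in> borel_measurable M"
  using measurable_M[OF _ _ X_component_measurable_F] obs_time_range[OF assms(1), of i] assms(2) by auto

text \<open>The rate 1 / sqrt n cancels the order of the component sums, leaving first moments
  bounded in n.\<close>

lemma score_bounded_in_prob:
  "bounded_in_prob M (\<lambda>n z. rate_matrix n *v grad (Hn n z) \<theta>0)"
proof -
  obtain C where C: "C \<ge> 0"
    "\<And>n l. n \<ge> 1 \<Longrightarrow> mean M (\<lambda>z. \<bar>\<Sum>i<n. Xn n i z $ l * excess n i z\<bar>) \<le> ennreal (C * sqrt (real n))"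
    by (rule sum_X_excess_bounds) blast
  define g where "g n l z = (1 / sqrt (real n)) * (1/2 * (\<Sum>i<n. Xn n i z $ l * excess n i z))" for n z and l :: 'p
  have gm: "g n l \<in> borel_measurable M" if n: "n \<ge> 1" for n l
    unfolding g_def using X_component_measurable[OF n] excess_measurable[OF n]
    by (intro borel_measurable_times borel_measurable_sum borel_measurable_const) auto
  have g: "mean M (\<lambda>z. \<bar>g n l z\<bar>) \<le> ennreal C" if n: "n \<ge> 1" for n l
  proof -
    have "mean M (\<lambda>z. \<bar>g n l z\<bar>) =
        (\<integral>\<^sup>+z. ennreal (1 / (2 * sqrt (real n))) * ennreal \<bar>\<Sum>i<n. Xn n i z $ l * excess n i z\<bar> \<partial>M)"
      by (intro nn_integral_cong) (simp add: g_def abs_mult ennreal_mult'[symmetric])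
    also have "\<dots> = ennreal (1 / (2 * sqrt (real n))) * mean M (\<lambda>z. \<bar>\<Sum>i<n. Xn n i z $ l * excess n i z\<bar>)"
      using X_component_measurable[OF n] excess_measurable[OF n]
      by (intro nn_integral_cmult measurable_compose[OF _ measurable_ennreal] borel_measurable_abs borel_measurable_sum borel_measurable_times) auto
    also have "\<dots> \<le> ennreal (1 / (2 * sqrt (real n))) * ennreal (C * sqrt (real n))"
      by (intro mult_left_mono C(2) n) simp
    also have "\<dots> = ennreal (C / 2)" using n C(1) by (simp add: ennreal_mult[symmetric])
    also have "\<dots> \<le> ennreal C" using C(1) by (intro ennreal_leI) simp
    finally show ?thesis .
  qed
  show ?thesis
  proof (rule bounded_in_probI_mean)
    fix n :: nat and z assume n: "n \<ge> 1"
    have "norm (rate_matrix n *v grad (Hn n z) \<theta>0) \<le> (\<Sum>l\<in>UNIV. \<bar>(rate_matrix n *v grad (Hn n z) \<theta>0) $ l\<bar>)"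
      by (rule norm_le_l1_cart)
    also have "\<dots> = (\<Sum>l\<in>UNIV. \<bar>g n l z\<bar>)"
      by (simp add: rate_matrix_mult_vec grad_quasi_loglik_excess g_def)
    finally show "norm (rate_matrix n *v grad (Hn n z) \<theta>0) \<le> (\<Sum>l\<in>UNIV. \<bar>g n l z\<bar>)" .
    show "(\<lambda>z. \<Sum>l\<in>UNIV. \<bar>g n l z\<bar>) \<in> borel_measurable M"
      using gm[OF n] by (intro borel_measurable_sum borel_measurable_abs) auto
    have "mean M (\<lambda>z. \<bar>\<Sum>l\<in>UNIV. \<bar>g n l z\<bar>\<bar>) \<le> ennreal (real (card (UNIV :: 'p set)) * C)"
      using gm[OF n] g[OF n] C(1) by (intro mean_abs_sum_le borel_measurable_abs) auto
    then show "mean M (\<lambda>z. \<Sum>l\<in>UNIV. \<bar>g n l z\<bar>) \<le> ennreal (real CARD('p) * C)"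
      by (simp add: abs_of_nonneg sum_nonneg)
  qed (use C in simp)
qed

text \<open>On a bounded parameter set the exponential factor is at most \<open>E\<close>. What
  remains is a sum of the nonnegative variables excess + 1, of order n in mean, against the
  normalisation n^(3/2).\<close>

lemma third_derivatives_vanish:
  assumes \<Theta>: "bounded \<Theta>"
  shows "vanishes_in_prob M
       (\<lambda>n z. MAX (i, j, k) \<in> UNIV. SUP \<theta>\<in>\<Theta>.
          ennreal \<bar>real n powr (-3/2) * partial i (partial j (partial k (Hn n z))) \<theta>\<bar>)"
proof -
  obtain C where C: "C \<ge> 0"
    "\<And>n. n \<ge> 1 \<Longrightarrow> mean M (\<lambda>z. \<bar>\<Sum>i<n. excess n i z\<bar>) \<le> ennreal (C * sqrt (real n))"
    by (rule sum_X_excess_bounds) blast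
  obtain R where R: "\<And>\<theta>. \<theta> \<in> \<Theta> \<Longrightarrow> norm \<theta> \<le> R" using \<Theta> unfolding bounded_iff by blast
  define E where "E = exp (B * (R + norm \<theta>0))"
  define K where "K = B ^ 3 * E"
  have K: "K \<ge> 0" using B(1) by (simp add: K_def E_def)
  \<comment> \<open>This majorant depends neither on the parameter nor on the indices, so it is
    measurable and dominates the whole supremum; its mean is of order n^(-1/2).\<close>
  define f where "f n z = (K * real n powr (-3/2) * real n) * 1 + (K * real n powr (-3/2)) * \<bar>\<Sum>i<n. excess n i z\<bar>" for n z
  have le: "\<bar>real n powr (-3/2) * partial m (partial l (partial k (Hn n z))) \<theta>\<bar> \<le> f n z"
    if n: "n \<ge> 1" and z: "z \<in> space M" and \<theta>: "\<theta> \<in> \<Theta>" for n z \<theta> m l k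
  proof -
    let ?p = "\<lambda>i. Xn n i z $ m * Xn n i z $ l * Xn n i z $ k *
       ((excess n i z + 1) * exp (- (Xn n i z \<bullet> (\<theta> - \<theta>0))))"
    have term_le: "\<bar>?p i\<bar> \<le> K * (excess n i z + 1)" if i: "i < n" for i
    proof -
      have Xn: "norm (Xn n i z) \<le> B"
        using obs_time_range[OF n, of i] i z by (intro B(2)) auto
      have c: "\<bar>Xn n i z $ j\<bar> \<le> B" for j
        using component_le_norm_cart[of "Xn n i z" j] Xn by linarith
      have "\<bar>Xn n i z \<bullet> (\<theta> - \<theta>0)\<bar> \<le> norm (Xn n i z) * norm (\<theta> - \<theta>0)"
        by (rule Cauchy_Schwarz_ineq2)
      also have "\<dots> \<le> B * (R + norm \<theta>0)"
        using Xn norm_triangle_ineq4[of \<theta> \<theta>0] R[OF \<theta>] B(1) by (intro mult_mono) auto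
      finally have "exp (- (Xn n i z \<bullet> (\<theta> - \<theta>0))) \<le> E" by (simp add: E_def abs_le_iff)
      then have 2: "(excess n i z + 1) * exp (- (Xn n i z \<bullet> (\<theta> - \<theta>0))) \<le> (excess n i z + 1) * E"
        using excess_ge[OF n] by (intro mult_left_mono) auto
      have 1: "\<bar>Xn n i z $ m\<bar> * \<bar>Xn n i z $ l\<bar> * \<bar>Xn n i z $ k\<bar> \<le> B * B * B"
        using c B(1) by (intro mult_mono) auto
      have "\<bar>Xn n i z $ m\<bar> * \<bar>Xn n i z $ l\<bar> * \<bar>Xn n i z $ k\<bar> *
          ((excess n i z + 1) * exp (- (Xn n i z \<bullet> (\<theta> - \<theta>0)))) \<le> (B * B * B) * ((excess n i z + 1) * E)"
        by (rule mult_mono[OF 1 2]) (use excess_ge[OF n] B(1) in auto)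
      then show ?thesis
        using excess_ge[OF n, of i z] by (simp add: abs_mult K_def power3_eq_cube mult_ac)
    qed
    have "\<bar>partial m (partial l (partial k (Hn n z))) \<theta>\<bar> \<le> 1/2 * (\<Sum>i<n. K * (excess n i z + 1))"
    proof -
      have "\<bar>\<Sum>i<n. ?p i\<bar> \<le> (\<Sum>i<n. K * (excess n i z + 1))"
        by (rule order_trans[OF sum_abs sum_mono]) (use term_le in simp)
      then show ?thesis unfolding partial3_quasi_loglik_excess by (simp only: abs_mult)
    qed
    also have "\<dots> \<le> (\<Sum>i<n. K * (excess n i z + 1))"
      using K excess_ge[OF n] by (simp add: sum_nonneg)
    also have "\<dots> = K * real n + K * (\<Sum>i<n. excess n i z)"
      by (simp add: sum_distrib_left[symmetric] sum.distrib algebra_simps)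
    also have "\<dots> \<le> K * real n + K * \<bar>\<Sum>i<n. excess n i z\<bar>"
      using K by (intro add_left_mono mult_left_mono) auto
    finally have "real n powr (-3/2) * \<bar>partial m (partial l (partial k (Hn n z))) \<theta>\<bar>
        \<le> real n powr (-3/2) * (K * real n + K * \<bar>\<Sum>i<n. excess n i z\<bar>)"
      by (rule mult_left_mono) simp
    then show ?thesis by (simp add: f_def abs_mult algebra_simps)
  qed
  show ?thesis
  proof (rule vanishes_in_probI_mean)
    fix n :: nat assume n: "n \<ge> 1"
    have em: "(\<lambda>z. \<bar>\<Sum>i<n. excess n i z\<bar>) \<in> borel_measurable M"
      using excess_measurable[OF n] by (intro borel_measurable_abs borel_measurable_sum) auto
    then show "(\<lambda>z. ennreal (f n z)) \<in> borel_measurable M"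
      unfolding f_def by measurable
    show "mean M (\<lambda>z. f n z) \<le> ennreal ((K * real n powr (-3/2) * real n) * 1 + (K * real n powr (-3/2)) * (C * sqrt (real n)))"
      unfolding f_def using K C n em by (intro mean_combination_le) (auto simp: emeasure_space_1)
    fix z assume "z \<in> space M"
    then have "(SUP \<theta>\<in>\<Theta>. ennreal \<bar>real n powr (-3/2) * partial m (partial l (partial k (Hn n z))) \<theta>\<bar>) \<le> ennreal (f n z)" for m l k
      using le[OF n] by (intro SUP_least ennreal_leI) auto
    then show "(MAX (i, j, k) \<in> UNIV. SUP \<theta>\<in>\<Theta>.
          ennreal \<bar>real n powr (-3/2) * partial i (partial j (partial k (Hn n z))) \<theta>\<bar>) \<le> ennreal (f n z)"
      by (intro Max.boundedI) auto
  next
    show "(\<lambda>n. (K * real n powr (-3/2) * real n) * 1 + (K * real n powr (-3/2)) * (C * sqrt (real n))) \<longlonglongrightarrow> 0"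
      by real_asymp
  qed
qed

end

section \<open>Time integrals along a path\<close>

context filtered_wiener
begin

lemma clamp_section_measurable:
  fixes Z :: "real \<Rightarrow> 'a \<Rightarrow> 'b::topological_space"
  assumes Zm: "jointly_measurable M T Z" and z: "z \<in> space M"
  shows "(\<lambda>u. Z (max 0 (min T u)) z) \<in> borel_measurable borel"
  using measurable_compose[OF _ Zm, of "\<lambda>u. (u, z)" borel] z by simp

lemma time_integral_measurable:
  fixes Z :: "real \<Rightarrow> 'a \<Rightarrow> 'b::{banach, second_countable_topology}"
  assumes Zm: "jointly_measurable M T Z"
    and A: "A \<subseteq> {0..T}" "A \<in> sets borel"
  shows "(\<lambda>z. LINT u:A|lborel. Z u z) \<in> borel_measurable M"
proof -
  note [measurable] = A(2)
  have Z2[measurable]: "(\<lambda>p. Z (max 0 (min T (snd p))) (fst p)) \<in> borel_measurable (M \<Otimes>\<^sub>M lborel)"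
    using measurable_compose[OF _ Zm, of "\<lambda>p. (snd p, fst p)" "M \<Otimes>\<^sub>M lborel"] by simp
  have "(\<lambda>(z, u). indicator A u *\<^sub>R Z (max 0 (min T u)) z) \<in> borel_measurable (M \<Otimes>\<^sub>M lborel)"
    unfolding split_beta' by measurable
  then have "(\<lambda>z. LINT u|lborel. indicator A u *\<^sub>R Z (max 0 (min T u)) z) \<in> borel_measurable M"
    by (rule lborel.borel_measurable_lebesgue_integral)
  also have "(\<lambda>z. LINT u|lborel. indicator A u *\<^sub>R Z (max 0 (min T u)) z) = (\<lambda>z. LINT u:A|lborel. Z u z)"
    unfolding set_lebesgue_integral_def
  proof (intro ext Bochner_Integration.integral_cong refl)
    fix z u
    have "max 0 (min T u) = u" if "u \<in> A" using that A(1) by auto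
    then show "indicator A u *\<^sub>R Z (max 0 (min T u)) z = indicator A u *\<^sub>R Z u z"
      by (cases "u \<in> A") auto
  qed
  finally show ?thesis .
qed

lemma time_set_integrable:
  fixes Z :: "real \<Rightarrow> 'a \<Rightarrow> 'b::{banach, second_countable_topology}"
  assumes Zm: "jointly_measurable M T Z"
    and bnd: "\<And>u. 0 \<le> u \<Longrightarrow> u \<le> T \<Longrightarrow> norm (Z u z) \<le> L" and z: "z \<in> space M"
    and A: "A \<subseteq> {0..T}" "A \<in> sets borel"
  shows "set_integrable lborel A (\<lambda>u. Z u z)"
proof -
  have fin: "emeasure lborel A < \<infinity>"
    using emeasure_mono[OF A(1), of lborel] emeasure_lborel_Icc_eq[of 0 T] A(2)
    by (auto simp: top_unique less_top intro: le_less_trans split: if_splits)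
  have clamp: "max 0 (min T u) = u" if "u \<in> A" for u using that A(1) by auto
  have "integrable lborel (\<lambda>u. indicator A u *\<^sub>R Z (max 0 (min T u)) z)"
  proof (rule integrableI_bounded_set_indicator)
    show "(\<lambda>u. Z (max 0 (min T u)) z) \<in> borel_measurable lborel"
      using clamp_section_measurable[of Z, OF Zm z] by simp
    show "AE u in lborel. u \<in> A \<longrightarrow> norm (Z (max 0 (min T u)) z) \<le> L"
      using A(1) bnd by (intro AE_I2) (auto simp: clamp)
  qed (use A fin in auto)
  also have "(\<lambda>u. indicator A u *\<^sub>R Z (max 0 (min T u)) z) = (\<lambda>u. indicator A u *\<^sub>R Z u z)"
  proof
    fix u show "indicator A u *\<^sub>R Z (max 0 (min T u)) z = indicator A u *\<^sub>R Z u z"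
      using clamp by (cases "u \<in> A") auto
  qed
  finally show ?thesis unfolding set_integrable_def .
qed

end

section \<open>Riemann sums and the limit of the observed information\<close>

context volatility_regression
begin

text \<open>On a cell of length h the integrand differs from its left value by at most K * sqrt h in
  mean; the n cells have total length T, which the factor 1 / T cancels.\<close>

lemma riemann_sum_bound:
  fixes y :: "real \<Rightarrow> 'a \<Rightarrow> real"
  assumes ym: "jointly_measurable M T y"
    and bnd: "\<And>u z. 0 \<le> u \<Longrightarrow> u \<le> T \<Longrightarrow> z \<in> space M \<Longrightarrow> \<bar>y u z\<bar> \<le> L"
    and K: "K \<ge> 0" and incr: "\<And>s u. 0 \<le> s \<Longrightarrow> s \<le> u \<Longrightarrow> u \<le> T \<Longrightarrow>
      mean M (\<lambda>z. \<bar>y s z - y u z\<bar>) \<le> ennreal (K * sqrt (u - s))"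
    and n: "n \<ge> 1"
  shows "mean M (\<lambda>z. \<bar>(1 / real n) * (\<Sum>i<n. y (tm n i) z) - (1 / T) * (LINT u:{0..T}|lborel. y u z)\<bar>)
    \<le> ennreal (K * sqrt (step T n))"
proof -
  define h where "h = step T n"
  define t where "t = obs_time T n"
  have h: "h > 0" "h = T / real n" using step_pos[OF n] by (simp_all add: h_def step_def)
  have t: "0 \<le> t i" "t i \<le> t (Suc i)" "t (Suc i) \<le> T" "t (Suc i) - t i = h" "t i \<le> T" if "i < n" for i
    using obs_time_range[OF n, of i] obs_time_range[OF n, of "Suc i"] obs_time_mono[OF n] obs_time_Suc that
    by (auto simp: t_def h_def)
  have t0: "t 0 = 0" and tn: "t n = T" using n by (auto simp: t_def obs_time_def step_def)
  have yt: "y u \<in> borel_measurable M" if "0 \<le> u" "u \<le> T" for u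
    using measurable_compose[OF measurable_Pair1' ym, of u] that by simp
  define G where "G i z = h * y (t i) z - (LINT u:{t i<..t (Suc i)}|lborel. y u z)" for i z
  have Gm: "G i \<in> borel_measurable M" if i: "i < n" for i
    unfolding G_def using t[OF i] yt[of "t i"]
    by (intro borel_measurable_diff borel_measurable_times borel_measurable_const time_integral_measurable[OF ym]) auto
  have eq: "(1 / real n) * (\<Sum>i<n. y (t i) z) - (1 / T) * (LINT u:{0..T}|lborel. y u z) = (1 / T) * (\<Sum>i<n. G i z)"
    if z: "z \<in> space M" for z
  proof -
    have int: "set_integrable lborel A (\<lambda>u. y u z)" if "A \<subseteq> {0..T}" "A \<in> sets borel" for A
      using bnd that z by (intro time_set_integrable[OF ym, where L = L]) auto
    have "(LINT u:{0..t m}|lborel. y u z) = (\<Sum>i<m. LINT u:{t i<..t (Suc i)}|lborel. y u z)" if "m \<le> n" for m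
      using that
    proof (induction m)
      \<comment> \<open>The interval \<open>{0..t 0}\<close> is the null set consisting of 0, the
        point that the half-open cells leave out.\<close>
      case 0
      have "AE u in lborel. indicator {0..t 0} u *\<^sub>R y u z = 0"
        using AE_lborel_singleton[of 0] by eventually_elim (auto simp: t0)
      then have "(LINT u:{0..t 0}|lborel. y u z) = 0"
        unfolding set_lebesgue_integral_def by (rule integral_eq_zero_AE)
      then show ?case by simp
    next
      case (Suc m)
      then have m: "m < n" by simp
      have i1: "set_integrable lborel {0..t m} (\<lambda>u. y u z)" and i2: "set_integrable lborel {t m<..t (Suc m)} (\<lambda>u. y u z)"
        using t[OF m] by (auto intro!: int)
      have "{0..t (Suc m)} = {0..t m} \<union> {t m<..t (Suc m)}" using t[OF m] by auto
      moreover have "{0..t m} \<inter> {t m<..t (Suc m)} = {}" by auto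
      ultimately have "(LINT u:{0..t (Suc m)}|lborel. y u z) = (LINT u:{0..t m}|lborel. y u z) + (LINT u:{t m<..t (Suc m)}|lborel. y u z)"
        using set_integral_Un[OF _ i1 i2] by simp
      then show ?case using Suc by simp
    qed
    from this[of n] have "(LINT u:{0..T}|lborel. y u z) = (\<Sum>i<n. LINT u:{t i<..t (Suc i)}|lborel. y u z)"
      by (simp add: tn)
    moreover have "(1 / real n) * S = (1 / T) * (h * S)" for S using h(2) T by simp
    ultimately show ?thesis
      by (simp add: G_def sum_subtractf sum_distrib_left[symmetric] right_diff_distrib)
  qed
  have G_le: "mean M (\<lambda>z. \<bar>G i z\<bar>) \<le> ennreal (K * sqrt h * h)" if i: "i < n" for i
  proof -
    have "mean M (\<lambda>z. \<bar>G i z\<bar>) \<le> (\<integral>\<^sup>+z. (\<integral>\<^sup>+u\<in>{t i<..t (Suc i)}. ennreal \<bar>y (t i) z - y u z\<bar> \<partial>lborel) \<partial>M)"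
    proof (rule nn_integral_mono)
      fix z assume z: "z \<in> space M"
      have i2: "set_integrable lborel {t i<..t (Suc i)} (\<lambda>u. y u z)"
        using bnd z t[OF i] by (intro time_set_integrable[OF ym, where L = L]) auto
      have i1: "set_integrable lborel {t i<..t (Suc i)} (\<lambda>u. y (t i) z)"
        using t[OF i] by (simp add: set_integrable_def)
      have "G i z = (LINT u:{t i<..t (Suc i)}|lborel. y (t i) z - y u z)"
        using t[OF i] by (subst set_integral_diff(2)[OF i1 i2]) (simp add: G_def set_lebesgue_integral_def)
      then have "ennreal \<bar>G i z\<bar> \<le> (\<integral>\<^sup>+u. ennreal (norm (indicator {t i<..t (Suc i)} u *\<^sub>R (y (t i) z - y u z))) \<partial>lborel)"
        using set_integral_diff(1)[OF i1 i2] unfolding set_integrable_def set_lebesgue_integral_def real_norm_def[symmetric]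
        by (simp only: integral_norm_bound_ennreal)
      also have "\<dots> = (\<integral>\<^sup>+u\<in>{t i<..t (Suc i)}. ennreal \<bar>y (t i) z - y u z\<bar> \<partial>lborel)"
        by (intro nn_integral_cong) (simp split: split_indicator)
      finally show "ennreal \<bar>G i z\<bar> \<le> (\<integral>\<^sup>+u\<in>{t i<..t (Suc i)}. ennreal \<bar>y (t i) z - y u z\<bar> \<partial>lborel)" .
    qed
    also have "\<dots> \<le> ennreal (K * sqrt h * (t (Suc i) - t i))"
    proof (rule mean_time_integral_le(2))
      note [measurable] = ym yt[OF t(1,5)[OF i]]
      show "(\<lambda>p. ennreal \<bar>y (t i) (snd p) - y (max 0 (min T (fst p))) (snd p)\<bar>) \<in> borel_measurable (borel \<Otimes>\<^sub>M M)"
        by measurable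
      fix u assume u: "t i < u" "u \<le> t (Suc i)"
      have "mean M (\<lambda>z. \<bar>y (t i) z - y u z\<bar>) \<le> ennreal (K * sqrt (u - t i))"
        using u t[OF i] by (intro incr) auto
      also have "\<dots> \<le> ennreal (K * sqrt h)"
        using u t(4)[OF i] K by (intro ennreal_leI mult_left_mono real_sqrt_le_mono) auto
      finally show "mean M (\<lambda>z. \<bar>y (t i) z - y u z\<bar>) \<le> ennreal (K * sqrt h)" .
    qed (use t[OF i] K h in auto)
    finally show ?thesis using t(4)[OF i] by simp
  qed
  have sum: "mean M (\<lambda>z. \<bar>\<Sum>i<n. G i z\<bar>) \<le> ennreal (real (card {..<n}) * (K * sqrt h * h))"
    using Gm G_le K h(1) by (intro mean_abs_sum_le) auto
  have "mean M (\<lambda>z. \<bar>(1 / real n) * (\<Sum>i<n. y (t i) z) - (1 / T) * (LINT u:{0..T}|lborel. y u z)\<bar>) =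
      (\<integral>\<^sup>+z. ennreal (1 / T) * ennreal \<bar>\<Sum>i<n. G i z\<bar> \<partial>M)"
  proof (rule nn_integral_cong)
    fix z assume z: "z \<in> space M"
    show "ennreal \<bar>(1 / real n) * (\<Sum>i<n. y (t i) z) - (1 / T) * (LINT u:{0..T}|lborel. y u z)\<bar> =
        ennreal (1 / T) * ennreal \<bar>\<Sum>i<n. G i z\<bar>"
      unfolding eq[OF z] using T by (simp add: abs_mult ennreal_mult'[symmetric])
  qed
  also have "\<dots> = ennreal (1 / T) * mean M (\<lambda>z. \<bar>\<Sum>i<n. G i z\<bar>)"
    using Gm by (intro nn_integral_cmult measurable_compose[OF _ measurable_ennreal] borel_measurable_abs borel_measurable_sum) auto
  also have "\<dots> \<le> ennreal (1 / T) * ennreal (real (card {..<n}) * (K * sqrt h * h))"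
    by (intro mult_left_mono sum) simp
  also have "\<dots> = ennreal ((1 / T) * (real (card {..<n}) * (K * sqrt h * h)))"
    using T K h(1) by (intro ennreal_mult[symmetric]) auto
  also have "(1 / T) * (real (card {..<n}) * (K * sqrt h * h)) = K * sqrt h"
  proof -
    have nh: "real n * h = T" using h(2) n by simp
    have "(1 / T) * (real (card {..<n}) * (K * sqrt h * h)) = (1 / T) * (K * sqrt h * (real n * h))" by simp
    also have "\<dots> = K * sqrt h" unfolding nh using T by simp
    finally show ?thesis .
  qed
  finally show ?thesis by (simp add: h_def t_def)
qed

text \<open>The random matrix whose smallest eigenvalue (V2)(ii) keeps away from 0.\<close>

definition gram :: "'a \<Rightarrow> real^'p^'p" where
  "gram z = (LINT t:{0..T}|lborel. outer_square (X t z))"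

lemma outer_square_measurable: "outer_square \<in> borel_measurable (borel :: (real^'p) measure)"
  unfolding outer_square_def by (intro borel_measurable_continuous_onI continuous_intros)

lemma gram_measurable: "gram \<in> borel_measurable M"
  unfolding gram_def[abs_def]
  by (rule time_integral_measurable[OF measurable_compose[OF X_clamp outer_square_measurable]]) auto

text \<open>Taking a component is bounded linear and commutes with the integral once the matrix path
  is known to be integrable; the bound \<open>B\<close> provides that.\<close>

lemma gram_component:
  assumes z: "z \<in> space M"
  shows "gram z $ l $ k = (LINT t:{0..T}|lborel. X t z $ l * X t z $ k)"
proof -
  have comp: "\<bar>X t z $ j\<bar> \<le> B" if "0 \<le> t" "t \<le> T" for t j
    using component_le_norm_cart[of "X t z" j] B(2)[OF that z] by linarith
  have "set_integrable lborel {0..T} (\<lambda>t. outer_square (X t z))"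
  proof (rule time_set_integrable[OF measurable_compose[OF X_clamp outer_square_measurable] _ z])
    fix u assume u: "0 \<le> u" "u \<le> T"
    have "norm (outer_square (X u z)) \<le> (\<Sum>i\<in>UNIV. \<Sum>j\<in>UNIV. \<bar>outer_square (X u z) $ i $ j\<bar>)"
      by (rule norm_matrix_le_sum)
    also have "\<dots> \<le> (\<Sum>i\<in>(UNIV :: 'p set). \<Sum>j\<in>(UNIV :: 'p set). B * B)"
      using comp[OF u] B(1) unfolding outer_square_def by (intro sum_mono) (simp add: abs_mult mult_mono)
    finally show "norm (outer_square (X u z)) \<le> (\<Sum>i\<in>(UNIV :: 'p set). \<Sum>j\<in>(UNIV :: 'p set). B * B)" .
  qed auto
  then have int: "integrable lborel (\<lambda>t. indicator {0..T} t *\<^sub>R outer_square (X t z))"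
    by (simp add: set_integrable_def)
  have bl: "bounded_linear (\<lambda>A :: real^'p^'p. A $ l $ k)"
    using bounded_linear_compose[OF bounded_linear_vec_nth bounded_linear_vec_nth] .
  have "gram z $ l $ k = (LINT t|lborel. (indicator {0..T} t *\<^sub>R outer_square (X t z)) $ l $ k)"
    unfolding gram_def set_lebesgue_integral_def by (rule integral_bounded_linear[OF bl int, symmetric])
  then show ?thesis by (simp add: set_lebesgue_integral_def outer_square_def)
qed

text \<open>The difference of products splits into two products with one factor bounded by
  \<open>B\<close> and one increment of X, to which (V1) applies with q = 1.\<close>

lemma X_product_increment:
  obtains K where "K \<ge> 0" "\<And>s u l k. 0 \<le> s \<Longrightarrow> s \<le> u \<Longrightarrow> u \<le> T \<Longrightarrow>
      mean M (\<lambda>z. \<bar>X s z $ l * X s z $ k - X u z $ l * X u z $ k\<bar>) \<le> ennreal (K * sqrt (u - s))"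
proof -
  have "(0::real) < 1" by simp
  then obtain CX where CX: "CX > 0" "\<And>s t. s \<in> {0..T} \<Longrightarrow> t \<in> {0..T} \<Longrightarrow>
      mean M (\<lambda>z. norm (X t z - X s z) powr 1) \<le> ennreal (CX * \<bar>t - s\<bar> powr (1/2))"
    by (rule X_increment) blast
  show ?thesis
  proof (rule that[of "2 * B * CX"])
    fix s u :: real and l k assume su: "0 \<le> s" "s \<le> u" "u \<le> T"
    have "mean M (\<lambda>z. \<bar>X s z $ l * X s z $ k - X u z $ l * X u z $ k\<bar>) \<le>
        (\<integral>\<^sup>+z. ennreal (2 * B) * ennreal (norm (X u z - X s z) powr 1) \<partial>M)"
    proof (rule nn_integral_mono)
      fix z assume z: "z \<in> space M"
      have c: "\<bar>X u z $ l\<bar> \<le> B" "\<bar>X s z $ k\<bar> \<le> B"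
        using component_le_norm_cart[of "X u z" l] component_le_norm_cart[of "X s z" k] B(2)[OF _ _ z] su
        by (meson order_trans)+
      have d: "\<bar>X u z $ j - X s z $ j\<bar> \<le> norm (X u z - X s z)" for j
        using component_le_norm_cart[of "X u z - X s z" j] by simp
      have "\<bar>X s z $ l * X s z $ k - X u z $ l * X u z $ k\<bar> =
          \<bar>X u z $ l * (X u z $ k - X s z $ k) + (X u z $ l - X s z $ l) * X s z $ k\<bar>"
        by (simp add: algebra_simps abs_minus_commute)
      also have "\<dots> \<le> \<bar>X u z $ l\<bar> * \<bar>X u z $ k - X s z $ k\<bar> + \<bar>X u z $ l - X s z $ l\<bar> * \<bar>X s z $ k\<bar>"
        unfolding abs_mult[symmetric] by (rule abs_triangle_ineq)
      also have "\<dots> \<le> B * norm (X u z - X s z) + norm (X u z - X s z) * B"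
        using c d B(1) by (intro add_mono mult_mono) auto
      finally have "\<bar>X s z $ l * X s z $ k - X u z $ l * X u z $ k\<bar> \<le> 2 * B * norm (X u z - X s z)" by simp
      then show "ennreal \<bar>X s z $ l * X s z $ k - X u z $ l * X u z $ k\<bar> \<le> ennreal (2 * B) * ennreal (norm (X u z - X s z) powr 1)"
        using B(1) by (simp add: ennreal_mult'[symmetric] ennreal_leI)
    qed
    also have "\<dots> = ennreal (2 * B) * mean M (\<lambda>z. norm (X u z - X s z) powr 1)"
      using X_measurable[of u] X_measurable[of s] su by (intro nn_integral_cmult) auto
    also have "\<dots> \<le> ennreal (2 * B) * ennreal (CX * \<bar>u - s\<bar> powr (1/2))"
      using CX(2)[of s u] su by (intro mult_left_mono) auto
    also have "\<dots> = ennreal (2 * B * CX * sqrt (u - s))"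
      using B(1) CX(1) su by (simp add: ennreal_mult[symmetric] powr_half_sqrt mult.assoc)
    finally show "mean M (\<lambda>z. \<bar>X s z $ l * X s z $ k - X u z $ l * X u z $ k\<bar>) \<le> ennreal (2 * B * CX * sqrt (u - s))" .
  qed (use B(1) CX(1) in simp)
qed

definition information :: "'a \<Rightarrow> real^'p^'p" where
  "information z = (1 / (2 * T)) *\<^sub>R gram z"

lemma information_measurable: "information \<in> borel_measurable M"
  unfolding information_def[abs_def] using gram_measurable by measurable

text \<open>Entry by entry, the deviation is a weighted sum of \<open>excess\<close> divided by 2n
  plus half a Riemann error. Both have mean of order n^(-1/2).\<close>

lemma observed_information_converges:
  "converges_in_prob M (\<lambda>n z. - (rate_matrix n ** hessian (Hn n z) \<theta>0 ** rate_matrix n)) information"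
proof -
  have comp: "\<bar>X t z $ j\<bar> \<le> B" if "0 \<le> t" "t \<le> T" "z \<in> space M" for t z j
    using component_le_norm_cart[of "X t z" j] B(2)[OF that] by linarith
  obtain K where K: "K \<ge> 0" "\<And>s u l k. 0 \<le> s \<Longrightarrow> s \<le> u \<Longrightarrow> u \<le> T \<Longrightarrow>
      mean M (\<lambda>z. \<bar>X s z $ l * X s z $ k - X u z $ l * X u z $ k\<bar>) \<le> ennreal (K * sqrt (u - s))"
    by (rule X_product_increment) blast
  obtain C where C: "C \<ge> 0"
    "\<And>n l k. n \<ge> 1 \<Longrightarrow> mean M (\<lambda>z. \<bar>\<Sum>i<n. Xn n i z $ l * Xn n i z $ k * excess n i z\<bar>)
       \<le> ennreal (C * sqrt (real n))"
    by (rule sum_X_excess_bounds) blast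
  define S where "S n l k z = (\<Sum>i<n. Xn n i z $ l * Xn n i z $ k * excess n i z)" for n l k z
  define Q where "Q n l k z = (1 / real n) * (\<Sum>i<n. Xn n i z $ l * Xn n i z $ k) - (1 / T) * gram z $ l $ k" for n l k z
  define f where "f n l k z = (1 / (2 * real n)) * \<bar>S n l k z\<bar> + 1 / 2 * \<bar>Q n l k z\<bar>" for n l k z
  define c where "c n = (1 / (2 * real n)) * (C * sqrt (real n)) + 1 / 2 * (K * sqrt (step T n))" for n
  have gm: "(\<lambda>z. gram z $ l $ k) \<in> borel_measurable M" for l k
  proof -
    have "(\<lambda>A :: real^'p^'p. A $ l $ k) \<in> borel_measurable borel"
      by (intro borel_measurable_continuous_onI continuous_intros)
    from measurable_compose[OF gram_measurable this] show ?thesis .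
  qed
  have Sm: "S n l k \<in> borel_measurable M" and Qm: "Q n l k \<in> borel_measurable M" if n: "n \<ge> 1" for n l k
    unfolding S_def Q_def using X_component_measurable[OF n] excess_measurable[OF n] gm
    by (auto intro!: borel_measurable_sum borel_measurable_times borel_measurable_diff)
  have fm: "f n l k \<in> borel_measurable M" if n: "n \<ge> 1" for n l k
    unfolding f_def using Sm[OF n] Qm[OF n] by measurable
  have xk_clamp: "(\<lambda>p. X (max 0 (min T (fst p))) (snd p) $ l * X (max 0 (min T (fst p))) (snd p) $ k) \<in> borel_measurable (borel \<Otimes>\<^sub>M M)" for l k
  proof -
    have "(\<lambda>x :: real^'p. x $ l * x $ k) \<in> borel_measurable borel"
      by (intro borel_measurable_continuous_onI continuous_intros)
    from measurable_compose[OF X_clamp this] show ?thesis .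
  qed
  have Qle: "mean M (\<lambda>z. \<bar>Q n l k z\<bar>) \<le> ennreal (K * sqrt (step T n))" if n: "n \<ge> 1" for n l k
  proof -
    have "mean M (\<lambda>z. \<bar>Q n l k z\<bar>) = mean M (\<lambda>z. \<bar>(1 / real n) * (\<Sum>i<n. Xn n i z $ l * Xn n i z $ k)
        - (1 / T) * (LINT u:{0..T}|lborel. X u z $ l * X u z $ k)\<bar>)"
      by (intro nn_integral_cong) (simp add: Q_def gram_component)
    also have "\<dots> \<le> ennreal (K * sqrt (step T n))"
    proof (rule riemann_sum_bound[OF xk_clamp _ K(1) K(2) n])
      show "\<bar>X u z $ l * X u z $ k\<bar> \<le> B * B" if "0 \<le> u" "u \<le> T" "z \<in> space M" for u z
        using comp[OF that] B(1) by (simp add: abs_mult mult_mono)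
    qed
    finally show ?thesis .
  qed
  have f_le: "mean M (\<lambda>z. \<bar>f n l k z\<bar>) \<le> ennreal (c n)" if n: "n \<ge> 1" for n l k
  proof -
    have "mean M (\<lambda>z. \<bar>S n l k z\<bar>) \<le> ennreal (C * sqrt (real n))"
      unfolding S_def by (rule C(2)[OF n])
    then have "mean M (\<lambda>z. f n l k z) \<le> ennreal (c n)"
      unfolding f_def c_def using Sm[OF n] Qm[OF n] C(1) K(1) Qle[OF n] step_pos[OF n]
      by (intro mean_combination_le borel_measurable_abs) auto
    then show ?thesis by (simp add: f_def)
  qed
  show ?thesis
    unfolding converges_in_prob_def
  proof (rule vanishes_in_probI_mean)
    fix n :: nat assume n: "n \<ge> 1"
    show "(\<lambda>z. ennreal (\<Sum>l\<in>UNIV. \<Sum>k\<in>UNIV. f n l k z)) \<in> borel_measurable M"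
      using fm[OF n] by (intro measurable_compose[OF _ measurable_ennreal] borel_measurable_sum) auto
    have "mean M (\<lambda>z. \<bar>\<Sum>p\<in>UNIV. f n (fst p) (snd p) z\<bar>) \<le> ennreal (real (card (UNIV :: ('p \<times> 'p) set)) * c n)"
      using fm[OF n] f_le[OF n] C(1) K(1) step_pos[OF n] by (intro mean_abs_sum_le) (auto simp: c_def)
    moreover have "(\<Sum>p\<in>UNIV. f n (fst p) (snd p) z) = (\<Sum>l\<in>UNIV. \<Sum>k\<in>UNIV. f n l k z)" for z
      by (simp add: sum.cartesian_product UNIV_Times_UNIV split_beta')
    moreover have "0 \<le> (\<Sum>l\<in>UNIV. \<Sum>k\<in>UNIV. f n l k z)" for z
      by (intro sum_nonneg) (simp add: f_def)
    ultimately show "mean M (\<lambda>z. \<Sum>l\<in>UNIV. \<Sum>k\<in>UNIV. f n l k z) \<le> ennreal (real (card (UNIV :: ('p \<times> 'p) set)) * c n)"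
      by simp
    fix z assume z: "z \<in> space M"
    define A where "A = - (rate_matrix n ** hessian (Hn n z) \<theta>0 ** rate_matrix n) - information z"
    have "\<bar>A $ l $ k\<bar> \<le> f n l k z" for l k
    proof -
      have "A $ l $ k = (1 / (2 * real n)) * S n l k z + 1 / 2 * Q n l k z"
        by (simp add: A_def rate_matrix_conjugate hessian_quasi_loglik_excess information_def S_def Q_def
            distrib_left sum.distrib algebra_simps)
      then show ?thesis
        using abs_triangle_ineq[of "(1 / (2 * real n)) * S n l k z" "1 / 2 * Q n l k z"]
        by (simp add: f_def abs_mult)
    qed
    then have "norm A \<le> (\<Sum>l\<in>UNIV. \<Sum>k\<in>UNIV. f n l k z)"
      by (intro order_trans[OF norm_matrix_le_sum] sum_mono)
    then show "ennreal (norm (- (rate_matrix n ** hessian (Hn n z) \<theta>0 ** rate_matrix n) - information z))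
        \<le> ennreal (\<Sum>l\<in>UNIV. \<Sum>k\<in>UNIV. f n l k z)"
      unfolding A_def by (rule ennreal_leI)
  next
    have "c \<longlonglongrightarrow> 0" unfolding c_def step_def using T by real_asymp
    then show "(\<lambda>n. real (card (UNIV :: ('p \<times> 'p) set)) * c n) \<longlonglongrightarrow> 0"
      by (intro tendsto_mult_right_zero)
  qed
qed

end

section \<open>Gaussian tails\<close>

lemma nn_integral_gaussian_finite:
  fixes a :: real
  assumes a: "a > 0"
  shows "(\<integral>\<^sup>+u. ennreal (exp (- (a * (norm u)^2))) \<partial>(lborel :: 'e::euclidean_space measure)) < \<infinity>"
proof -
  \<comment> \<open>The standard deviation for which the centred normal density is proportional to
    exp (- (a * x^2)).\<close>
  define s where "s = 1 / sqrt (2 * a)"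
  have s: "s > 0" "2 * s^2 = 1 / a" using a by (auto simp: s_def power_divide)
  have "integrable lborel (\<lambda>x. normal_density 0 s x)"
    using normal_moment_even[OF s(1), of 0 0] by (simp add: has_bochner_integral_iff)
  then have "integrable lborel (\<lambda>x. sqrt (2 * pi * s^2) * normal_density 0 s x)" by simp
  moreover have "sqrt (2 * pi * s^2) * normal_density 0 s x = exp (- (a * x^2))" for x
    using s a unfolding normal_density_def by (simp add: real_sqrt_mult s(2) mult.commute)
  ultimately have "integrable lborel (\<lambda>x::real. exp (- (a * x^2)))" by simp
  then have fin: "(\<integral>\<^sup>+x. ennreal (exp (- (a * x^2))) \<partial>(lborel :: real measure)) < \<infinity>"
    by (simp add: integrable_iff_bounded)
  have "(\<integral>\<^sup>+u. ennreal (exp (- (a * (norm u)^2))) \<partial>(lborel :: 'e measure)) =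
      (\<integral>\<^sup>+u. (\<Prod>i\<in>Basis. ennreal (exp (- (a * (u \<bullet> i)^2)))) \<partial>(lborel :: 'e measure))"
  proof (intro nn_integral_cong)
    fix u :: 'e
    have "(norm u)^2 = (\<Sum>i\<in>Basis. (u \<bullet> i)^2)"
      unfolding power2_norm_eq_inner euclidean_inner[of u u] by (simp add: power2_eq_square)
    then have "exp (- (a * (norm u)^2)) = (\<Prod>i\<in>Basis. exp (- (a * (u \<bullet> i)^2)))"
      by (simp add: sum_distrib_left sum_negf[symmetric] exp_sum)
    then show "ennreal (exp (- (a * (norm u)^2))) = (\<Prod>i\<in>Basis. ennreal (exp (- (a * (u \<bullet> i)^2))))"
      by (simp add: prod_ennreal)
  qed
  also have "\<dots> = (\<Prod>i\<in>(Basis :: 'e set). \<integral>\<^sup>+x. ennreal (exp (- (a * x^2))) \<partial>lborel)"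
    by (rule nn_integral_lborel_prod) auto
  also have "\<dots> < \<infinity>"
  proof -
    obtain g where "g \<ge> 0" "(\<integral>\<^sup>+x. ennreal (exp (- (a * x^2))) \<partial>(lborel :: real measure)) = ennreal g"
      using fin less_top_ennreal by auto
    then show ?thesis by (simp add: ennreal_power)
  qed
  finally show ?thesis .
qed

text \<open>Far out, the quadratic term beats the linear one and still leaves both decay in
  \<open>K\<close> and integrability.\<close>

lemma gaussian_tail:
  fixes a \<kappa> \<epsilon> :: real
  assumes a: "a > 0" and \<kappa>: "\<kappa> > 0" and e: "\<epsilon> > 0"
  obtains K where "K > 0"
    "(\<integral>\<^sup>+u\<in>{u. norm u \<ge> K}. ennreal (exp (\<kappa> * norm u - a * (norm u)^2)) \<partial>(lborel :: 'e::euclidean_space measure)) \<le> ennreal \<epsilon>"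
proof -
  obtain g where g: "g \<ge> 0" "(\<integral>\<^sup>+u. ennreal (exp (- ((a/2) * (norm u)^2))) \<partial>(lborel :: 'e measure)) = ennreal g"
    using nn_integral_gaussian_finite[of "a/2", where 'e = 'e] a less_top_ennreal by fastforce
  have "((\<lambda>K. exp (- (a / 4 * K^2)) * g) \<longlongrightarrow> 0) at_top" using a by real_asymp
  then have "eventually (\<lambda>K. exp (- (a / 4 * K^2)) * g < \<epsilon>) at_top"
    using e by (rule order_tendstoD)
  then have "eventually (\<lambda>K. exp (- (a / 4 * K^2)) * g < \<epsilon> \<and> K > 4 * \<kappa> / a) at_top"
    by (intro eventually_conj eventually_gt_at_top)
  then obtain K where K: "exp (- (a / 4 * K^2)) * g < \<epsilon>" "K > 4 * \<kappa> / a"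
    using eventually_happens trivial_limit_at_top_linorder by blast
  have K0: "K > 0" using K(2) a \<kappa> by (meson divide_pos_pos less_trans mult_pos_pos zero_less_numeral)
  show ?thesis
  proof (rule that[OF K0])
    have "(\<integral>\<^sup>+u\<in>{u. norm u \<ge> K}. ennreal (exp (\<kappa> * norm u - a * (norm u)^2)) \<partial>(lborel :: 'e measure)) \<le>
        (\<integral>\<^sup>+u. ennreal (exp (- (a / 4 * K^2))) * ennreal (exp (- ((a/2) * (norm u)^2))) \<partial>(lborel :: 'e measure))"
    proof (rule nn_integral_mono)
      fix u :: 'e
      show "ennreal (exp (\<kappa> * norm u - a * (norm u)^2)) * indicator {u. norm u \<ge> K} u \<le>
          ennreal (exp (- (a / 4 * K^2))) * ennreal (exp (- ((a/2) * (norm u)^2)))"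
      proof (cases "norm u \<ge> K")
        case True
        have "4 * \<kappa> / a \<le> norm u" using True K(2) by linarith
        then have "4 * \<kappa> \<le> a * norm u" using a by (simp add: divide_le_eq mult.commute)
        then have "4 * \<kappa> * norm u \<le> a * norm u * norm u" by (rule mult_right_mono) simp
        moreover have "K^2 \<le> (norm u)^2" using True K0 by (intro power_mono) auto
        then have "a * K^2 \<le> a * (norm u)^2" using a by (intro mult_left_mono) auto
        \<comment> \<open>Split a as a/4 + a/4 + a/2: the first quarter absorbs the linear term
          since K exceeds 4 * \<kappa> / a, the second gives the factor that is small in
          \<open>K\<close>, and the half remains integrable.\<close>
        ultimately have "\<kappa> * norm u - a * (norm u)^2 \<le> - (a / 4 * K^2) + - ((a/2) * (norm u)^2)"
          by (simp add: power2_eq_square field_simps)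
        then have "exp (\<kappa> * norm u - a * (norm u)^2) \<le> exp (- (a / 4 * K^2)) * exp (- ((a/2) * (norm u)^2))"
          unfolding exp_add[symmetric] by (simp only: exp_le_cancel_iff)
        then show ?thesis using True by (simp add: ennreal_mult'[symmetric] ennreal_leI)
      qed simp
    qed
    also have "\<dots> = ennreal (exp (- (a / 4 * K^2))) * ennreal g"
      unfolding g(2)[symmetric] by (intro nn_integral_cmult) measurable
    also have "\<dots> = ennreal (exp (- (a / 4 * K^2)) * g)" using g(1) by (simp add: ennreal_mult)
    also have "\<dots> \<le> ennreal \<epsilon>" using K(1) by (intro ennreal_leI) simp
    finally show "(\<integral>\<^sup>+u\<in>{u. norm u \<ge> K}. ennreal (exp (\<kappa> * norm u - a * (norm u)^2)) \<partial>(lborel :: 'e measure)) \<le> ennreal \<epsilon>" .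
  qed
qed

section \<open>Conditions (A1) and (A3), consistency\<close>

lemma uminus_matrix_vector: "(- A) *v x = - (A *v (x :: real^'p))" for A :: "real^'p^'q::finite"
  by (simp add: vec_eq_iff matrix_vector_mult_def sum_negf)

section \<open>Nondegeneracy of the limit information\<close>

context volatility_regression
begin

lemma gram_symmetric: "z \<in> space M \<Longrightarrow> transpose (gram z) = gram z"
  by (simp add: vec_eq_iff transpose_def gram_component mult.commute)

lemma gram_quadratic_form:
  "z \<in> space M \<Longrightarrow> min_eigenvalue (gram z) * (norm x)^2 \<le> 2 * T * (x \<bullet> (information z *v x))"
  using min_eigenvalue_symmetric(2)[OF gram_symmetric, of z x] T
  by (simp add: information_def scaleR_matrix_vector_assoc[symmetric])

definition degenerate :: "real \<Rightarrow> 'a set" where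
  "degenerate r = {z \<in> space M. min_eigenvalue (gram z) \<le> 1 / r}"

lemma degenerate_sets: "degenerate r \<in> sets M"
proof -
  have [measurable]: "(\<lambda>z. min_eigenvalue (gram z)) \<in> borel_measurable M"
    by (rule borel_measurable_min_eigenvalue[OF gram_measurable gram_symmetric])
  show ?thesis unfolding degenerate_def by measurable
qed

lemma degenerate_tail:
  obtains C where "C > 0" "\<And>r. r > 0 \<Longrightarrow> emeasure M (degenerate r) \<le> ennreal (C / r)"
proof -
  have "(0::real) < 1" by simp
  then obtain C where C: "C > 0" "\<And>r. r > 0 \<Longrightarrow> measure M (degenerate r) \<le> C / r powr 1"
    using V2 unfolding cond_V2_def gram_def degenerate_def by blast
  then have "emeasure M (degenerate r) \<le> ennreal (C / r)" if "r > 0" for r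
    using C(2)[OF that] that by (simp add: emeasure_eq_measure ennreal_leI)
  then show ?thesis using C(1) by (rule that[rotated])
qed

lemma information_positive_definite: "AE z in M. positive_definite (information z)"
proof -
  obtain C where C: "C > 0" and tail: "\<And>r. r > 0 \<Longrightarrow> emeasure M (degenerate r) \<le> ennreal (C / r)"
    by (rule degenerate_tail) blast
  \<comment> \<open>As 1 / 0 = 0, this is the event that the smallest eigenvalue is not
    positive.\<close>
  define N where "N = degenerate 0"
  have small: "emeasure M N \<le> 0 + ennreal e" if e: "e > 0" for e
  proof -
    \<comment> \<open>The level at which the tail bound equals \<open>e\<close>; \<open>N\<close> is
      contained in \<open>degenerate r\<close> for every positive \<open>r\<close>.\<close>
    have r: "C / e > 0" using C e by simp
    have "1 / (C / e) \<ge> 0" using C e by (simp add: zero_le_divide_iff)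
    then have "emeasure M N \<le> emeasure M (degenerate (C / e))"
      by (intro emeasure_mono degenerate_sets) (auto simp: N_def degenerate_def)
    also have "\<dots> \<le> ennreal (C / (C / e))" by (rule tail[OF r])
    finally show ?thesis using C e by simp
  qed
  have "emeasure M N \<le> 0" by (rule ennreal_le_epsilon) (rule small)
  then have "emeasure M N = 0" by simp
  show ?thesis
  proof (rule AE_I)
    show "N \<in> sets M" unfolding N_def by (rule degenerate_sets)
    show "emeasure M N = 0" by fact
    show "{z \<in> space M. \<not> positive_definite (information z)} \<subseteq> N"
    proof (rule subsetI, rule ccontr)
      fix z assume "z \<in> {z \<in> space M. \<not> positive_definite (information z)}" and nN: "z \<notin> N"
      then have z: "z \<in> space M" and npd: "\<not> positive_definite (information z)" by auto
      have pos: "min_eigenvalue (gram z) > 0" using nN z by (auto simp: N_def degenerate_def)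
      have "x \<bullet> (information z *v x) > 0" if "x \<noteq> 0" for x
      proof -
        have "0 < min_eigenvalue (gram z) * (norm x)^2" using pos that by simp
        also have "\<dots> \<le> 2 * T * (x \<bullet> (information z *v x))" by (rule gram_quadratic_form[OF z])
        finally show ?thesis using T by (simp add: zero_less_mult_iff)
      qed
      moreover have "transpose (information z) = information z"
        using gram_symmetric[OF z] by (simp add: information_def transpose_def vec_eq_iff)
      ultimately show False using npd by (simp add: positive_definite_def)
    qed
  qed
qed

theorem cond_A1_quasi_loglik:
  assumes "bounded \<Theta>"
  shows "cond_A1 M \<Theta> \<theta>0 Hn"
  unfolding cond_A1_def
proof (intro conjI)
  show "\<forall>n\<ge>1. \<forall>z\<in>space M. Ck_on 3 (Hn n z) \<Theta>"
    unfolding quasi_loglik_affine_exp_sum by (intro allI impI ballI Ck_on_affine_exp_sum)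
  show "\<exists>\<Gamma>\<in>borel_measurable M. (AE z in M. positive_definite (\<Gamma> z)) \<and>
      converges_in_prob M (\<lambda>n z. - (rate_matrix n ** hessian (Hn n z) \<theta>0 ** rate_matrix n)) \<Gamma>"
    using information_measurable information_positive_definite observed_information_converges by blast
qed (use score_bounded_in_prob third_derivatives_vanish[OF assms] in auto)

section \<open>One event that controls all parameters: (A3) and consistency\<close>

definition score :: "nat \<Rightarrow> 'a \<Rightarrow> real^'p" where
  "score n z = rate_matrix n *v grad (Hn n z) \<theta>0"

definition obs_info :: "nat \<Rightarrow> 'a \<Rightarrow> real^'p^'p" where
  "obs_info n z = - (rate_matrix n ** hessian (Hn n z) \<theta>0 ** rate_matrix n)"

text \<open>The event on which the log-likelihood ratio obeys one Gaussian bound for all local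
  parameters simultaneously. It isolates the probabilistic input; what follows on it is
  deterministic.\<close>

definition regular :: "real \<Rightarrow> real \<Rightarrow> nat \<Rightarrow> 'a \<Rightarrow> bool" where
  "regular \<kappa> \<delta> n z \<longleftrightarrow> norm (score n z) \<le> \<kappa> \<and> (\<forall>v. \<delta> * (norm v)^2 \<le> v \<bullet> (obs_info n z *v v))"

abbreviation irregular :: "real \<Rightarrow> real \<Rightarrow> nat \<Rightarrow> 'a set" where
  "irregular \<kappa> \<delta> n \<equiv> {z \<in> space M. \<not> regular \<kappa> \<delta> n z}"

text \<open>Failure of regularity forces a large score, an observed information far from its limit,
  or a nearly degenerate limit. The three events get probability \<open>\<epsilon> / 4\<close> each,
  which leaves room for the strict inequality.\<close>

lemma regular_whp:
  assumes e: "\<epsilon> > 0"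
  obtains \<kappa> \<delta> N where "\<kappa> > 0" "\<delta> > 0" "N \<ge> 1"
    "\<And>n. n \<ge> N \<Longrightarrow> outer_measure_of M (irregular \<kappa> \<delta> n) < ennreal \<epsilon>"
proof -
  obtain C where C: "C > 0" and tail: "\<And>r. r > 0 \<Longrightarrow> emeasure M (degenerate r) \<le> ennreal (C / r)"
    by (rule degenerate_tail) blast
  define r where "r = 4 * C / \<epsilon>"
  \<comment> \<open>Outside \<open>degenerate r\<close> the limit information is at least 1 / (2 * T
    * r) = 2 * \<delta> as a quadratic form; a deviation of norm at most \<delta> leaves
    \<delta>.\<close>
  define \<delta> where "\<delta> = 1 / (4 * T * r)"
  have r: "r > 0" "C / r = \<epsilon> / 4" using C e by (auto simp: r_def)
  have \<delta>: "\<delta> > 0" using r T by (simp add: \<delta>_def)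
  have e4: "\<epsilon> / 4 > 0" using e by simp
  then obtain K where "\<forall>\<^sub>F n in sequentially. outer_measure_of M {z \<in> space M. norm (score n z) > K} < ennreal (\<epsilon> / 4)"
    using score_bounded_in_prob unfolding bounded_in_prob_def score_def by blast
  then obtain N1 where N1: "\<And>n. n \<ge> N1 \<Longrightarrow> outer_measure_of M {z \<in> space M. norm (score n z) > K} < ennreal (\<epsilon> / 4)"
    unfolding eventually_at_top_linorder by blast
  let ?D = "\<lambda>n. {z \<in> space M. ennreal (norm (obs_info n z - information z)) > ennreal \<delta>}"
  have "(\<lambda>n. outer_measure_of M (?D n)) \<longlonglongrightarrow> 0"
    using observed_information_converges \<delta>
    unfolding converges_in_prob_def vanishes_in_prob_def obs_info_def by blast
  then have "\<forall>\<^sub>F n in sequentially. outer_measure_of M (?D n) < ennreal (\<epsilon> / 4)"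
    using e4 by (intro order_tendstoD(2)) auto
  then obtain N2 where N2: "\<And>n. n \<ge> N2 \<Longrightarrow> outer_measure_of M (?D n) < ennreal (\<epsilon> / 4)"
    unfolding eventually_at_top_linorder by blast
  show ?thesis
  \<comment> \<open>The tightness bound \<open>K\<close> may fail to be positive, hence the maximum
    with 1.\<close>
  proof (rule that[of "max K 1" \<delta> "max 1 (max N1 N2)"])
    fix n assume n: "max 1 (max N1 N2) \<le> n"
    define A1 where "A1 = {z \<in> space M. norm (score n z) > K}"
    define A2 where "A2 = ?D n"
    define A3 where "A3 = degenerate r"
    have sub: "{z \<in> space M. \<not> regular (max K 1) \<delta> n z} \<subseteq> A1 \<union> (A2 \<union> A3)"
    proof (rule subsetI, rule ccontr)
      fix z assume "z \<in> {z \<in> space M. \<not> regular (max K 1) \<delta> n z}" and n: "z \<notin> A1 \<union> (A2 \<union> A3)"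
      then have z: "z \<in> space M" and nreg: "\<not> regular (max K 1) \<delta> n z" by auto
      have 1: "norm (score n z) \<le> K" using n z by (auto simp: A1_def)
      have 2: "norm (obs_info n z - information z) \<le> \<delta>"
        using n z \<delta> by (auto simp: A2_def not_less)
      have 3: "1 / r < min_eigenvalue (gram z)" using n z by (auto simp: A3_def degenerate_def)
      have "\<delta> * (norm v)^2 \<le> v \<bullet> (obs_info n z *v v)" for v
      proof -
        have "(1 / r) * (norm v)^2 \<le> min_eigenvalue (gram z) * (norm v)^2"
          using 3 by (intro mult_right_mono) auto
        also have "\<dots> \<le> 2 * T * (v \<bullet> (information z *v v))" by (rule gram_quadratic_form[OF z])
        finally have i: "2 * \<delta> * (norm v)^2 \<le> v \<bullet> (information z *v v)"
          using T r by (simp add: \<delta>_def field_simps)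
        have "\<bar>v \<bullet> ((obs_info n z - information z) *v v)\<bar> \<le>
            norm (obs_info n z - information z) * (norm v)^2"
          by (rule abs_quadratic_form_le)
        also have "\<dots> \<le> \<delta> * (norm v)^2" using 2 by (intro mult_right_mono) auto
        finally have "- (\<delta> * (norm v)^2) \<le> v \<bullet> (obs_info n z *v v) - v \<bullet> (information z *v v)"
          by (simp add: matrix_vector_mult_diff_rdistrib inner_diff_right abs_le_iff)
        with i show ?thesis by simp
      qed
      then show False using nreg 1 by (simp add: regular_def)
    qed
    have "outer_measure_of M {z \<in> space M. \<not> regular (max K 1) \<delta> n z} \<le> outer_measure_of M (A1 \<union> (A2 \<union> A3))"
      by (rule outer_measure_of_mono[OF sub])
    also have "\<dots> \<le> outer_measure_of M A1 + outer_measure_of M (A2 \<union> A3)"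
      by (rule outer_measure_of_Un_le) (auto simp: A1_def A2_def A3_def degenerate_def)
    also have "\<dots> \<le> outer_measure_of M A1 + (outer_measure_of M A2 + outer_measure_of M A3)"
      by (intro add_left_mono outer_measure_of_Un_le) (auto simp: A2_def A3_def degenerate_def)
    also have "\<dots> \<le> ennreal (\<epsilon> / 4) + (ennreal (\<epsilon> / 4) + ennreal (\<epsilon> / 4))"
    proof (intro add_mono)
      show "outer_measure_of M A1 \<le> ennreal (\<epsilon> / 4)" using N1[of n] n by (simp add: A1_def less_imp_le)
      show "outer_measure_of M A2 \<le> ennreal (\<epsilon> / 4)" using N2[of n] n by (simp add: A2_def less_imp_le)
      show "outer_measure_of M A3 \<le> ennreal (\<epsilon> / 4)"
        using tail[OF r(1)] degenerate_sets[of r] r(2) by (simp add: A3_def)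
    qed
    also have "\<dots> = ennreal (\<epsilon> / 4 + (\<epsilon> / 4 + \<epsilon> / 4))" using e by (simp only: ennreal_plus)
    also have "\<dots> < ennreal \<epsilon>" using e by (intro ennreal_lessI) auto
    finally show "outer_measure_of M {z \<in> space M. \<not> regular (max K 1) \<delta> n z} < ennreal \<epsilon>" .
  qed (use \<delta> in auto)
qed

text \<open>The constant \<open>c\<close> is exp (- D) / 2, with \<open>D\<close> bounding all
  exponents over the given set; it depends on neither n, the path, nor the levels of regularity. The
  lemma is applied to the parameter set for (A3) and to its closure for the maximizer.\<close>

lemma quasi_loglik_regular_bound:
  assumes \<Theta>: "bounded \<Theta>"
  obtains c where "c > 0" "\<And>\<kappa> \<delta> n z u. n \<ge> 1 \<Longrightarrow> z \<in> space M \<Longrightarrow> regular \<kappa> \<delta> n z \<Longrightarrow>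
      \<theta>0 + rate_matrix n *v u \<in> \<Theta> \<Longrightarrow>
      Hn n z (\<theta>0 + rate_matrix n *v u) - Hn n z \<theta>0 \<le>
        \<kappa> * norm u - c * \<delta> * (norm u)^2"
proof -
  obtain R where R: "\<And>\<theta>. \<theta> \<in> \<Theta> \<Longrightarrow> norm \<theta> \<le> R" using \<Theta> unfolding bounded_iff by blast
  define D where "D = B * (R + norm \<theta>0)"
  show ?thesis
  proof (rule that[of "exp (- D) / 2"])
    fix \<kappa> \<delta> :: real and n :: nat and z and u :: "real^'p"
    assume n: "n \<ge> 1" and z: "z \<in> space M" and reg: "regular \<kappa> \<delta> n z" and \<theta>: "\<theta>0 + rate_matrix n *v u \<in> \<Theta>"
    define H where "H = Hn n z"
    define \<theta>u where "\<theta>u = \<theta>0 + rate_matrix n *v u"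
    have d: "\<theta>u - \<theta>0 = (1 / sqrt (real n)) *\<^sub>R u" by (simp add: \<theta>u_def rate_matrix_mult_vec)
    have "H \<theta>u - H \<theta>0 \<le> (\<theta>u - \<theta>0) \<bullet> grad H \<theta>0 - exp (- D) / 2 * ((\<theta>u - \<theta>0) \<bullet> (- hessian H \<theta>0 *v (\<theta>u - \<theta>0)))"
      unfolding H_def
    proof (rule quasi_loglik_quadratic_bound)
      fix j assume j: "j \<in> {1..n}"
      have "\<bar>obs T X n j z \<bullet> (\<theta>u - \<theta>0)\<bar> \<le> norm (obs T X n j z) * norm (\<theta>u - \<theta>0)" by (rule Cauchy_Schwarz_ineq2)
      also have "\<dots> \<le> B * (R + norm \<theta>0)"
      proof (rule mult_mono)
        show "norm (obs T X n j z) \<le> B"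
          unfolding obs_def using obs_time_range[OF n, of "j - 1"] j z by (intro B(2)) auto
        show "norm (\<theta>u - \<theta>0) \<le> R + norm \<theta>0"
          using norm_triangle_ineq4[of \<theta>u \<theta>0] R[OF \<theta>] by (simp add: \<theta>u_def)
      qed (use B in auto)
      finally show "\<bar>obs T X n j z \<bullet> (\<theta>u - \<theta>0)\<bar> \<le> D" by (simp add: D_def)
    qed (use T in simp)
    also have "(\<theta>u - \<theta>0) \<bullet> grad H \<theta>0 = u \<bullet> score n z"
      by (simp add: d score_def rate_matrix_mult_vec H_def)
    also have "(\<theta>u - \<theta>0) \<bullet> (- hessian H \<theta>0 *v (\<theta>u - \<theta>0)) = u \<bullet> (obs_info n z *v u)"
      using n by (simp add: d obs_info_def rate_matrix_conjugate uminus_matrix_vector H_def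
          matrix_vector_mult_scaleR scaleR_matrix_vector_assoc[symmetric])
    also have "u \<bullet> score n z - exp (- D) / 2 * (u \<bullet> (obs_info n z *v u)) \<le> \<kappa> * norm u - exp (- D) / 2 * (\<delta> * (norm u)^2)"
    proof (rule diff_mono)
      have "u \<bullet> score n z \<le> norm u * norm (score n z)" by (rule norm_cauchy_schwarz)
      also have "\<dots> \<le> norm u * \<kappa>" using reg by (intro mult_left_mono) (auto simp: regular_def)
      finally show "u \<bullet> score n z \<le> \<kappa> * norm u" by (simp add: mult.commute)
      show "exp (- D) / 2 * (\<delta> * (norm u)^2) \<le> exp (- D) / 2 * (u \<bullet> (obs_info n z *v u))"
        using reg by (intro mult_left_mono) (auto simp: regular_def)
    qed
    finally show "Hn n z (\<theta>0 + rate_matrix n *v u) - Hn n z \<theta>0 \<le>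
        \<kappa> * norm u - exp (- D) / 2 * \<delta> * (norm u)^2"
      by (simp add: H_def \<theta>u_def mult.assoc)
  qed simp
qed

text \<open>On a regular path the tail integral is dominated by a deterministic Gaussian tail, at
  most \<open>\<epsilon>\<close> for a suitable radius. Hence a large integral can occur only on an
  irregular path.\<close>

theorem cond_A3_quasi_loglik:
  assumes \<Theta>: "bounded \<Theta>"
  shows "cond_A3 M \<Theta> \<theta>0 Hn"
  unfolding cond_A3_def
proof (intro allI impI)
  fix \<epsilon> :: real assume e: "\<epsilon> > 0"
  obtain c where c: "c > 0" and bound: "\<And>\<kappa> \<delta> n z u. n \<ge> 1 \<Longrightarrow> z \<in> space M \<Longrightarrow> regular \<kappa> \<delta> n z \<Longrightarrow>
      \<theta>0 + rate_matrix n *v u \<in> \<Theta> \<Longrightarrow>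
      Hn n z (\<theta>0 + rate_matrix n *v u) - Hn n z \<theta>0 \<le>
        \<kappa> * norm u - c * \<delta> * (norm u)^2"
    using \<Theta> by (rule quasi_loglik_regular_bound) blast
  \<comment> \<open>Half of \<open>\<epsilon>\<close>, because strictness may be lost in the
    supremum over n.\<close>
  have e2: "\<epsilon> / 2 > 0" using e by simp
  then obtain \<kappa> \<delta> N where N: "\<kappa> > 0" "\<delta> > 0" "N \<ge> 1"
    "\<And>n. n \<ge> N \<Longrightarrow> outer_measure_of M (irregular \<kappa> \<delta> n) < ennreal (\<epsilon> / 2)"
    by (rule regular_whp) blast
  have cd: "c * \<delta> > 0" using c N(2) by simp
  obtain K where K: "K > 0" "(\<integral>\<^sup>+u\<in>{u. norm u \<ge> K}. ennreal (exp (\<kappa> * norm u - c * \<delta> * (norm u)^2)) \<partial>(lborel :: (real^'p) measure)) \<le> ennreal \<epsilon>"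
    using cd N(1) e by (rule gaussian_tail) blast
  let ?I = "\<lambda>n z. \<integral>\<^sup>+u\<in>local_params \<Theta> \<theta>0 n \<inter> {u. norm u \<ge> K}.
      ennreal (lik_ratio \<theta>0 Hn n z u) \<partial>lborel"
  have sub: "{z \<in> space M. ?I n z > ennreal \<epsilon>} \<subseteq> irregular \<kappa> \<delta> n" if n: "n \<ge> N" for n
  proof (rule subsetI, rule ccontr)
    fix z assume *: "z \<in> {z \<in> space M. ?I n z > ennreal \<epsilon>}"
      and "z \<notin> irregular \<kappa> \<delta> n"
    then have z: "z \<in> space M" "regular \<kappa> \<delta> n z" by auto
    have "?I n z \<le>
        (\<integral>\<^sup>+u\<in>{u. norm u \<ge> K}. ennreal (exp (\<kappa> * norm u - c * \<delta> * (norm u)^2)) \<partial>(lborel :: (real^'p) measure))"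
    proof (rule nn_integral_mono)
      fix u :: "real^'p"
      show "ennreal (lik_ratio \<theta>0 Hn n z u) * indicator (local_params \<Theta> \<theta>0 n \<inter> {u. norm u \<ge> K}) u
          \<le> ennreal (exp (\<kappa> * norm u - c * \<delta> * (norm u)^2)) * indicator {u. norm u \<ge> K} u"
        using bound[of n z \<kappa> \<delta> u] n N(3) z
        by (auto simp: lik_ratio_def local_params_def split: split_indicator intro!: ennreal_leI)
    qed
    also have "\<dots> \<le> ennreal \<epsilon>" by (rule K(2))
    finally show False using * leD by blast
  qed
  have "(SUP n\<in>{N..}. outer_measure_of M {z \<in> space M. ?I n z > ennreal \<epsilon>}) \<le> ennreal (\<epsilon> / 2)"
  proof (rule SUP_least)
    fix n assume "n \<in> {N..}"
    then have n: "n \<ge> N" by simp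
    show "outer_measure_of M {z \<in> space M. ?I n z > ennreal \<epsilon>} \<le> ennreal (\<epsilon> / 2)"
      using outer_measure_of_mono[OF sub[OF n], of M] N(4)[OF n] by (meson le_less_trans less_imp_le)
  qed
  also have "\<dots> < ennreal \<epsilon>" using e by (intro ennreal_lessI) auto
  finally show "\<exists>K>0. \<exists>N. (SUP n\<in>{N..}. outer_measure_of M {z \<in> space M.
      (\<integral>\<^sup>+u\<in>local_params \<Theta> \<theta>0 n \<inter> {u. norm u \<ge> K}. ennreal (lik_ratio \<theta>0 Hn n z u) \<partial>lborel) > ennreal \<epsilon>}) < ennreal \<epsilon>"
    using K(1) by blast
qed

text \<open>The log-likelihood ratio is nonnegative at a maximizer, since \<open>\<theta>0\<close>
  is a competitor. On a regular path the quadratic upper bound then confines its local coordinate to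
  a ball whose radius does not depend on n.\<close>

theorem estimator_consistent:
  assumes \<Theta>: "bounded \<Theta>" "\<theta>0 \<in> \<Theta>"
    and max: "\<And>n z. n \<ge> 1 \<Longrightarrow> z \<in> space M \<Longrightarrow>
      is_arg_max (Hn n z) (\<lambda>\<theta>. \<theta> \<in> closure \<Theta>) (\<theta>h n z)"
  shows "converges_in_prob M \<theta>h (\<lambda>_. \<theta>0)"
  unfolding converges_in_prob_def vanishes_in_prob_def
proof (intro allI impI)
  fix \<epsilon> :: real assume e: "\<epsilon> > 0"
  have "bounded (closure \<Theta>)" using \<Theta>(1) by (rule bounded_closure)
  then obtain c where c: "c > 0" and bound: "\<And>\<kappa> \<delta> n z u. n \<ge> 1 \<Longrightarrow> z \<in> space M \<Longrightarrow> regular \<kappa> \<delta> n z \<Longrightarrow>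
      \<theta>0 + rate_matrix n *v u \<in> closure \<Theta> \<Longrightarrow>
      Hn n z (\<theta>0 + rate_matrix n *v u) - Hn n z \<theta>0 \<le>
        \<kappa> * norm u - c * \<delta> * (norm u)^2"
    by (rule quasi_loglik_regular_bound) blast
  have small: "\<forall>\<^sub>F n in sequentially. outer_measure_of M {z \<in> space M. ennreal \<epsilon> < ennreal (norm (\<theta>h n z - \<theta>0))} < ennreal \<eta>"
    if \<eta>: "\<eta> > 0" for \<eta> :: real
  proof -
    obtain \<kappa> \<delta> N where N: "\<kappa> > 0" "\<delta> > 0" "N \<ge> 1"
      "\<And>n. n \<ge> N \<Longrightarrow> outer_measure_of M (irregular \<kappa> \<delta> n) < ennreal \<eta>"
      using \<eta> by (rule regular_whp) blast
    have cd: "c * \<delta> > 0" using c N(2) by simp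
    have "(\<lambda>n. \<kappa> / (c * \<delta>) / sqrt (real n)) \<longlonglongrightarrow> 0" by real_asymp
    then have "\<forall>\<^sub>F n in sequentially. \<kappa> / (c * \<delta>) / sqrt (real n) < \<epsilon>" using e by (rule order_tendstoD)
    moreover have "\<forall>\<^sub>F n in sequentially. n \<ge> N" by (rule eventually_ge_at_top)
    ultimately show ?thesis
    proof eventually_elim
      case (elim n)
      then have n: "n \<ge> 1" using N(3) by simp
      have "{z \<in> space M. ennreal \<epsilon> < ennreal (norm (\<theta>h n z - \<theta>0))} \<subseteq> irregular \<kappa> \<delta> n"
      proof (rule subsetI, rule ccontr)
        fix z assume *: "z \<in> {z \<in> space M. ennreal \<epsilon> < ennreal (norm (\<theta>h n z - \<theta>0))}"
          and "z \<notin> irregular \<kappa> \<delta> n"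
        then have z: "z \<in> space M" "regular \<kappa> \<delta> n z" by auto
        \<comment> \<open>The local coordinate of the maximizer; dividing its bound by sqrt n gives
          the distance to \<open>\<theta>0\<close>.\<close>
        define u where "u = sqrt (real n) *\<^sub>R (\<theta>h n z - \<theta>0)"
        have u: "\<theta>0 + rate_matrix n *v u = \<theta>h n z" using n by (simp add: u_def rate_matrix_mult_vec)
        have "\<theta>h n z \<in> closure \<Theta>" "\<not> Hn n z (\<theta>h n z) < Hn n z \<theta>0"
          using max[OF n z(1)] closure_subset \<Theta>(2) by (auto simp: is_arg_max_def)
        then have "0 \<le> \<kappa> * norm u - c * \<delta> * (norm u)^2"
          using bound[OF n z, of u] unfolding u by simp
        then have "c * \<delta> * norm u * norm u \<le> \<kappa> * norm u" by (simp add: power2_eq_square mult.assoc)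
        then have "c * \<delta> * norm u \<le> \<kappa>" using N(1) by (cases "norm u = 0") auto
        then have "norm u \<le> \<kappa> / (c * \<delta>)" using cd by (simp add: le_divide_eq mult.commute)
        then have "norm u / sqrt (real n) \<le> \<kappa> / (c * \<delta>) / sqrt (real n)" by (rule divide_right_mono) simp
        moreover have "norm u / sqrt (real n) = norm (\<theta>h n z - \<theta>0)" using n by (simp add: u_def)
        ultimately have "norm (\<theta>h n z - \<theta>0) < \<epsilon>" using elim(1) by simp
        then show False using * e by (auto simp: ennreal_less_iff)
      qed
      then show ?case using N(4)[OF elim(2)] by (meson outer_measure_of_mono le_less_trans)
    qed
  qed
  show "(\<lambda>n. outer_measure_of M {z \<in> space M. ennreal \<epsilon> < ennreal (norm (\<theta>h n z - \<theta>0))}) \<longlonglongrightarrow> 0"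
  proof (rule order_tendstoI)
    fix a :: ennreal assume "0 < a"
    \<comment> \<open>The bound \<open>a\<close> is extended real and may be infinite; a positive
      real below it is enough.\<close>
    then obtain \<eta> where \<eta>: "\<eta> > 0" "ennreal \<eta> \<le> a"
    proof (cases a)
      case (real r)
      then show ?thesis using \<open>0 < a\<close> that[of r] by simp
    next
      case top
      then show ?thesis using that[of 1] by simp
    qed
    show "\<forall>\<^sub>F n in sequentially. outer_measure_of M {z \<in> space M. ennreal \<epsilon> < ennreal (norm (\<theta>h n z - \<theta>0))} < a"
      using small[OF \<eta>(1)] \<eta>(2) by (auto elim: eventually_mono)
  qed simp
qed

end

theorem theorem4p11:
  fixes M :: "'a measure" and T :: real and F :: "real \<Rightarrow> 'a measure"
    and w b Y :: "real \<Rightarrow> 'a \<Rightarrow> real" and X :: "real \<Rightarrow> 'a \<Rightarrow> real^'p::finite"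
    and \<Theta> :: "(real^'p) set" and \<theta>0 :: "real^'p" and \<theta>h :: "nat \<Rightarrow> 'a \<Rightarrow> real^'p"
  assumes "prob_space M" and "T > 0" and "filtration_upto M T F"
    and "wiener_process M T F w"
    and "progressive_upto T F b" and "progressive_upto T F X"
    and "bounded \<Theta>" and "convex \<Theta>" and "open \<Theta>" and "\<theta>0 \<in> \<Theta>"
    and "ito_process M T F w b (\<lambda>t \<omega>. vol (X t \<omega>) \<theta>0) Y"
    and maximizer: "\<And>n \<omega>. n \<ge> 1 \<Longrightarrow> \<omega> \<in> space M \<Longrightarrow>
      is_arg_max (quasi_loglik T X Y n \<omega>) (\<lambda>\<theta>. \<theta> \<in> closure \<Theta>) (\<theta>h n \<omega>)"
    and "cond_V1 M T X b" and "cond_V2 M T X"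
  shows "cond_A1 M \<Theta> \<theta>0 (quasi_loglik T X Y) \<and>
    cond_A3 M \<Theta> \<theta>0 (quasi_loglik T X Y) \<and>
    converges_in_prob M \<theta>h (\<lambda>_. \<theta>0) \<and>
    (\<forall>\<pi>. prior_densities \<Theta> \<pi> \<and> cond_A2 \<Theta> \<theta>0 \<pi> \<and> log_prior_consistent M \<theta>0 \<theta>h \<pi> \<longrightarrow>
       marginal_expansion_hyps M \<Theta> \<theta>0 (quasi_loglik T X Y) \<theta>h \<pi>) \<and>
    (\<forall>n\<ge>1. \<forall>\<omega>\<in>space M.
       qbic (quasi_loglik T X Y n \<omega>) (\<theta>h n \<omega>) =
         (\<Sum>j=1..n. X (obs_time T n (j - 1)) \<omega> \<bullet> \<theta>h n \<omega> +
            1 / step T n * (increment T Y n j \<omega>)\<^sup>2 *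
              exp (- (X (obs_time T n (j - 1)) \<omega> \<bullet> \<theta>h n \<omega>))) +
         ln (det ((1 / (2 * step T n)) *\<^sub>R
            (\<Sum>j=1..n. ((increment T Y n j \<omega>)\<^sup>2 *
               exp (- (X (obs_time T n (j - 1)) \<omega> \<bullet> \<theta>h n \<omega>))) *\<^sub>R
               outer_square (X (obs_time T n (j - 1)) \<omega>)))))"
proof -
  interpret prob_space M by fact
  interpret volatility_regression M T F w b X Y \<theta>0
    by unfold_locales (use assms in auto)
  have A1: "cond_A1 M \<Theta> \<theta>0 (quasi_loglik T X Y)"
    using \<open>bounded \<Theta>\<close> by (rule cond_A1_quasi_loglik)
  have A3: "cond_A3 M \<Theta> \<theta>0 (quasi_loglik T X Y)"
    using \<open>bounded \<Theta>\<close> by (rule cond_A3_quasi_loglik)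
  have consistent: "converges_in_prob M \<theta>h (\<lambda>_. \<theta>0)"
    using \<open>bounded \<Theta>\<close> \<open>\<theta>0 \<in> \<Theta>\<close> maximizer by (rule estimator_consistent)
  show ?thesis
    using A1 A3 consistent qbic_quasi_loglik[of T X Y]
    unfolding marginal_expansion_hyps_def by blast
qed

end
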